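(* Let $n\ge3$ be an odd number and $h_n:=(n-1)/2$. Let $T\in\mathcal{BC}^1(V_n)$ be such that its components $T_i$, $i=1,\dots,n$, have real spectra. Let $U$ be a bounded slice Cauchy domain with $\sigma_S(T)\subset U$, let $f$ be an intrinsic slice hyperholomorphic function and $g$ a left slice hyperholomorphic function, with $\overline U\subset\mathrm{dom}(f)\cap\mathrm{dom}(g)$. Then $$\Delta_{n+1}^{h_n}(fg)(T)=(\Delta_{n+1}^{h_n}f)(T)\,g(T)+f(T)\,(\Delta_{n+1}^{h_n}g)(T)+\sum_{i=0}^{h_n-2}(\Delta_{n+1}^{h_n-i-1}f)(T)\,(\Delta_{n+1}^{i+1}g)(T)-\sum_{i=0}^{h_n-1}(D\Delta_{n+1}^{h_n-i-1}f)(T)\,(D\Delta_{n+1}^{i}g)(T),$$ where $\sum_{i=0}^{-1}$ is understood as zero.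
   Context: $\mathbb R_n$ is the real Clifford algebra generated by $e_1,\dots,e_n$ with $e_ie_j+e_je_i=-2\delta_{ij}$. A point $(x_0,\dots,x_n)\in\mathbb R^{n+1}$ is identified with the paravector $x=x_0+\underline x$, $\underline x=\sum_{j=1}^n x_je_j$ (with $e_0=1$). $\mathbb S$ is the set of $\underline x$ with $|\underline x|=1$; for $I\in\mathbb S$, $\mathbb C_I=\mathbb R+I\mathbb R$. $[x]=\{x_0+I|\underline x|: I\in\mathbb S\}$. An open $U\subset\mathbb R^{n+1}$ is axially symmetric if $[x]\subset U$ for all $x\in U$; it is a slice Cauchy domain if it is axially symmetric and, for every $I\in\mathbb S$, $\partial(U\cap\mathbb C_I)$ is a finite union of non-intersecting piecewise continuously differentiable Jordan curves in $\mathbb C_I$ (positively oriented). $ds_I=ds(-I)$. For $U$ axially symmetric open let $\mathcal U=\{(u,v)\in\mathbb R^2: u+\mathbb S v\subset U\}$. $f:U\to\mathbb R_n$ is left slice hyperholomorphic if $f(u+Iv)=a(u,v)+I\,b(u,v)$ for all $I\in\mathbb S$, $(u,v)\in\mathcal U$, with differentiable $a,b:\mathcal U\to\mathbb R_n$ satisfying $a(u,-v)=a(u,v)$, $b(u,-v)=-b(u,v)$ and $\partial_ua=\partial_vb$, $\partial_va=-\partial_ub$; it is intrinsic if $a,b$ are real-valued. Domains $\mathrm{dom}(\cdot)$ are axially symmetric open sets. $D=\partial_{x_0}+\sum_{i}e_i\partial_{x_i}$, $\Delta_{n+1}=\sum_{j=0}^n\partial_{x_j}^2$. $V$ is a real Banach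 space, $\mathcal B(V)$ its bounded linear operators, $V_n=V\otimes\mathbb R_n$ the two-sided Banach $\mathbb R_n$-module, $\mathcal B(V_n)$ the set of $\sum_A T_Ae_A$, $T_A\in\mathcal B(V)$, with $(\sum_AT_Ae_A)(\sum_Bv_Be_B)=\sum_{A,B}T_A(v_B)e_Ae_B$; $\mathbb R_n$ is embedded via $a\mapsto\mathcal I a$. $\mathcal{BC}^{0,1}(V_n)$ is the set of $T=\sum_{\mu=0}^ne_\mu T_\mu$ with pairwise commuting $T_\mu\in\mathcal B(V)$; $\mathcal{BC}^1(V_n)$ is the subset with $T_0=0$. $\overline T=T_0-\sum_{\mu\ge1}e_\mu T_\mu$. $\sigma_S(T)$ is the set of $s\in\mathbb R^{n+1}$ such that $T^2-2s_0T+|s|^2\mathcal I$ is not invertible in $\mathcal B(V_n)$ (equivalently, for commuting components, $\mathcal Q_{c,s}(T):=s^2\mathcal I-s(T+\overline T)+T\overline T$ is not invertible in $\mathcal B(V_n)$). The spectrum of $T_i$ is the usual one (in the complexification of $V$). Functional calculi: for a left slice hyperholomorphic $\phi$ with $\overline U\subset\mathrm{dom}(\phi)$ and any $I\in\mathbb S$, each of the following operators is $\frac1{2\pi}\int_{\partial(U\cap\mathbb C_I)}R(s)\,ds_I\,\phi(s)$ with the indicated resolvent $R(s)$ (independent of $U$ and $I$): - $\phi(T)$ ($S$-functional calculus): $R(s)=(s\mathcal I-\overline T)\mathcal Q_{c,s}(T)^{-1}$; - $(\Delta_{n+1}^{h_n}\phi)(T)$ ($F$-functional calculus): $R(s)=\gamma_n(s\mathcal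 I-\overline T)\mathcal Q_{c,s}(T)^{-h_n-1}$, $\gamma_n=[\Gamma(\frac{n+1}2)]^22^{n-1}(-1)^{\frac{n-1}2}$; - $(\Delta_{n+1}^{\alpha}\phi)(T)$, $1\le\alpha\le h_n-1$ (holomorphic Cliffordian functional calculus): $R(s)=4^\alpha\alpha!\,(-h_n)_\alpha(s\mathcal I-\overline T)\mathcal Q_{c,s}(T)^{-\alpha-1}$; - $(D\Delta_{n+1}^{\ell-1}\phi)(T)$, $1\le\ell\le h_n$ (polyharmonic functional calculus): $R(s)=2^{2\ell-1}(\ell-1)!\,(-h_n)_\ell\,\mathcal Q_{c,s}(T)^{-\ell}$. Here $(-h_n)_m=(-1)^m\frac{h_n!}{(h_n-m)!}$. For intrinsic $\phi$ these left versions coincide with the corresponding right versions (with $\phi(s)\,ds_I$ on the left of the right resolvent operators). $\Delta_{n+1}^{h_n}(fg)(T)$ is the $F$-functional calculus of the left slice hyperholomorphic function $\phi=fg$. *)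

theory Defs
  imports "HOL-Complex_Analysis.Winding_Numbers"
begin

section \<open>Clifford algebras with coefficients\<close>

text \<open>
  The dimension n is \<open>CARD('n)\<close>; the order of \<open>'n\<close> is only used to fix the order of the factors in
  the basis elements \<open>e_A = e_{i1} \<dots> e_{ir}\<close>, \<open>A = {i1 < \<dots> < ir}\<close>.  A vector \<open>x :: 'a ^ ('n set)\<close>
  stands for the sum of the \<open>x $ A\<close> times \<open>e_A\<close>: the Clifford algebra is \<open>real ^ ('n set)\<close>, the module
  \<open>V_n\<close> is \<open>'v ^ ('n set)\<close>, and \<open>B(V_n)\<close> is \<open>('v \<Rightarrow>\<^sub>L 'v) ^ ('n set)\<close>.
  The library's operations \<open>*\<close> and \<open>1\<close> on these types are componentwise and are not the Clifford
  operations.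
\<close>

text \<open>\<open>e_A e_B = cl_sign A B e_{A \<triangle> B}\<close>: one sign for each transposition, and one for each square
  \<open>e_i e_i = -1\<close>.\<close>

definition cl_sign :: "'n::{finite,linorder} set \<Rightarrow> 'n set \<Rightarrow> real" where
  "cl_sign A B = (-1) ^ card {(a, b). a \<in> A \<and> b \<in> B \<and> b \<le> a}"

definition cl_prod :: "('a \<Rightarrow> 'b \<Rightarrow> 'c::real_vector) \<Rightarrow> 'a ^ ('n::{finite,linorder} set) \<Rightarrow>
    'b ^ ('n set) \<Rightarrow> 'c ^ ('n set)" where
  "cl_prod p x y =
     (\<Sum>A\<in>UNIV. \<Sum>B\<in>UNIV. axis (sym_diff A B) (cl_sign A B *\<^sub>R p (x $ A) (y $ B)))"

abbreviation cl_times :: "real ^ ('n::{finite,linorder} set) \<Rightarrow> real ^ ('n set) \<Rightarrow> real ^ ('n set)"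
    (infixl "\<odot>" 70) where
  "x \<odot> y \<equiv> cl_prod (*) x y"

type_synonym ('v, 'n) cl_op = "('v \<Rightarrow>\<^sub>L 'v) ^ ('n set)"

abbreviation op_times :: "('v::real_normed_vector, 'n::{finite,linorder}) cl_op \<Rightarrow> ('v, 'n) cl_op \<Rightarrow>
    ('v, 'n) cl_op" (infixl "\<otimes>" 70) where
  "S \<otimes> T \<equiv> cl_prod (o\<^sub>L) S T"

definition op_apply :: "('v::real_normed_vector, 'n::{finite,linorder}) cl_op \<Rightarrow> 'v ^ ('n set) \<Rightarrow>
    'v ^ ('n set)" where
  "op_apply T v = cl_prod blinfun_apply T v"

definition op_one :: "('v::real_normed_vector, 'n::finite) cl_op" where
  "op_one = axis {} id_blinfun"

definition cl_emb :: "real ^ ('n::finite set) \<Rightarrow> ('v::real_normed_vector, 'n) cl_op" where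
  "cl_emb a = (\<chi> A. (a $ A) *\<^sub>R id_blinfun)"

definition op_power :: "('v::real_normed_vector, 'n::{finite,linorder}) cl_op \<Rightarrow> nat \<Rightarrow>
    ('v, 'n) cl_op" where
  "op_power T k = (((\<otimes>) T) ^^ k) op_one"

definition op_invertible :: "('v::real_normed_vector, 'n::{finite,linorder}) cl_op \<Rightarrow> bool" where
  "op_invertible T \<longleftrightarrow> (\<exists>S. T \<otimes> S = op_one \<and> S \<otimes> T = op_one)"

definition op_inv :: "('v::real_normed_vector, 'n::{finite,linorder}) cl_op \<Rightarrow> ('v, 'n) cl_op" where
  "op_inv T = (THE S. T \<otimes> S = op_one \<and> S \<otimes> T = op_one)"

text \<open>\<open>c_0 + e_1 c_1 + \<dots> + e_n c_n\<close>\<close>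

definition paravec :: "'a::real_vector \<Rightarrow> ('n::finite \<Rightarrow> 'a) \<Rightarrow> 'a ^ ('n set)" where
  "paravec c0 c = axis {} c0 + (\<Sum>i\<in>UNIV. axis {i} (c i))"


subsection \<open>The algebra laws\<close>

lemma cl_sign_prod: "cl_sign A B = (\<Prod>a\<in>A. \<Prod>b\<in>B. if b \<le> a then -1 else 1)"
proof -
  have "{(a, b). a \<in> A \<and> b \<in> B \<and> b \<le> a} = (A \<times> B) \<inter> {x. snd x \<le> fst x}"
    by auto
  then show ?thesis
    unfolding cl_sign_def prod.cartesian_product
    by (simp add: prod.If_cases case_prod_beta)
qed

lemma cl_sign_commute_prod: "cl_sign A B = (\<Prod>b\<in>B. \<Prod>a\<in>A. if b \<le> a then -1 else 1)"
  unfolding cl_sign_prod by (rule prod.swap)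

lemma prod_sym_diff:
  fixes f :: "'n::finite \<Rightarrow> real"
  assumes "\<And>x. f x * f x = 1"
  shows "prod f (sym_diff A B) = prod f A * prod f B"
proof -
  have A: "prod f A = prod f (A - B) * prod f (A \<inter> B)"
    using prod.Int_Diff[of A f B] by (simp add: mult.commute)
  have B: "prod f B = prod f (B - A) * prod f (A \<inter> B)"
    using prod.Int_Diff[of B f A] by (simp add: mult.commute Int_commute)
  have "prod f (A \<inter> B) * prod f (A \<inter> B) = 1"
    by (simp add: prod.distrib[symmetric] assms)
  moreover have "prod f (sym_diff A B) = prod f (A - B) * prod f (B - A)"
    by (rule prod.union_disjoint) auto
  ultimately show ?thesis
    using A B by (simp add: algebra_simps)
qed

lemma cl_sign_square: "cl_sign A B * cl_sign A B = 1"
  by (simp add: cl_sign_def power_mult_distrib[symmetric])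

lemma cl_sign_sym_diff_left: "cl_sign (sym_diff A B) C = cl_sign A C * cl_sign B C"
  unfolding cl_sign_prod
  by (rule prod_sym_diff) (auto simp: prod.distrib[symmetric] intro!: prod.neutral)

lemma cl_sign_sym_diff_right: "cl_sign A (sym_diff B C) = cl_sign A B * cl_sign A C"
  unfolding cl_sign_commute_prod
  by (rule prod_sym_diff) (auto simp: prod.distrib[symmetric] intro!: prod.neutral)

lemma cl_sign_empty [simp]: "cl_sign {} A = 1" "cl_sign A {} = 1"
  by (simp_all add: cl_sign_prod)

lemma cl_prod_axis:
  assumes "\<And>y. p 0 y = 0" "\<And>x. p x 0 = 0"
  shows "cl_prod p (axis A a) (axis B b) = axis (sym_diff A B) (cl_sign A B *\<^sub>R p a b)"
proof -
  have z: "axis k (0::'z::zero) = 0" for k :: "'k::finite"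
    by (simp add: axis_def vec_eq_iff)
  have "cl_prod p (axis A a) (axis B b) = (\<Sum>A'\<in>UNIV. if A' = A then
      (\<Sum>B'\<in>UNIV. if B' = B then axis (sym_diff A B) (cl_sign A B *\<^sub>R p a b) else 0) else 0)"
    unfolding cl_prod_def
  proof (intro sum.cong refl)
    fix A' :: "'d set"
    have "axis A a $ A' = (if A' = A then a else 0)" "axis B b $ B' = (if B' = B then b else 0)" for B'
      by (auto simp: axis_def)
    then have "axis (sym_diff A' B') (cl_sign A' B' *\<^sub>R p (axis A a $ A') (axis B b $ B')) =
        (if A' = A then if B' = B then axis (sym_diff A B) (cl_sign A B *\<^sub>R p a b) else 0 else 0)" for B'
      by (simp add: assms z)
    then show "(\<Sum>B'\<in>UNIV. axis (sym_diff A' B') (cl_sign A' B' *\<^sub>R p (axis A a $ A') (axis B b $ B'))) =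
        (if A' = A then \<Sum>B'\<in>UNIV. if B' = B then axis (sym_diff A B) (cl_sign A B *\<^sub>R p a b) else 0
         else 0)"
      by simp
  qed
  then show ?thesis
    by simp
qed

lemma vec_eq_sum_axis: "(x :: 'a::comm_monoid_add ^ 'k::finite) = (\<Sum>k\<in>UNIV. axis k (x $ k))"
  by (simp add: vec_eq_iff axis_def)

lemma axis_add_eq: "axis k (x + y) = axis k x + axis k (y::'a::monoid_add)"
  by (simp add: axis_def vec_eq_iff)

lemma
  assumes "bounded_bilinear p"
  shows cl_prod_add_left: "cl_prod p (x + x') y = cl_prod p x y + cl_prod p x' y"
    and cl_prod_add_right: "cl_prod p x (y + y') = cl_prod p x y + cl_prod p x y'"
    and cl_prod_scaleR_left: "cl_prod p (r *\<^sub>R x) y = r *\<^sub>R cl_prod p x y"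
    and cl_prod_scaleR_right: "cl_prod p x (r *\<^sub>R y) = r *\<^sub>R cl_prod p x y"
proof -
  interpret bounded_bilinear p by fact
  have s: "axis k (r *\<^sub>R z) = r *\<^sub>R axis k (z::'c)" for k :: "'d set" and r z
    by (simp add: axis_def vec_eq_iff)
  show "cl_prod p (x + x') y = cl_prod p x y + cl_prod p x' y"
    "cl_prod p x (y + y') = cl_prod p x y + cl_prod p x y'"
    by (simp_all add: cl_prod_def add_left add_right scaleR_add_right axis_add_eq sum.distrib)
  show "cl_prod p (r *\<^sub>R x) y = r *\<^sub>R cl_prod p x y" "cl_prod p x (r *\<^sub>R y) = r *\<^sub>R cl_prod p x y"
    by (simp_all add: cl_prod_def scaleR_left scaleR_right scaleR_sum_right s[symmetric]
        mult.commute)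
qed

lemma
  assumes "bounded_bilinear p"
  shows cl_prod_sum_left: "cl_prod p (sum X S) y = (\<Sum>k\<in>S. cl_prod p (X k) y)"
    and cl_prod_sum_right: "cl_prod p x (sum Y S) = (\<Sum>k\<in>S. cl_prod p x (Y k))"
proof -
  have "Modules.additive (\<lambda>x. cl_prod p x y)"
    by (simp add: Modules.additive_def cl_prod_add_left assms)
  then show "cl_prod p (sum X S) y = (\<Sum>k\<in>S. cl_prod p (X k) y)"
    by (rule Modules.additive.sum)
  have "Modules.additive (cl_prod p x)"
    by (simp add: Modules.additive_def cl_prod_add_right assms)
  then show "cl_prod p x (sum Y S) = (\<Sum>k\<in>S. cl_prod p x (Y k))"
    by (rule Modules.additive.sum)
qed

lemma sym_diff_assoc: "sym_diff (sym_diff A B) C = sym_diff A (sym_diff B C)"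
  by blast

lemma cl_prod_assoc:
  assumes p: "bounded_bilinear p" and q: "bounded_bilinear q"
    and r: "bounded_bilinear r" and s: "bounded_bilinear s"
    and pq: "\<And>a b c. p (q a b) c = r a (s b c)"
  shows "cl_prod p (cl_prod q x y) z = cl_prod r x (cl_prod s y z)"
proof -
  note zeros = bounded_bilinear.zero_left bounded_bilinear.zero_right
  have 1: "cl_prod p (cl_prod q (axis A a) (axis B b)) (axis C c) =
      cl_prod r (axis A a) (cl_prod s (axis B b) (axis C c))" for A B C a b c
    by (simp add: cl_prod_axis p q r s zeros[OF p] zeros[OF q] zeros[OF r] zeros[OF s] pq
        cl_sign_sym_diff_left cl_sign_sym_diff_right bounded_bilinear.scaleR_left[OF p]
        bounded_bilinear.scaleR_right[OF r] mult.commute mult.left_commute)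
      (simp only: sym_diff_assoc)
  have "cl_prod p (cl_prod q x y) z = cl_prod p (cl_prod q (\<Sum>A\<in>UNIV. axis A (x $ A))
      (\<Sum>B\<in>UNIV. axis B (y $ B))) (\<Sum>C\<in>UNIV. axis C (z $ C))"
    by (simp only: vec_eq_sum_axis[symmetric])
  also have "\<dots> = cl_prod r (\<Sum>A\<in>UNIV. axis A (x $ A))
      (cl_prod s (\<Sum>B\<in>UNIV. axis B (y $ B)) (\<Sum>C\<in>UNIV. axis C (z $ C)))"
    by (simp only: cl_prod_sum_left[OF p] cl_prod_sum_left[OF q] cl_prod_sum_left[OF r]
        cl_prod_sum_left[OF s] cl_prod_sum_right[OF p] cl_prod_sum_right[OF q]
        cl_prod_sum_right[OF r] cl_prod_sum_right[OF s] 1)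
  also have "\<dots> = cl_prod r x (cl_prod s y z)"
    by (simp only: vec_eq_sum_axis[symmetric])
  finally show ?thesis .
qed

lemma cl_times_assoc: "(x \<odot> y) \<odot> z = x \<odot> (y \<odot> z)"
  by (rule cl_prod_assoc) (auto intro: bounded_bilinear_mult simp: mult.assoc)

lemma op_times_assoc: "(R \<otimes> S) \<otimes> T = R \<otimes> (S \<otimes> T)"
  by (rule cl_prod_assoc)
    (auto intro: bounded_bilinear_blinfun_compose intro!: blinfun_eqI)

lemma op_apply_times: "op_apply (S \<otimes> T) v = op_apply S (op_apply T v)"
  unfolding op_apply_def
  by (rule cl_prod_assoc)
    (auto intro: bounded_bilinear_blinfun_compose bounded_bilinear_blinfun_apply)

lemma generators:
  fixes i j :: "'n::{finite,linorder}"
  shows "axis {i} 1 \<odot> axis {j} 1 + axis {j} 1 \<odot> axis {i} 1 = axis {} (if i = j then -2 else 0)"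
proof -
  have "sym_diff {j} {i} = sym_diff {i} {j}"
    by blast
  then have *: "axis {i} 1 \<odot> axis {j} 1 + axis {j} 1 \<odot> axis {i} 1 =
      axis (sym_diff {i} {j}) (cl_sign {i} {j} + cl_sign {j} {i})"
    by (simp add: cl_prod_axis axis_add_eq)
  have z: "axis k 0 = (0 :: real ^ ('n set))" for k :: "'n set"
    by (simp add: axis_def vec_eq_iff)
  show ?thesis
    using linear[of i j] unfolding * by (cases "i = j") (auto simp: cl_sign_prod z)
qed

lemma basis_insert:
  assumes "\<And>b. b \<in> A \<Longrightarrow> a < b"
  shows "axis {a} 1 \<odot> axis A 1 = axis (insert a A) 1"
proof -
  have "cl_sign {a} A = 1"
    using assms by (auto simp: cl_sign_prod not_le intro!: prod.neutral)
  moreover have "sym_diff {a} A = insert a A"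
    using assms by blast
  ultimately show ?thesis
    by (simp add: cl_prod_axis)
qed

lemma op_apply_inject: "op_apply S = op_apply T \<longleftrightarrow> S = T"
proof
  assume eq: "op_apply S = op_apply T"
  have "(op_apply R (axis {} v)) $ A = (R $ A) v" for R :: "('v::real_normed_vector, 'n::{finite,linorder}) cl_op" and A v
  proof -
    have "op_apply R (axis {} v) = (\<Sum>A\<in>UNIV. cl_prod blinfun_apply (axis A (R $ A)) (axis {} v))"
      unfolding op_apply_def
      by (subst vec_eq_sum_axis[of R]) (rule cl_prod_sum_left[OF bounded_bilinear_blinfun_apply])
    also have "\<dots> = (\<Sum>A\<in>UNIV. axis A ((R $ A) v))"
      by (simp add: cl_prod_axis blinfun.zero_left blinfun.zero_right)
    finally show ?thesis
      by (simp add: axis_def)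
  qed
  then show "S = T"
    using eq by (metis vec_eq_iff blinfun_eqI)
qed simp

lemma op_times_one: "op_one \<otimes> T = T" "T \<otimes> op_one = T"
proof -
  note b = bounded_bilinear_blinfun_compose
  have c: "id_blinfun o\<^sub>L t = t" "t o\<^sub>L id_blinfun = t" for t :: "'a \<Rightarrow>\<^sub>L 'a"
    by (auto intro: blinfun_eqI)
  have "op_one \<otimes> (\<Sum>A\<in>UNIV. axis A (T $ A)) = (\<Sum>A\<in>UNIV. axis A (T $ A))"
    "(\<Sum>A\<in>UNIV. axis A (T $ A)) \<otimes> op_one = (\<Sum>A\<in>UNIV. axis A (T $ A))"
    unfolding op_one_def cl_prod_sum_left[OF b] cl_prod_sum_right[OF b]
    by (simp_all add: cl_prod_axis b bounded_bilinear.zero_left[OF b] bounded_bilinear.zero_right[OF b] c)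
  then show "op_one \<otimes> T = T" "T \<otimes> op_one = T"
    by (simp_all only: vec_eq_sum_axis[symmetric])
qed


section \<open>Slice hyperholomorphic functions\<close>

text \<open>The point \<open>(x_0, (x_1, \<dots>, x_n))\<close>.  A unit vector \<open>I\<close>, \<open>norm I = 1\<close>, is an element of the sphere
  of imaginary units.\<close>

type_synonym 'n point = "real \<times> (real ^ 'n)"

definition cl_of_point :: "'n::finite point \<Rightarrow> real ^ ('n set)" where
  "cl_of_point x = paravec (fst x) (\<lambda>i. snd x $ i)"

text \<open>\<open>u + I v\<close>\<close>

definition slice_point :: "real ^ 'n::finite \<Rightarrow> real \<times> real \<Rightarrow> 'n point" where
  "slice_point I p = (fst p, snd p *\<^sub>R I)"

definition point_class :: "'n::finite point \<Rightarrow> 'n point set" where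
  "point_class x = {slice_point I (fst x, norm (snd x)) | I. norm I = 1}"

definition axially_symmetric :: "'n::finite point set \<Rightarrow> bool" where
  "axially_symmetric U \<longleftrightarrow> (\<forall>x\<in>U. point_class x \<subseteq> U)"

definition uv_set :: "'n::finite point set \<Rightarrow> (real \<times> real) set" where
  "uv_set U = {p. \<forall>I. norm I = 1 \<longrightarrow> slice_point I p \<in> U}"

text \<open>The intersection of \<open>U\<close> with the plane of \<open>I\<close>, which is identified with the complex plane
  through \<open>u + I v \<mapsto> u + \<i> v\<close>.\<close>

definition slice :: "real ^ 'n::finite \<Rightarrow> 'n point set \<Rightarrow> complex set" where
  "slice I U = {z. slice_point I (Re z, Im z) \<in> U}"

definition slice_components :: "'n::{finite,linorder} point set \<Rightarrow> ('n point \<Rightarrow> real ^ ('n set)) \<Rightarrow>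
    (real \<times> real \<Rightarrow> real ^ ('n set)) \<Rightarrow> (real \<times> real \<Rightarrow> real ^ ('n set)) \<Rightarrow> bool" where
  "slice_components U f a b \<longleftrightarrow>
     (\<forall>I. norm I = 1 \<longrightarrow> (\<forall>p\<in>uv_set U.
        f (slice_point I p) = a p + cl_of_point (0, I) \<odot> b p)) \<and>
     (\<forall>u v. (u, v) \<in> uv_set U \<longrightarrow> a (u, - v) = a (u, v) \<and> b (u, - v) = - b (u, v)) \<and>
     (\<forall>p\<in>uv_set U. a differentiable (at p) \<and> b differentiable (at p) \<and>
        frechet_derivative a (at p) (1, 0) = frechet_derivative b (at p) (0, 1) \<and>
        frechet_derivative a (at p) (0, 1) = - frechet_derivative b (at p) (1, 0))"

text \<open>\<open>f\<close> is left slice hyperholomorphic with domain \<open>U\<close>; its values outside \<open>U\<close> are irrelevant.\<close>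

definition left_slice_hyperholomorphic ::
    "'n::{finite,linorder} point set \<Rightarrow> ('n point \<Rightarrow> real ^ ('n set)) \<Rightarrow> bool" where
  "left_slice_hyperholomorphic U f \<longleftrightarrow>
     open U \<and> axially_symmetric U \<and> (\<exists>a b. slice_components U f a b)"

definition intrinsic_slice_hyperholomorphic ::
    "'n::{finite,linorder} point set \<Rightarrow> ('n point \<Rightarrow> real ^ ('n set)) \<Rightarrow> bool" where
  "intrinsic_slice_hyperholomorphic U f \<longleftrightarrow>
     open U \<and> axially_symmetric U \<and>
     (\<exists>a b. slice_components U f a b \<and>
       (\<forall>p\<in>uv_set U. a p \<in> range (axis {}) \<and> b p \<in> range (axis {})))"

text \<open>The closed paths in \<open>\<Gamma>\<close> are disjoint piecewise continuously differentiable Jordan curves which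
  together parametrize the boundary of the plane set \<open>W\<close>.  They are positively oriented, that is,
  they wind once around the points of \<open>W\<close> and do not wind around the points outside the closure.\<close>

definition oriented_boundary :: "(real \<Rightarrow> complex) set \<Rightarrow> complex set \<Rightarrow> bool" where
  "oriented_boundary \<Gamma> W \<longleftrightarrow>
     finite \<Gamma> \<and>
     (\<forall>\<gamma>\<in>\<Gamma>. valid_path \<gamma> \<and> simple_path \<gamma> \<and> pathfinish \<gamma> = pathstart \<gamma>) \<and>
     pairwise (\<lambda>\<gamma> \<delta>. path_image \<gamma> \<inter> path_image \<delta> = {}) \<Gamma> \<and>
     (\<Union>\<gamma>\<in>\<Gamma>. path_image \<gamma>) = frontier W \<and>
     (\<forall>z\<in>W. (\<Sum>\<gamma>\<in>\<Gamma>. winding_number \<gamma> z) = 1) \<and>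
     (\<forall>z. z \<notin> closure W \<longrightarrow> (\<Sum>\<gamma>\<in>\<Gamma>. winding_number \<gamma> z) = 0)"

definition slice_Cauchy_domain :: "'n::finite point set \<Rightarrow> bool" where
  "slice_Cauchy_domain U \<longleftrightarrow> open U \<and> axially_symmetric U \<and>
     (\<forall>I. norm I = 1 \<longrightarrow> (\<exists>\<Gamma>. oriented_boundary \<Gamma> (slice I U)))"


section \<open>Operators with commuting components\<close>

definition BC01 :: "('v::real_normed_vector, 'n::finite) cl_op set" where
  "BC01 = {paravec T0 T | T0 T.
     (\<forall>i. T0 o\<^sub>L T i = T i o\<^sub>L T0) \<and> (\<forall>i j. T i o\<^sub>L T j = T j o\<^sub>L T i)}"

definition BC1 :: "('v::real_normed_vector, 'n::finite) cl_op set" where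
  "BC1 = {T \<in> BC01. T $ {} = 0}"

definition component :: "('v::real_normed_vector, 'n::finite) cl_op \<Rightarrow> 'n \<Rightarrow> 'v \<Rightarrow>\<^sub>L 'v" where
  "component T i = T $ {i}"

text \<open>\<open>T_0 - e_1 T_1 - \<dots> - e_n T_n\<close>\<close>

definition op_conj :: "('v::real_normed_vector, 'n::finite) cl_op \<Rightarrow> ('v, 'n) cl_op" where
  "op_conj T = paravec (T $ {}) (\<lambda>i. - component T i)"

definition S_spectrum :: "('v::real_normed_vector, 'n::{finite,linorder}) cl_op \<Rightarrow> 'n point set" where
  "S_spectrum T =
     {s. \<not> op_invertible (T \<otimes> T - (2 * fst s) *\<^sub>R T + (norm s)\<^sup>2 *\<^sub>R op_one)}"

definition Q_op :: "('v::real_normed_vector, 'n::{finite,linorder}) cl_op \<Rightarrow> 'n point \<Rightarrow>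
    ('v, 'n) cl_op" where
  "Q_op T s = cl_emb (cl_of_point s \<odot> cl_of_point s) - cl_emb (cl_of_point s) \<otimes> (T + op_conj T)
     + T \<otimes> op_conj T"

text \<open>The complexification of \<open>'v\<close> is \<open>'v \<times> 'v\<close>, where \<open>(x, y)\<close> stands for \<open>x + \<i> y\<close>.\<close>

definition cscale :: "complex \<Rightarrow> 'v::real_vector \<times> 'v \<Rightarrow> 'v \<times> 'v" where
  "cscale c p = (Re c *\<^sub>R fst p - Im c *\<^sub>R snd p, Re c *\<^sub>R snd p + Im c *\<^sub>R fst p)"

definition spectrum :: "('v::real_normed_vector \<Rightarrow>\<^sub>L 'v) \<Rightarrow> complex set" where
  "spectrum A = {c. \<not> (\<exists>S :: ('v \<times> 'v) \<Rightarrow>\<^sub>L ('v \<times> 'v).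
     (\<forall>p. S (map_prod A A p - cscale c p) = p) \<and> (\<forall>p. map_prod A A (S p) - cscale c (S p) = p))}"


section \<open>Functional calculi\<close>

text \<open>The integral of \<open>R(s) ds_I \<phi>(s)\<close> along \<open>\<gamma>\<close>, where \<open>s = \<gamma>(t)\<close>, \<open>ds_I = \<gamma>'(t) dt (-I)\<close>.\<close>

definition slice_integral :: "('n::{finite,linorder} point \<Rightarrow> ('v::banach, 'n) cl_op) \<Rightarrow>
    ('n point \<Rightarrow> real ^ ('n set)) \<Rightarrow> (real, 'n) vec \<Rightarrow> (real \<Rightarrow> complex) \<Rightarrow> ('v, 'n) cl_op" where
  "slice_integral R \<phi> I \<gamma> = integral {0..1} (\<lambda>t.
     let s = slice_point I (Re (\<gamma> t), Im (\<gamma> t));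
         d = vector_derivative \<gamma> (at t within {0..1});
         ds_I = cl_of_point (slice_point I (Re d, Im d)) \<odot> (- cl_of_point (0, I))
     in R s \<otimes> cl_emb ds_I \<otimes> cl_emb (\<phi> s))"

text \<open>The common value, for all admissible \<open>U\<close>, \<open>I\<close> and all parametrizations of the boundary, of
  \<open>1/(2\<pi>)\<close> times the integral; \<open>\<Omega>\<close> is the domain of \<open>\<phi>\<close>.\<close>

definition calculus :: "('v::banach, 'n::{finite,linorder}) cl_op \<Rightarrow> ('n point \<Rightarrow> ('v, 'n) cl_op) \<Rightarrow>
    'n point set \<Rightarrow> ('n point \<Rightarrow> real ^ ('n set)) \<Rightarrow> ('v, 'n) cl_op" where
  "calculus T R \<Omega> \<phi> = (THE A. \<forall>U I \<Gamma>.
     bounded U \<and> slice_Cauchy_domain U \<and> S_spectrum T \<subseteq> U \<and> closure U \<subseteq> \<Omega> \<and>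
     norm I = 1 \<and> oriented_boundary \<Gamma> (slice I U) \<longrightarrow>
       A = (1 / (2 * pi)) *\<^sub>R (\<Sum>\<gamma>\<in>\<Gamma>. slice_integral R \<phi> I \<gamma>))"

text \<open>\<open>h_n = (n - 1) / 2\<close>\<close>

definition h_of :: "'n::finite itself \<Rightarrow> nat" where
  "h_of _ = (CARD('n) - 1) div 2"

definition gamma_of :: "'n::finite itself \<Rightarrow> real" where
  "gamma_of _ = (Gamma ((real CARD('n) + 1) / 2))\<^sup>2 * 2 ^ (CARD('n) - 1) * (-1) ^ ((CARD('n) - 1) div 2)"

text \<open>\<open>\<phi>(T)\<close>\<close>

definition S_calculus :: "('v::banach, 'n::{finite,linorder}) cl_op \<Rightarrow> 'n point set \<Rightarrow>
    ('n point \<Rightarrow> real ^ ('n set)) \<Rightarrow> ('v, 'n) cl_op" where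
  "S_calculus T = calculus T (\<lambda>s. (cl_emb (cl_of_point s) - op_conj T) \<otimes> op_inv (Q_op T s))"

text \<open>\<open>(\<Delta>\<^sup>h \<phi>)(T)\<close> with \<open>h = h_n\<close>\<close>

definition F_calculus :: "('v::banach, 'n::{finite,linorder}) cl_op \<Rightarrow> 'n point set \<Rightarrow>
    ('n point \<Rightarrow> real ^ ('n set)) \<Rightarrow> ('v, 'n) cl_op" where
  "F_calculus T = calculus T (\<lambda>s. gamma_of TYPE('n) *\<^sub>R
     ((cl_emb (cl_of_point s) - op_conj T) \<otimes> op_power (op_inv (Q_op T s)) (h_of TYPE('n) + 1)))"

text \<open>\<open>(\<Delta>\<^sup>\<alpha> \<phi>)(T)\<close> for \<open>1 \<le> \<alpha> \<le> h_n - 1\<close>\<close>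

definition Cliffordian_calculus :: "nat \<Rightarrow> ('v::banach, 'n::{finite,linorder}) cl_op \<Rightarrow>
    'n point set \<Rightarrow> ('n point \<Rightarrow> real ^ ('n set)) \<Rightarrow> ('v, 'n) cl_op" where
  "Cliffordian_calculus \<alpha> T = calculus T (\<lambda>s.
     (4 ^ \<alpha> * fact \<alpha> * pochhammer (- real (h_of TYPE('n))) \<alpha>) *\<^sub>R
     ((cl_emb (cl_of_point s) - op_conj T) \<otimes> op_power (op_inv (Q_op T s)) (\<alpha> + 1)))"

text \<open>\<open>(D \<Delta>\<^sup>l\<^sup>-\<^sup>1 \<phi>)(T)\<close> for \<open>1 \<le> l \<le> h_n\<close>\<close>

definition polyharmonic_calculus :: "nat \<Rightarrow> ('v::banach, 'n::{finite,linorder}) cl_op \<Rightarrow>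
    'n point set \<Rightarrow> ('n point \<Rightarrow> real ^ ('n set)) \<Rightarrow> ('v, 'n) cl_op" where
  "polyharmonic_calculus l T = calculus T (\<lambda>s.
     (2 ^ (2 * l - 1) * fact (l - 1) * pochhammer (- real (h_of TYPE('n))) l) *\<^sub>R
     op_power (op_inv (Q_op T s)) l)"

end

theory Submission
  imports Defs "HOL-Complex_Analysis.Cauchy_Integral_Formula"
begin

text \<open>
  For \<open>T\<close> with commuting components and \<open>T_0 = 0\<close>, \<open>Q_s = s^2 + B\<close>, where \<open>B = - T^2 = \<Sum>i. T_i^2\<close> is an
  operator on \<open>V\<close>.  A left slice hyperholomorphic function is \<open>\<Sum>A. \<Phi>_A e_A\<close> with intrinsic \<open>\<Phi>_A\<close>, and on
  intrinsic functions \<open>\<Phi>\<close> all the calculi are combinations of \<open>P_m \<Phi>\<close> and \<open>P_m (z \<Phi>) + T P_m \<Phi>\<close>, where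
  \<open>P_m \<Phi>\<close> is \<open>1 / (2 \<pi> i)\<close> times the integral of \<open>\<Phi> (z) (z^2 + B)^{-m}\<close>.  Since \<open>P_m \<Phi>\<close> is invariant under
  conjugation of the contour, it is an operator on \<open>V\<close> that does not depend on the imaginary unit, and it
  commutes with \<open>T\<close>.

  With \<open>p = (s^2 + B)^{-1}\<close>, \<open>q = (t^2 + B)^{-1}\<close> the resolvent equation \<open>p - q = (t^2 - s^2) p q\<close> telescopes to
  \<open>(t - s) (\<Sum>j + k = N + 1. (s + T) (t + T) p^j q^k) + (t - s) (\<Sum>j + k = N. p^j q^k) =
  (s + T) p^N - (t + T) q^N\<close>.  The theorem is the case \<open>N = h + 1\<close>, integrated against \<open>f (s) g (t)\<close>:
  the constants of the calculi were chosen such that their products are all \<open>\<gamma>_n\<close> or \<open>- \<gamma>_n\<close>.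

  Both integrals are taken over the same contour \<open>\<Gamma>\<close>.  For a kernel \<open>H (s, t) = (\<phi> (s) - \<phi> (t)) / (t - s)\<close> with
  \<open>\<phi>\<close> holomorphic off the spectrum \<open>K\<close>, the difference between the inner integral and \<open>2 \<pi> i g (s) \<phi> (s)\<close>
  extends holomorphically across \<open>K\<close>, so that it does not contribute to the outer integral.  The Hahn-Banach
  theorem reduces the identities between operators to complex-valued integrals.
\<close>


section \<open>Separating functionals\<close>

text \<open>The obstacle is noncommutativity. Neither \<open>T\<close> nor the values of
  \<open>g\<close> need commute with an imaginary unit, and two imaginary units need not commute
  with each other, while \<open>calculus\<close> demands one value for all of them. Splitting
  \<open>g\<close> leaves the \<open>e_A\<close> on the far right, out of the computation;
  multiplication by the intrinsic \<open>f\<close> from the left then acts on each component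
  separately. Only one imaginary unit remains, and it is eliminated by writing the integrals through
  \<open>B\<close>.

  Nested contours would require a second Cauchy domain between the spectrum and the first one. A
  common contour avoids it, at the price of points \<open>s\<close> on the contour itself, where
  \<open>1 / (t - s)\<close> cannot be integrated although the whole kernel can.

  The products of two constants agree because the orders of the two calculi have a fixed sum: in
  \<open>(-h)_m = (-1)^m h! / (h - m)!\<close> the denominator of one constant is the leading
  factorial of the other, and \<open>4^h (h!)^2 (-1)^h\<close> remains up to sign.\<close>

text \<open>The one-dimensional step of Hahn-Banach. A functional is represented by its graph, a
  subspace of the product with the reals, so that extending it means taking a span. The bound
  \<open>r \<le> norm x\<close> encodes everything: applied to negatives it is two-sided, and at
  \<open>x = 0\<close> it makes the graph single-valued.\<close>

lemma functional_graph_extension: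
  fixes G :: "('a::real_normed_vector \<times> real) set"
  assumes sub: "subspace G" and dom: "\<And>x r. (x, r) \<in> G \<Longrightarrow> r \<le> norm x"
  obtains c where "\<And>y r. (y, r) \<in> span (insert (x, c) G) \<Longrightarrow> r \<le> norm y"
proof -
  \<comment> \<open>The value \<open>c\<close> at \<open>x\<close> must lie above all of
    \<open>A\<close> and below all \<open>norm (y + x) - r\<close>. By \<open>key\<close> the first
    family lies below the second, so the supremum of \<open>A\<close> serves.\<close>
  define A where "A = (\<lambda>(y, r). r - norm (y - x)) ` G"
  have G0: "(0, 0) \<in> G"
    using subspace_0[OF sub] by (simp add: zero_prod_def)
  have key: "r - norm (y - x) \<le> norm (y' + x) - r'" if "(y, r) \<in> G" "(y', r') \<in> G" for y r y' r'
  proof -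
    have "(y + y', r + r') \<in> G"
      using subspace_add[OF sub that] by simp
    then have "r + r' \<le> norm ((y - x) + (y' + x))"
      using dom by simp
    also have "\<dots> \<le> norm (y - x) + norm (y' + x)"
      by (rule norm_triangle_ineq)
    finally show ?thesis
      by simp
  qed
  have ne: "A \<noteq> {}"
    using G0 by (auto simp: A_def)
  have "bdd_above A"
    using key[OF _ G0] by (auto simp: A_def intro!: bdd_aboveI2[where M = "norm (0 + x) - 0"])
  define c where "c = Sup A"
  have lo: "r - norm (y - x) \<le> c" if "(y, r) \<in> G" for y r
    unfolding c_def using that \<open>bdd_above A\<close> by (intro cSup_upper) (force simp: A_def)+
  have hi: "c \<le> norm (y + x) - r" if "(y, r) \<in> G" for y r
    unfolding c_def using that ne key by (intro cSup_least) (auto simp: A_def)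
  show ?thesis
  proof
    fix y r
    assume "(y, r) \<in> span (insert (x, c) G)"
    then obtain k where "(y, r) - k *\<^sub>R (x, c) \<in> span G"
      using span_breakdown_eq by blast
    then have mem: "(y - k *\<^sub>R x, r - k * c) \<in> G"
      using sub by (simp add: span_eq_iff[THEN iffD2])
    \<comment> \<open>Division by the modulus of \<open>k\<close> turns the claim into one of the
      two bounds on \<open>c\<close>: \<open>hi\<close> for positive \<open>k\<close>,
      \<open>lo\<close> for negative \<open>k\<close>.\<close>
    have scaled: "((1 / t) *\<^sub>R (y - k *\<^sub>R x), (r - k * c) / t) \<in> G" for t
      using subspace_scale[OF sub mem, of "1 / t"] by simp
    consider "k = 0" | "k > 0" | "k < 0"
      by linarith
    then show "r \<le> norm y"
    proof cases
      case 1
      then show ?thesis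
        using dom mem by simp
    next
      case 2
      have "(1 / k) *\<^sub>R (y - k *\<^sub>R x) + x = (1 / k) *\<^sub>R y"
        using 2 by (simp add: scaleR_diff_right)
      then have "c \<le> norm ((1 / k) *\<^sub>R y) - (r - k * c) / k"
        using hi[OF scaled[of k]] by simp
      then show ?thesis
        using 2 by (simp add: field_simps)
    next
      case 3
      have "(1 / (- k)) *\<^sub>R (y - k *\<^sub>R x) - x = (1 / (- k)) *\<^sub>R y"
        using 3 by (simp add: scaleR_diff_right)
      then have "(r - k * c) / (- k) - norm ((1 / (- k)) *\<^sub>R y) \<le> c"
        using lo[OF scaled[of "- k"]] by simp
      then show ?thesis
        using 3 by (simp add: field_simps)
    qed
  qed
qed

text \<open>Zorn's lemma on graphs that contain \<open>(x0, norm x0)\<close> and are dominated by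
  the norm. A maximal graph is defined at every vector by the one-dimensional step, and its function
  takes the value \<open>norm x0\<close> at \<open>x0\<close>.\<close>

theorem bounded_linear_functional_separates:
  fixes x0 :: "'a::real_normed_vector"
  assumes "x0 \<noteq> 0"
  obtains f :: "'a \<Rightarrow> real" where "bounded_linear f" "f x0 \<noteq> 0"
proof -
  define good where "good G \<longleftrightarrow> subspace G \<and> (\<forall>x r. (x, r) \<in> G \<longrightarrow> r \<le> norm x) \<and> (x0, norm x0) \<in> G"
    for G :: "('a \<times> real) set"
  have "r \<le> norm x" if "(x, r) \<in> span {(x0, norm x0)}" for x r
    using that by (auto simp: span_singleton mult_right_mono)
  then have "good (span {(x0, norm x0)})"
    by (simp add: good_def span_base)
  moreover have "good (\<Union>C)" if "C \<noteq> {}" "subset.chain {G. good G} C" for C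
  proof -
    have C: "good G" if "G \<in> C" for G
      using that \<open>subset.chain {G. good G} C\<close> by (auto simp: subset_chain_def)
    have cmp: "G \<subseteq> H \<or> H \<subseteq> G" if "G \<in> C" "H \<in> C" for G H
      using that \<open>subset.chain {G. good G} C\<close> by (auto simp: subset_chain_def)
    have Csub: "subspace G" if "G \<in> C" for G
      using C that by (simp add: good_def)
    have "subspace (\<Union>C)"
    proof (rule subspaceI)
      show "0 \<in> \<Union>C"
        using Csub subspace_0 \<open>C \<noteq> {}\<close> by blast
      fix x assume "x \<in> \<Union>C"
      show "k *\<^sub>R x \<in> \<Union>C" for k
        using \<open>x \<in> \<Union>C\<close> Csub subspace_scale by blast
      fix y assume "y \<in> \<Union>C"
      obtain G where "G \<in> C" "x \<in> G" "y \<in> G"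
        using \<open>x \<in> \<Union>C\<close> \<open>y \<in> \<Union>C\<close> cmp by blast
      then show "x + y \<in> \<Union>C"
        using Csub subspace_add by blast
    qed
    then show ?thesis
      using C \<open>C \<noteq> {}\<close> by (auto simp: good_def)
  qed
  ultimately obtain M where M: "good M" and max: "\<And>X. good X \<Longrightarrow> M \<subseteq> X \<Longrightarrow> X = M"
    using subset_Zorn_nonempty[of "{G. good G}"] by auto
  have sub: "subspace M" and dom: "\<And>x r. (x, r) \<in> M \<Longrightarrow> r \<le> norm x"
    using M by (auto simp: good_def)
  have total: "\<exists>r. (x, r) \<in> M" for x
  proof -
    obtain c where c: "\<And>y r. (y, r) \<in> span (insert (x, c) M) \<Longrightarrow> r \<le> norm y"
      using functional_graph_extension[OF sub dom] by blast
    have "M \<subseteq> span (insert (x, c) M)"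
      by (meson insertI2 span_base subsetI)
    moreover have "good (span (insert (x, c) M))"
      using c M \<open>M \<subseteq> _\<close> by (auto simp: good_def)
    ultimately have "span (insert (x, c) M) = M"
      using max by blast
    then show ?thesis
      by (metis insertI1 span_base)
  qed
  \<comment> \<open>The difference of two values at \<open>x\<close> is a value at \<open>0\<close>,
    hence at most \<open>0\<close> in either order.\<close>
  have unique: "r = s" if "(x, r) \<in> M" "(x, s) \<in> M" for x r s
    using dom[of 0 "r - s"] dom[of 0 "s - r"] subspace_diff[OF sub that] subspace_diff[OF sub that(2,1)]
    by auto
  define f where "f x = (THE r. (x, r) \<in> M)" for x
  have fM: "(x, f x) \<in> M" for x
    unfolding f_def using total[of x] unique by (metis theI)
  have feq: "f x = r" if "(x, r) \<in> M" for x r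
    using unique that fM by blast
  have "bounded_linear f"
  proof (rule bounded_linear_intro[where K = 1])
    show "f (x + y) = f x + f y" for x y
      using subspace_add[OF sub fM[of x] fM[of y]] by (simp add: feq)
    show "f (r *\<^sub>R x) = r *\<^sub>R f x" for r x
      using subspace_scale[OF sub fM[of x], of r] by (simp add: feq)
    show "norm (f x) \<le> norm x * 1" for x
      using dom[OF fM[of x]] dom[OF subspace_neg[OF sub fM[of x], unfolded uminus_prod_def fst_conv snd_conv]]
      by simp
  qed
  moreover have "f x0 = norm x0"
    using M by (simp add: feq good_def)
  ultimately show ?thesis
    using that assms by force
qed

section \<open>Cauchy theory for cycles\<close>

text \<open>An indexed family instead of a set of paths: cycles are reversed, conjugated and
  deformed below, and the modified paths may coincide for different indices. The contours of a
  Cauchy domain are indexed by themselves.\<close>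

definition cycle_in :: "complex set \<Rightarrow> 'i set \<Rightarrow> ('i \<Rightarrow> real \<Rightarrow> complex) \<Rightarrow> bool" where
  "cycle_in S A \<gamma> \<longleftrightarrow> finite A \<and>
     (\<forall>i\<in>A. valid_path (\<gamma> i) \<and> pathfinish (\<gamma> i) = pathstart (\<gamma> i) \<and> path_image (\<gamma> i) \<subseteq> S)"

definition cycle_integral :: "'i set \<Rightarrow> ('i \<Rightarrow> real \<Rightarrow> complex) \<Rightarrow> (complex \<Rightarrow> complex) \<Rightarrow> complex" where
  "cycle_integral A \<gamma> f = (\<Sum>i\<in>A. contour_integral (\<gamma> i) f)"

definition cycle_winding :: "'i set \<Rightarrow> ('i \<Rightarrow> real \<Rightarrow> complex) \<Rightarrow> complex \<Rightarrow> complex" where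
  "cycle_winding A \<gamma> z = (\<Sum>i\<in>A. winding_number (\<gamma> i) z)"

lemma cycle_in_mono: "cycle_in S A \<gamma> \<Longrightarrow> S \<subseteq> S' \<Longrightarrow> cycle_in S' A \<gamma>"
  by (auto simp: cycle_in_def)

lemma cycle_integrable:
  "cycle_in S A \<gamma> \<Longrightarrow> open S \<Longrightarrow> f holomorphic_on S \<Longrightarrow> i \<in> A \<Longrightarrow> f contour_integrable_on \<gamma> i"
  unfolding cycle_in_def by (meson contour_integrable_holomorphic_simple)

lemma cycle_winding_integral:
  assumes "cycle_in S A \<gamma>" "z \<notin> S"
  shows "cycle_winding A \<gamma> z = 1 / (2 * of_real pi * \<i>) * cycle_integral A \<gamma> (\<lambda>w. 1 / (w - z))"
  unfolding cycle_winding_def cycle_integral_def sum_distrib_left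
proof (rule sum.cong)
  show "winding_number (\<gamma> i) z = 1 / (2 * of_real pi * \<i>) * contour_integral (\<gamma> i) (\<lambda>w. 1 / (w - z))"
    if "i \<in> A" for i
    using assms that by (subst winding_number_valid_path) (auto simp: cycle_in_def)
qed simp

text \<open>Each curve of the cycle is joined to \<open>p\<close> by a path \<open>c\<close> that is
  traversed there and back, so that its contribution cancels. This makes the Cauchy theorem for a
  single closed path available for cycles.\<close>

lemma merge_loops:
  assumes "open S" "connected S" "p \<in> S" "cycle_in S A \<gamma>"
  obtains g where "valid_path g" "pathstart g = p" "pathfinish g = p" "path_image g \<subseteq> S"
    "\<And>f. f holomorphic_on S \<Longrightarrow> contour_integral g f = cycle_integral A \<gamma> f"
proof -
  have "finite A"
    using assms by (simp add: cycle_in_def)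
  then have "\<exists>g. valid_path g \<and> pathstart g = p \<and> pathfinish g = p \<and> path_image g \<subseteq> S \<and>
      (\<forall>f. f holomorphic_on S \<longrightarrow> contour_integral g f = cycle_integral A \<gamma> f)"
    using \<open>cycle_in S A \<gamma>\<close>
  proof (induction A)
    case empty
    then show ?case
      using \<open>p \<in> S\<close> by (intro exI[of _ "linepath p p"]) (auto simp: cycle_integral_def simp del: linepath_trivial)
  next
    case (insert i A)
    then obtain g where g: "valid_path g" "pathstart g = p" "pathfinish g = p" "path_image g \<subseteq> S"
      "\<And>f. f holomorphic_on S \<Longrightarrow> contour_integral g f = cycle_integral A \<gamma> f"
      by (auto simp: cycle_in_def)
    have i: "valid_path (\<gamma> i)" "pathfinish (\<gamma> i) = pathstart (\<gamma> i)" "path_image (\<gamma> i) \<subseteq> S"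
      using insert.prems by (auto simp: cycle_in_def)
    then have "pathstart (\<gamma> i) \<in> S"
      by auto
    then obtain c where c: "valid_path c" "path_image c \<subseteq> S" "pathstart c = p"
      "pathfinish c = pathstart (\<gamma> i)"
      using connected_open_polynomial_connected[OF assms(1,2) \<open>p \<in> S\<close>] valid_path_polynomial_function
      by blast
    define g' where "g' = g +++ (c +++ (\<gamma> i +++ reversepath c))"
    have "contour_integral g' f = cycle_integral (insert i A) \<gamma> f" if f: "f holomorphic_on S" for f
    proof -
      have "f contour_integrable_on h" if "valid_path h" "path_image h \<subseteq> S" for h
        using contour_integrable_holomorphic_simple[OF f \<open>open S\<close> that] .
      then show ?thesis
        unfolding g'_def using g i c f insert.hyps
        by (simp add: cycle_integral_def contour_integrable_reversepath contour_integral_reversepath)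
    qed
    moreover have "valid_path g' \<and> pathstart g' = p \<and> pathfinish g' = p \<and> path_image g' \<subseteq> S"
      unfolding g'_def using g i c by (auto simp: path_image_join)
    ultimately show ?case
      by blast
  qed
  then show ?thesis
    using that by blast
qed

text \<open>For \<open>z\<close> outside \<open>S\<close> the function \<open>1 / (w - z)\<close> is
  holomorphic on \<open>S\<close>, so the merged loop winds around \<open>z\<close> as often as the
  cycle does.\<close>

lemma cycle_Cauchy_connected:
  assumes "open S" "connected S" "cycle_in S A \<gamma>" "f holomorphic_on S"
    and "\<And>z. z \<notin> S \<Longrightarrow> cycle_winding A \<gamma> z = 0"
  shows "cycle_integral A \<gamma> f = 0"
proof (cases "A = {}")
  case False
  then obtain i where "i \<in> A"
    by blast
  then have "pathstart (\<gamma> i) \<in> S"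
    using assms(3) by (auto simp: cycle_in_def)
  then obtain g where g: "valid_path g" "pathfinish g = pathstart g" "path_image g \<subseteq> S"
    "\<And>f. f holomorphic_on S \<Longrightarrow> contour_integral g f = cycle_integral A \<gamma> f"
    using merge_loops[OF assms(1,2) _ assms(3)] by metis
  have "winding_number g z = 0" if "z \<notin> S" for z
  proof -
    have "(\<lambda>w. 1 / (w - z)) holomorphic_on S"
      using that by (auto intro!: holomorphic_intros)
    then have "winding_number g z = cycle_winding A \<gamma> z"
      using g that assms(3) by (subst winding_number_valid_path) (auto simp: cycle_winding_integral)
    then show ?thesis
      using assms(5) that by simp
  qed
  then have "(f has_contour_integral 0) g"
    using Cauchy_theorem_global[OF assms(1,4) g(1-3)] by blast
  then show ?thesis
    using g(4)[OF assms(4)] contour_integral_unique by metis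
qed (simp add: cycle_integral_def)

text \<open>The point sought is the point of the closure of \<open>C\<close> on the segment from
  \<open>z\<close> to \<open>p\<close> that is closest to \<open>z\<close>.\<close>

lemma segment_to_frontier:
  fixes C :: "'a::euclidean_space set"
  assumes "open C" "p \<in> C" "z \<notin> C"
  obtains x where "x \<in> frontier C" "closed_segment z x \<inter> C = {}"
proof -
  define K where "K = closed_segment z p \<inter> closure C"
  have "closed K" "K \<noteq> {}"
    using \<open>p \<in> C\<close> closure_subset by (auto simp: K_def intro!: closed_Int)
  then obtain x where x: "x \<in> K" and min: "\<And>y. y \<in> K \<Longrightarrow> dist z x \<le> dist z y"
    using distance_attains_inf by blast
  have sub: "closed_segment z x \<subseteq> closed_segment z p"
    using x by (simp add: K_def subset_closed_segment)
  have far: "y = x" if "y \<in> closed_segment z x" "y \<in> C" for y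
  proof (rule ccontr)
    assume "y \<noteq> x"
    moreover have "y \<noteq> z"
      using that \<open>z \<notin> C\<close> by blast
    ultimately have "y \<in> open_segment z x"
      using that by (simp add: open_segment_def)
    then have "dist z y < dist z x"
      by (metis dist_commute dist_in_open_segment)
    moreover have "y \<in> K"
      using that sub closure_subset by (auto simp: K_def)
    ultimately show False
      using min by force
  qed
  \<comment> \<open>If \<open>x\<close> were in the open set \<open>C\<close>, then \<open>C\<close>
    would also contain points of the segment closer to \<open>z\<close>.\<close>
  have "x \<notin> C"
  proof
    assume "x \<in> C"
    then have "x \<noteq> z"
      using \<open>z \<notin> C\<close> by blast
    then have "x \<in> closure (open_segment z x)"
      by simp
    then obtain y where "y \<in> C" "y \<in> open_segment z x"
      using \<open>x \<in> C\<close> \<open>open C\<close> by (metis Int_iff disjoint_iff open_Int_closure_eq_empty)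
    then show False
      using far by (auto simp: open_segment_def)
  qed
  then have "x \<in> frontier C"
    using x \<open>open C\<close> by (simp add: K_def frontier_def interior_open)
  with far \<open>x \<notin> C\<close> that show ?thesis
    by blast
qed

text \<open>The winding hypothesis concerns the whole cycle, whereas the Cauchy theorem on the
  component \<open>C\<close> needs it for the part \<open>B\<close> of the cycle that runs inside
  \<open>C\<close>. At frontier points of \<open>C\<close>, which lie outside \<open>S\<close>, the
  winding of \<open>B\<close> is minus that of the other curves; these do not meet \<open>C\<close>,
  so the number is the same at all frontier points. Segments that avoid \<open>C\<close> carry it to
  every point outside \<open>C\<close>, and a point far away shows that it is zero.\<close>

lemma component_cycle_winding:
  assumes S: "open S" "bounded S" and C: "C \<in> components S"
    and cyc: "cycle_in S A \<gamma>" and wn: "\<And>z. z \<notin> S \<Longrightarrow> cycle_winding A \<gamma> z = 0"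
    and sep: "\<And>i. i \<in> A - B \<Longrightarrow> path_image (\<gamma> i) \<inter> C = {}"
    and B: "B \<subseteq> A" "\<And>i. i \<in> B \<Longrightarrow> path_image (\<gamma> i) \<subseteq> C"
    and z: "z \<notin> C"
  shows "cycle_winding B \<gamma> z = 0"
proof -
  note paths = cyc[unfolded cycle_in_def]
  have "finite A"
    using paths by blast
  have "open C" "C \<noteq> {}" "connected C" "C \<subseteq> S"
    using C S open_components in_components_nonempty in_components_connected in_components_subset
    by blast+
  then obtain p where "p \<in> C"
    by blast
  have split: "cycle_winding A \<gamma> x = cycle_winding B \<gamma> x + cycle_winding (A - B) \<gamma> x" for x
    using \<open>finite A\<close> B(1) by (simp add: cycle_winding_def sum.subset_diff add.commute)
  have frontier_notin: "x \<notin> S" if "x \<in> frontier C" for x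
    using frontier_of_components_subset[OF C] that \<open>open S\<close> by (auto simp: frontier_def interior_open)
  have const: "winding_number (\<gamma> i) x = winding_number (\<gamma> i) y"
    if "i \<in> A" "connected X" "x \<in> X" "y \<in> X" "X \<inter> path_image (\<gamma> i) = {}" for i X x y
  proof -
    have "winding_number (\<gamma> i) constant_on X"
      using paths that by (intro winding_number_constant) (auto simp: valid_path_imp_path)
    then show ?thesis
      using that by (auto simp: constant_on_def)
  qed
  have frontier_val: "cycle_winding B \<gamma> x = - cycle_winding (A - B) \<gamma> p" if x: "x \<in> frontier C" for x
  proof -
    have "connected (insert x C)"
      using \<open>connected C\<close> by (rule connected_intermediate_closure)
        (use x closure_subset in \<open>auto simp: frontier_def\<close>)
    then have "winding_number (\<gamma> i) x = winding_number (\<gamma> i) p" if "i \<in> A - B" for i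
      using that sep[OF that] frontier_notin[OF x] paths \<open>p \<in> C\<close>
      by (intro const[of _ "insert x C"]) auto
    then have "cycle_winding (A - B) \<gamma> x = cycle_winding (A - B) \<gamma> p"
      unfolding cycle_winding_def by (intro sum.cong) auto
    then show ?thesis
      using split[of x] wn[OF frontier_notin[OF x]] by (simp add: eq_neg_iff_add_eq_0)
  qed
  have val: "cycle_winding B \<gamma> z = - cycle_winding (A - B) \<gamma> p" if zC: "z \<notin> C" for z
  proof -
    obtain x where x: "x \<in> frontier C" "closed_segment z x \<inter> C = {}"
      using segment_to_frontier[OF \<open>open C\<close> \<open>p \<in> C\<close> zC] by blast
    have "winding_number (\<gamma> i) z = winding_number (\<gamma> i) x" if "i \<in> B" for i
      using that B x by (intro const[of _ "closed_segment z x"]) auto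
    then have "cycle_winding B \<gamma> z = cycle_winding B \<gamma> x"
      unfolding cycle_winding_def by (intro sum.cong) auto
    then show ?thesis
      using frontier_val[OF x(1)] by simp
  qed
  obtain R where R: "C \<subseteq> ball 0 R"
    using S(2) \<open>C \<subseteq> S\<close> by (meson bounded_subset bounded_subset_ballD)
  define w where "w = complex_of_real \<bar>R\<bar>"
  have "w \<notin> ball 0 R"
    by (simp add: w_def)
  then have "winding_number (\<gamma> i) w = 0" if "i \<in> B" for i
    using that B R paths by (intro winding_number_zero_outside[of _ "ball 0 R"])
      (auto simp: valid_path_imp_path)
  then have "cycle_winding B \<gamma> w = 0"
    by (simp add: cycle_winding_def)
  then show ?thesis
    using val[of w] val[OF z] \<open>w \<notin> ball 0 R\<close> R by fastforce
qed

text \<open>Grouping the curves by the component of the open set that contains them reduces the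
  claim to the connected case.\<close>

theorem cycle_Cauchy:
  assumes "open S" and cyc: "cycle_in S A \<gamma>" and f: "f holomorphic_on S"
    and wn: "\<And>z. z \<notin> S \<Longrightarrow> cycle_winding A \<gamma> z = 0"
  shows "cycle_integral A \<gamma> f = 0"
proof -
  note paths = cyc[unfolded cycle_in_def]
  have "compact (\<Union>i\<in>A. path_image (\<gamma> i))"
    using paths by (intro compact_UN) (auto simp: compact_valid_path_image)
  then obtain R where R: "(\<Union>i\<in>A. path_image (\<gamma> i)) \<subseteq> ball 0 R"
    by (meson compact_imp_bounded bounded_subset_ballD)
  \<comment> \<open>Cutting \<open>S\<close> down to a ball is harmless, since no curve winds around
    points outside the ball. The argument with a distant point on each component relies on
    boundedness.\<close>
  define S' where "S' = S \<inter> ball 0 R"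
  have S': "open S'" "bounded S'" "S' \<subseteq> S"
    using \<open>open S\<close> by (auto simp: S'_def intro: bounded_subset[OF bounded_ball])
  have cyc': "cycle_in S' A \<gamma>"
    using paths R by (auto simp: cycle_in_def S'_def)
  have wn': "cycle_winding A \<gamma> z = 0" if "z \<notin> S'" for z
  proof (cases "z \<in> S")
    case True
    then have "z \<notin> ball 0 R"
      using that by (simp add: S'_def)
    then have "winding_number (\<gamma> i) z = 0" if "i \<in> A" for i
      using that R paths by (intro winding_number_zero_outside[of _ "ball 0 R"])
        (auto simp: valid_path_imp_path)
    then show ?thesis
      by (simp add: cycle_winding_def)
  qed (use wn in simp)
  define c where "c i = connected_component_set S' (pathstart (\<gamma> i))" for i
  have start: "pathstart (\<gamma> i) \<in> S'" if "i \<in> A" for i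
    using cyc' that by (auto simp: cycle_in_def)
  have comp: "c i \<in> components S'" if "i \<in> A" for i
    using start[OF that] by (simp add: c_def componentsI)
  have im: "path_image (\<gamma> i) \<subseteq> c i" if "i \<in> A" for i
    unfolding c_def using that cyc'
    by (intro connected_component_maximal connected_path_image)
      (auto simp: cycle_in_def valid_path_imp_path)
  have "cycle_integral {i \<in> A. c i = C} \<gamma> f = 0" if C: "C \<in> c ` A" for C
  proof (rule cycle_Cauchy_connected)
    have comps: "C \<in> components S'"
      using comp C by blast
    show "open C" "connected C" "f holomorphic_on C"
      using comps S' f open_components in_components_connected in_components_subset
        holomorphic_on_subset by (blast, blast, metis subset_trans)
    show "cycle_in C {i \<in> A. c i = C} \<gamma>"
      using paths im by (auto simp: cycle_in_def)
    show "cycle_winding {i \<in> A. c i = C} \<gamma> z = 0" if "z \<notin> C" for z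
    proof (rule component_cycle_winding[OF S'(1,2) comps cyc' wn'])
      show "path_image (\<gamma> i) \<inter> C = {}" if "i \<in> A - {i \<in> A. c i = C}" for i
      proof -
        have "c i \<inter> C = {}"
          using comps comp[of i] that by (metis (mono_tags, lifting) DiffE components_nonoverlap mem_Collect_eq)
        then show ?thesis
          using im[of i] that by blast
      qed
    qed (use im that in auto)
  qed
  moreover have "cycle_integral A \<gamma> f = (\<Sum>C\<in>c ` A. cycle_integral {i \<in> A. c i = C} \<gamma> f)"
    unfolding cycle_integral_def using paths by (intro sum.image_gen) blast
  ultimately show ?thesis
    by simp
qed

lemma cycle_in_image: "cycle_in S A \<gamma> \<Longrightarrow> i \<in> A \<Longrightarrow> path_image (\<gamma> i) \<subseteq> S"
  by (simp add: cycle_in_def)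

lemma cycle_integral_cong:
  assumes "cycle_in S A \<gamma>" "\<And>z. z \<in> S \<Longrightarrow> f z = g z"
  shows "cycle_integral A \<gamma> f = cycle_integral A \<gamma> g"
  unfolding cycle_integral_def using assms
  by (intro sum.cong contour_integral_cong refl) (auto simp: cycle_in_def)

lemma
  assumes "open S" "cycle_in S A \<gamma>" "f holomorphic_on S"
  shows cycle_integral_cmult: "cycle_integral A \<gamma> (\<lambda>z. c * f z) = c * cycle_integral A \<gamma> f"
    and cycle_integral_add: "g holomorphic_on S \<Longrightarrow>
      cycle_integral A \<gamma> (\<lambda>z. f z + g z) = cycle_integral A \<gamma> f + cycle_integral A \<gamma> g"
    and cycle_integral_diff: "g holomorphic_on S \<Longrightarrow>
      cycle_integral A \<gamma> (\<lambda>z. f z - g z) = cycle_integral A \<gamma> f - cycle_integral A \<gamma> g"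
proof -
  note int = cycle_integrable[OF assms(2,1)]
  show "cycle_integral A \<gamma> (\<lambda>z. c * f z) = c * cycle_integral A \<gamma> f"
    unfolding cycle_integral_def sum_distrib_left
    by (intro sum.cong refl contour_integral_lmul int assms)
  show "cycle_integral A \<gamma> (\<lambda>z. f z + g z) = cycle_integral A \<gamma> f + cycle_integral A \<gamma> g"
    if "g holomorphic_on S"
    unfolding cycle_integral_def sum.distrib[symmetric]
    by (intro sum.cong refl contour_integral_add int assms that)
  show "cycle_integral A \<gamma> (\<lambda>z. f z - g z) = cycle_integral A \<gamma> f - cycle_integral A \<gamma> g"
    if "g holomorphic_on S"
    unfolding cycle_integral_def sum_subtractf[symmetric]
    by (intro sum.cong refl contour_integral_diff int assms that)
qed

text \<open>The difference of the two cycles, indexed by the disjoint sum with the second family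
  reversed, has winding number zero around every point outside \<open>S\<close>.\<close>

lemma cycle_integral_homologous:
  assumes "open S" "cycle_in S A \<gamma>" "cycle_in S B \<delta>" "f holomorphic_on S"
    and "\<And>z. z \<notin> S \<Longrightarrow> cycle_winding A \<gamma> z = cycle_winding B \<delta> z"
  shows "cycle_integral A \<gamma> f = cycle_integral B \<delta> f"
proof -
  define \<epsilon> where "\<epsilon> = case_sum \<gamma> (\<lambda>j. reversepath (\<delta> j))"
  have fin: "finite A" "finite B"
    using assms by (auto simp: cycle_in_def)
  have cyc: "cycle_in S (A <+> B) \<epsilon>"
    using assms(2,3) by (auto simp: cycle_in_def \<epsilon>_def; blast)
  have split: "(\<Sum>k\<in>A <+> B. h k) = (\<Sum>i\<in>A. h (Inl i)) + (\<Sum>j\<in>B. h (Inr j))" for h :: "'a + 'b \<Rightarrow> complex"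
    using fin by (simp add: sum.Plus)
  have "cycle_winding (A <+> B) \<epsilon> z = 0" if "z \<notin> S" for z
  proof -
    have "winding_number (reversepath (\<delta> j)) z = - winding_number (\<delta> j) z" if "j \<in> B" for j
      using that assms(3) \<open>z \<notin> S\<close>
      by (intro winding_number_reversepath) (auto simp: cycle_in_def valid_path_imp_path)
    then have "cycle_winding (A <+> B) \<epsilon> z = cycle_winding A \<gamma> z - cycle_winding B \<delta> z"
      by (simp add: cycle_winding_def split \<epsilon>_def sum_negf)
    then show ?thesis
      using assms(5)[OF that] by simp
  qed
  then have "cycle_integral (A <+> B) \<epsilon> f = 0"
    using cycle_Cauchy[OF assms(1) cyc assms(4)] by blast
  moreover have "contour_integral (reversepath (\<delta> j)) f = - contour_integral (\<delta> j) f" if "j \<in> B" for j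
    using that assms(3) by (intro contour_integral_reversepath) (auto simp: cycle_in_def)
  then have "cycle_integral (A <+> B) \<epsilon> f = cycle_integral A \<gamma> f - cycle_integral B \<delta> f"
    by (simp add: cycle_integral_def split \<epsilon>_def sum_negf)
  ultimately show ?thesis
    by simp
qed

section \<open>Cauchy integrals as holomorphic functions of the pole\<close>

text \<open>A valid path may have an unbounded derivative near its exceptional points, but
  differentiation under the integral asks for a bound. Polynomial loops close to the given ones
  provide it without changing integrals of holomorphic functions.\<close>

lemma polynomial_cycle:
  assumes "open S" "cycle_in S A \<gamma>"
  obtains \<gamma>' where "cycle_in S A \<gamma>'" "\<And>i. i \<in> A \<Longrightarrow> polynomial_function (\<gamma>' i)"
    "\<And>f. f holomorphic_on S \<Longrightarrow> cycle_integral A \<gamma>' f = cycle_integral A \<gamma> f"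
proof -
  have "\<exists>p. polynomial_function p \<and> pathfinish p = pathstart p \<and> path_image p \<subseteq> S \<and>
      (\<forall>f. f holomorphic_on S \<longrightarrow> contour_integral p f = contour_integral (\<gamma> i) f)"
    if "i \<in> A" for i
  proof -
    have i: "valid_path (\<gamma> i)" "path (\<gamma> i)" "pathfinish (\<gamma> i) = pathstart (\<gamma> i)" "path_image (\<gamma> i) \<subseteq> S"
      using assms(2) that by (auto simp: cycle_in_def valid_path_imp_path)
    obtain d where "d > 0" and d: "\<And>g h. valid_path g \<and> valid_path h \<and>
          (\<forall>t\<in>{0..1}. norm (g t - \<gamma> i t) < d \<and> norm (h t - \<gamma> i t) < d) \<and>
          pathfinish g = pathstart g \<and> pathfinish h = pathstart h \<Longrightarrow>
        path_image g \<subseteq> S \<and> path_image h \<subseteq> S \<and>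
        (\<forall>f. f holomorphic_on S \<longrightarrow> contour_integral h f = contour_integral g f)"
      using contour_integral_nearby_loops[OF assms(1) i(2,4)] by blast
    obtain p where "polynomial_function p" "pathstart p = pathstart (\<gamma> i)" "pathfinish p = pathfinish (\<gamma> i)"
      "\<And>t. t \<in> {0..1} \<Longrightarrow> norm (p t - \<gamma> i t) < d"
      using path_approx_polynomial_function[OF i(2) \<open>d > 0\<close>] by blast
    then show ?thesis
      using d[of "\<gamma> i" p] i \<open>d > 0\<close> valid_path_polynomial_function
      by (intro exI[of _ p]) auto
  qed
  then obtain \<gamma>' where \<gamma>': "\<And>i. i \<in> A \<Longrightarrow> polynomial_function (\<gamma>' i) \<and> pathfinish (\<gamma>' i) = pathstart (\<gamma>' i) \<and>
      path_image (\<gamma>' i) \<subseteq> S \<and> (\<forall>f. f holomorphic_on S \<longrightarrow>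
      contour_integral (\<gamma>' i) f = contour_integral (\<gamma> i) f)"
    by metis
  show ?thesis
  proof
    show "cycle_in S A \<gamma>'"
      using \<gamma>' assms(2) by (auto simp: cycle_in_def valid_path_polynomial_function)
    show "cycle_integral A \<gamma>' f = cycle_integral A \<gamma> f" if "f holomorphic_on S" for f
      using \<gamma>' that by (simp add: cycle_integral_def)
  qed (use \<gamma>' in blast)
qed

text \<open>The difference quotient \<open>D\<close> of \<open>G\<close> extends holomorphically
  across \<open>s\<close>, so its integral vanishes. The integral of \<open>1 / (t - s)\<close> is
  left as it stands, because the winding number around \<open>s\<close> is not known here.\<close>

lemma cycle_Cauchy_formula:
  assumes "open S" "cycle_in S A \<gamma>" "cycle_in (- {s}) A \<gamma>" "G holomorphic_on S"
    and "\<And>z. z \<notin> S \<Longrightarrow> cycle_winding A \<gamma> z = 0"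
  shows "cycle_integral A \<gamma> (\<lambda>t. G t / (t - s)) = G s * cycle_integral A \<gamma> (\<lambda>t. 1 / (t - s))"
proof -
  define D where "D t = (if t = s then deriv G s else (G t - G s) / (t - s))" for t
  have "D holomorphic_on S"
    unfolding D_def by (intro pole_lemma_open assms)
  then have "cycle_integral A \<gamma> D = 0"
    by (rule cycle_Cauchy[OF assms(1,2) _ assms(5)])
  have cyc: "cycle_in (S - {s}) A \<gamma>"
    using assms(2,3) by (auto simp: cycle_in_def)
  have hol: "(\<lambda>t. G t / (t - s)) holomorphic_on (S - {s})" "(\<lambda>t. 1 / (t - s)) holomorphic_on (S - {s})"
    by (auto intro!: holomorphic_intros holomorphic_on_subset[OF assms(4)])
  have op: "open (S - {s})" and hol3: "(\<lambda>t. G s * (1 / (t - s))) holomorphic_on (S - {s})"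
    using assms(1) by (auto intro!: holomorphic_intros)
  have "cycle_integral A \<gamma> (\<lambda>t. G t / (t - s)) - G s * cycle_integral A \<gamma> (\<lambda>t. 1 / (t - s)) =
      cycle_integral A \<gamma> (\<lambda>t. G t / (t - s) - G s * (1 / (t - s)))"
    unfolding cycle_integral_diff[OF op cyc hol(1) hol3] cycle_integral_cmult[OF op cyc hol(2)] ..
  also have "\<dots> = cycle_integral A \<gamma> D"
    by (intro cycle_integral_cong[OF cyc]) (simp add: D_def diff_divide_distrib)
  finally show ?thesis
    using \<open>cycle_integral A \<gamma> D = 0\<close> by simp
qed

lemma holomorphic_polynomial_Cauchy_integral:
  assumes "open S" "cycle_in S A \<gamma>" "\<And>i. i \<in> A \<Longrightarrow> polynomial_function (\<gamma> i)" "q holomorphic_on S"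
  shows "(\<lambda>s. cycle_integral A \<gamma> (\<lambda>t. q t / (t - s))) holomorphic_on - (\<Union>i\<in>A. path_image (\<gamma> i))"
  unfolding cycle_integral_def
proof (rule holomorphic_on_sum)
  fix i assume i: "i \<in> A"
  have paths: "valid_path (\<gamma> i)" "path_image (\<gamma> i) \<subseteq> S"
    using assms(2) i by (auto simp: cycle_in_def)
  obtain p' where p': "polynomial_function p'" "\<And>x. (\<gamma> i has_vector_derivative p' x) (at x)"
    using has_vector_derivative_polynomial_function[OF assms(3)[OF i]] by blast
  have "bounded (p' ` {0..1})"
    using p'(1) continuous_on_polymonial_function
    by (intro compact_imp_bounded compact_continuous_image) auto
  then obtain B where B: "\<And>t. t \<in> {0..1} \<Longrightarrow> norm (p' t) \<le> B"
    unfolding bounded_iff by blast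
  have "((\<lambda>s. contour_integral (\<gamma> i) (\<lambda>t. q t / (t - s))) has_field_derivative
      of_nat 1 * contour_integral (\<gamma> i) (\<lambda>t. q t / (t - s) ^ Suc 1)) (at s)"
    if s: "s \<notin> path_image (\<gamma> i)" for s
  proof (rule Cauchy_next_derivative(2)[where S = UNIV and B = B])
    show "continuous_on (path_image (\<gamma> i)) q"
      using assms(4) paths by (meson continuous_on_subset holomorphic_on_imp_continuous_on)
    show "norm (vector_derivative (\<gamma> i) (at t)) \<le> B" if "t \<in> {0..1}" for t
      using B[OF that] vector_derivative_at[OF p'(2)] by simp
    show "((\<lambda>t. q t / (t - w) ^ 1) has_contour_integral contour_integral (\<gamma> i) (\<lambda>t. q t / (t - w))) (\<gamma> i)"
      if "w \<in> UNIV - path_image (\<gamma> i)" for w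
    proof -
      have "(\<lambda>t. q t / (t - w)) contour_integrable_on \<gamma> i"
        using paths that assms(1)
        by (intro contour_integrable_holomorphic_simple[where S = "S - {w}"])
          (auto intro!: holomorphic_intros holomorphic_on_subset[OF assms(4)])
      then show ?thesis
        by (simp add: has_contour_integral_integral)
    qed
  qed (use paths s in auto)
  then have "(\<lambda>s. contour_integral (\<gamma> i) (\<lambda>t. q t / (t - s))) holomorphic_on - path_image (\<gamma> i)"
    using paths by (subst holomorphic_on_open) (auto simp: open_Compl closed_valid_path_image)
  then show "(\<lambda>s. contour_integral (\<gamma> i) (\<lambda>t. q t / (t - s))) holomorphic_on - (\<Union>i\<in>A. path_image (\<gamma> i))"
    by (rule holomorphic_on_subset) (use i in blast)
qed

text \<open>Holomorphy is local. For poles in a small disc off the contour, the contour can be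
  replaced by a polynomial one in \<open>S\<close> minus the closed disc, where the integrands are
  holomorphic and the integrals do not change.\<close>

lemma holomorphic_Cauchy_integral:
  assumes "open S" "cycle_in S A \<gamma>" "q holomorphic_on S"
  shows "(\<lambda>s. cycle_integral A \<gamma> (\<lambda>t. q t / (t - s))) holomorphic_on - (\<Union>i\<in>A. path_image (\<gamma> i))"
    (is "?I holomorphic_on - ?P")
proof -
  have "closed ?P"
    using assms(2) unfolding cycle_in_def by (intro closed_UN) (auto simp: closed_valid_path_image)
  have "\<exists>D. (?I has_field_derivative D) (at w)" if w: "w \<in> - ?P" for w
  proof -
    obtain e where "e > 0" and e: "cball w e \<subseteq> - ?P"
      using w open_contains_cball_eq[OF open_Compl[OF \<open>closed ?P\<close>]] by blast
    define S' where "S' = S - cball w e"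
    have S': "open S'" "cycle_in S' A \<gamma>" "q holomorphic_on S'"
    proof -
      have "path_image (\<gamma> i) \<subseteq> S'" if "i \<in> A" for i
        using cycle_in_image[OF assms(2) that] e that unfolding S'_def by blast
      then show "cycle_in S' A \<gamma>"
        using assms(2) by (simp add: cycle_in_def)
      show "open S'" "q holomorphic_on S'"
        using assms(1) holomorphic_on_subset[OF assms(3)] by (auto simp: S'_def)
    qed
    obtain \<delta> where \<delta>: "cycle_in S' A \<delta>" "\<And>i. i \<in> A \<Longrightarrow> polynomial_function (\<delta> i)"
      "\<And>f. f holomorphic_on S' \<Longrightarrow> cycle_integral A \<delta> f = cycle_integral A \<gamma> f"
      using polynomial_cycle[OF S'(1,2)] by blast
    have "ball w e \<inter> path_image (\<delta> i) = {}" if "i \<in> A" for i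
      using cycle_in_image[OF \<delta>(1) that] ball_subset_cball unfolding S'_def by blast
    then have "(\<lambda>s. cycle_integral A \<delta> (\<lambda>t. q t / (t - s))) holomorphic_on ball w e"
      by (intro holomorphic_on_subset[OF holomorphic_polynomial_Cauchy_integral[OF S'(1) \<delta>(1,2) S'(3)]])
        (auto simp: disjoint_iff)
    then have "?I holomorphic_on ball w e"
    proof (rule holomorphic_transform)
      show "cycle_integral A \<delta> (\<lambda>t. q t / (t - s)) = ?I s" if "s \<in> ball w e" for s
        using that by (intro \<delta>(3) holomorphic_on_divide S'(3) holomorphic_intros) (auto simp: S'_def)
    qed
    then show ?thesis
      using \<open>e > 0\<close> by (auto simp: holomorphic_on_open)
  qed
  then show ?thesis
    using holomorphic_on_open[OF open_Compl[OF \<open>closed ?P\<close>]] by blast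
qed

section \<open>Iterated integrals over a common contour\<close>

lemma cycle_integral_sum:
  assumes "open S" "cycle_in S A \<gamma>" "finite R" "\<And>r. r \<in> R \<Longrightarrow> f r holomorphic_on S"
  shows "cycle_integral A \<gamma> (\<lambda>z. \<Sum>r\<in>R. f r z) = (\<Sum>r\<in>R. cycle_integral A \<gamma> (f r))"
proof -
  have "contour_integral (\<gamma> i) (\<lambda>z. \<Sum>r\<in>R. f r z) = (\<Sum>r\<in>R. contour_integral (\<gamma> i) (f r))" if "i \<in> A" for i
    using cycle_integrable[OF assms(2,1,4) that] assms(3) by (intro contour_integral_sum)
  then show ?thesis
    unfolding cycle_integral_def by (simp add: sum.swap[of _ R A])
qed

text \<open>Up to sign \<open>H\<close> is the difference quotient of \<open>\<phi>\<close> at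
  \<open>s\<close>. It is holomorphic at \<open>t = s\<close> too, so \<open>s\<close> may lie on
  the contour. On a large circle homologous to the cycle the quotient can be split:
  \<open>\<phi> s / (t - s)\<close> contributes the value claimed, and the contribution of
  \<open>\<phi> t / (t - s)\<close> is small because \<open>\<phi>\<close> vanishes at
  infinity.\<close>

lemma cycle_difference_quotient:
  assumes K: "compact K" "cycle_in (- K) A \<gamma>" "\<And>z. z \<in> K \<Longrightarrow> cycle_winding A \<gamma> z = 1"
    and \<phi>: "\<phi> holomorphic_on - K" "(\<phi> \<longlongrightarrow> 0) at_infinity"
    and s: "s \<notin> K" and H: "H holomorphic_on - K" "\<And>t. t \<notin> K \<Longrightarrow> H t * (t - s) = \<phi> s - \<phi> t"
  shows "cycle_integral A \<gamma> H = 2 * of_real pi * \<i> * \<phi> s"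
proof -
  have openK: "open (- K)"
    using K(1) by (simp add: compact_imp_closed open_Compl)
  obtain b where b: "K \<subseteq> ball 0 b"
    using K(1) by (meson compact_imp_bounded bounded_subset_ballD)
  have bound: "norm (cycle_integral A \<gamma> H - 2 * of_real pi * \<i> * \<phi> s) \<le> e" if "e > 0" for e
  proof -
    \<comment> \<open>The final estimate is \<open>(2 * e' / R) * (2 * pi * R)\<close>, which equals
      \<open>e\<close>.\<close>
    define e' where "e' = e / (4 * pi)"
    have "e' > 0"
      using that by (simp add: e'_def)
    obtain c where c: "\<And>z. c \<le> norm z \<Longrightarrow> norm (\<phi> z) < e'"
      using \<phi>(2) \<open>e' > 0\<close> by (auto simp: tendsto_iff eventually_at_infinity)
    \<comment> \<open>\<open>2 * norm s \<le> R\<close> yields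
      \<open>norm (t - s) \<ge> R / 2\<close> on the circle. The other entries put \<open>K\<close>
      inside the circle, make \<open>\<phi>\<close> small on it and keep \<open>R\<close>
      positive.\<close>
    define R where "R = Max {b, c, 2 * norm s, 1}"
    have R: "b \<le> R" "c \<le> R" "2 * norm s \<le> R" "1 \<le> R"
      by (auto simp: R_def)
    have "norm s < R"
      using R norm_ge_zero[of s] by linarith
    have cyc: "cycle_in (- K - {s}) {()} (\<lambda>_. circlepath 0 R)"
      using b R \<open>norm s < R\<close> by (auto simp: cycle_in_def)
    have "cycle_integral A \<gamma> H = cycle_integral {()} (\<lambda>_. circlepath 0 R) H"
    proof (rule cycle_integral_homologous[OF openK K(2) _ H(1)])
      show "cycle_in (- K) {()} (\<lambda>_. circlepath 0 R)"
        using cyc by (rule cycle_in_mono) auto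
      show "cycle_winding A \<gamma> z = cycle_winding {()} (\<lambda>_. circlepath 0 R) z" if "z \<notin> - K" for z
        using that b R K(3)[of z] by (auto simp: cycle_winding_def winding_number_circlepath)
    qed
    also have "\<dots> = contour_integral (circlepath 0 R) H"
      by (simp add: cycle_integral_def)
    finally have eq: "cycle_integral A \<gamma> H = contour_integral (circlepath 0 R) H" .
    have hol: "(\<lambda>t. 1 / (t - s)) holomorphic_on - K - {s}"
      by (auto intro!: holomorphic_intros)
    have "(\<lambda>t. 1 / (t - s)) contour_integrable_on circlepath 0 R"
      using cycle_integrable[OF cyc _ hol] openK by auto
    moreover have "contour_integral (circlepath 0 R) (\<lambda>t. 1 / (t - s)) = 2 * of_real pi * \<i>"
      using winding_number_circlepath[of s 0 R] \<open>norm s < R\<close>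
        winding_number_valid_path[of "circlepath 0 R" s] by auto
    ultimately have "((\<lambda>t. 1 / (t - s)) has_contour_integral 2 * of_real pi * \<i>) (circlepath 0 R)"
      by (metis has_contour_integral_integral)
    then have "((\<lambda>t. \<phi> s * (1 / (t - s))) has_contour_integral \<phi> s * (2 * of_real pi * \<i>)) (circlepath 0 R)"
      by (rule has_contour_integral_lmul)
    moreover have "(H has_contour_integral cycle_integral A \<gamma> H) (circlepath 0 R)"
      using cyc unfolding eq
      by (intro has_contour_integral_integral contour_integrable_holomorphic_simple[OF H(1) openK])
        (auto simp: cycle_in_def)
    ultimately have "((\<lambda>t. H t - \<phi> s * (1 / (t - s))) has_contour_integral
        cycle_integral A \<gamma> H - \<phi> s * (2 * of_real pi * \<i>)) (circlepath 0 R)"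
      by (rule has_contour_integral_diff[rotated])
    then have "norm (cycle_integral A \<gamma> H - \<phi> s * (2 * of_real pi * \<i>)) \<le> (2 * e' / R) * (2 * pi * R)"
    proof (rule has_contour_integral_bound_circlepath)
      show "norm (H t - \<phi> s * (1 / (t - s))) \<le> 2 * e' / R" if "norm (t - 0) = R" for t
      proof -
        have "t \<notin> K"
          using that b R by auto
        have far: "R / 2 \<le> norm (t - s)"
          using that R norm_triangle_ineq2[of t s] by simp
        then have "t \<noteq> s"
          using R by auto
        have "(H t - \<phi> s * (1 / (t - s))) * (t - s) = - \<phi> t"
          using H(2)[OF \<open>t \<notin> K\<close>] \<open>t \<noteq> s\<close> by (simp add: left_diff_distrib)
        then have eq': "norm (H t - \<phi> s * (1 / (t - s))) * norm (t - s) = norm (\<phi> t)"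
          by (metis norm_minus_cancel norm_mult)
        have "norm (H t - \<phi> s * (1 / (t - s))) * (R / 2) \<le> norm (H t - \<phi> s * (1 / (t - s))) * norm (t - s)"
          using far by (rule mult_left_mono) simp
        also have "\<dots> \<le> e'"
          using c[of t] that R unfolding eq' by auto
        finally have "norm (H t - \<phi> s * (1 / (t - s))) * (R / 2) \<le> e'" .
        then show ?thesis
          using R by (simp add: field_simps)
      qed
    qed (use R \<open>e' > 0\<close> in auto)
    also have "\<dots> = e"
      using R by (simp add: e'_def)
    finally show ?thesis
      by (simp add: ac_simps)
  qed
  have "norm (cycle_integral A \<gamma> H - 2 * of_real pi * \<i> * \<phi> s) \<le> 0"
  proof (rule field_le_epsilon)
    show "norm (cycle_integral A \<gamma> H - 2 * of_real pi * \<i> * \<phi> s) \<le> 0 + e" if "e > 0" for e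
      using bound[OF that] by simp
  qed
  then show ?thesis
    by simp
qed

text \<open>\<open>E1\<close> and \<open>E2\<close> are two expressions for the same function with
  complementary domains: \<open>E1\<close> makes sense on the contour, \<open>E2\<close> makes sense
  on \<open>K\<close>. As \<open>K\<close> and the contour are disjoint, they glue to a function
  holomorphic on all of \<open>\<Omega>\<close>, whose product with \<open>F\<close> integrates to
  zero.\<close>

theorem cycle_double_integral:
  assumes \<Omega>: "open \<Omega>" and K: "compact K" and cyc: "cycle_in (\<Omega> - K) A \<gamma>"
    and wn: "\<And>z. z \<in> K \<Longrightarrow> cycle_winding A \<gamma> z = 1" "\<And>z. z \<notin> \<Omega> \<Longrightarrow> cycle_winding A \<gamma> z = 0"
    and F: "F holomorphic_on \<Omega>" and G: "G holomorphic_on \<Omega>"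
    and \<phi>: "\<phi> holomorphic_on - K" "(\<phi> \<longlongrightarrow> 0) at_infinity"
    and H: "\<And>s. s \<notin> K \<Longrightarrow> H s holomorphic_on - K"
      "\<And>s t. s \<notin> K \<Longrightarrow> t \<notin> K \<Longrightarrow> H s t * (t - s) = \<phi> s - \<phi> t"
    and inner: "(\<lambda>s. cycle_integral A \<gamma> (\<lambda>t. G t * H s t)) holomorphic_on (\<Omega> - K)"
  shows "cycle_integral A \<gamma> (\<lambda>s. F s * cycle_integral A \<gamma> (\<lambda>t. G t * H s t)) =
    2 * of_real pi * \<i> * cycle_integral A \<gamma> (\<lambda>s. F s * G s * \<phi> s)"
proof -
  define P where "P = (\<Union>i\<in>A. path_image (\<gamma> i))"
  have paths: "P \<subseteq> \<Omega> - K" "closed P"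
    using cyc unfolding P_def cycle_in_def by (blast, intro closed_UN) (auto simp: closed_valid_path_image)
  have opens: "open (\<Omega> - K)" "open (\<Omega> - P)"
    using \<Omega> K paths by (auto intro: open_Diff compact_imp_closed)
  note hol = holomorphic_on_subset[OF F] holomorphic_on_subset[OF G] holomorphic_on_subset[OF \<phi>(1)]
  define E1 where "E1 s = 2 * of_real pi * \<i> * (G s * \<phi> s) - cycle_integral A \<gamma> (\<lambda>t. G t * H s t)" for s
  \<comment> \<open>The winding number around \<open>s\<close>, which is not prescribed for
    \<open>s\<close> in \<open>\<Omega> - K\<close>, has dropped out of this expression.\<close>
  define E2 where "E2 s = cycle_integral A \<gamma> (\<lambda>t. G t * \<phi> t / (t - s)) -
      G s * cycle_integral A \<gamma> (\<lambda>t. \<phi> t / (t - s))" for s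
  have eq: "E1 s = E2 s" if "s \<in> \<Omega> - K" "s \<notin> P" for s
  proof -
    have cyc': "cycle_in (\<Omega> - K - {s}) A \<gamma>"
      using cyc that(2) unfolding cycle_in_def P_def by blast
    have op: "open (\<Omega> - K - {s})"
      using opens by auto
    have h: "(\<lambda>t. 1 / (t - s)) holomorphic_on (\<Omega> - K - {s})" "(\<lambda>t. \<phi> t / (t - s)) holomorphic_on (\<Omega> - K - {s})"
      "(\<lambda>t. G t / (t - s)) holomorphic_on (\<Omega> - K - {s})" "(\<lambda>t. G t * \<phi> t / (t - s)) holomorphic_on (\<Omega> - K - {s})"
      by (intro holomorphic_intros hol; auto)+
    have h': "(\<lambda>t. \<phi> s * (1 / (t - s))) holomorphic_on (\<Omega> - K - {s})" "(\<lambda>t. \<phi> s * (G t / (t - s))) holomorphic_on (\<Omega> - K - {s})"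
      by (rule holomorphic_on_mult[OF holomorphic_on_const h(1)],
          rule holomorphic_on_mult[OF holomorphic_on_const h(3)])
    have Hst: "H s t = (\<phi> s - \<phi> t) / (t - s)" if "t \<in> \<Omega> - K - {s}" for t
      using H(2)[of s t] that \<open>s \<in> \<Omega> - K\<close> by (simp add: field_simps)
    \<comment> \<open>The value of this integral is known although the values of its two parts are
      not. The relation serves to eliminate the integral of \<open>1 / (t - s)\<close> from the
      integral with the factor \<open>G t\<close>.\<close>
    have "2 * of_real pi * \<i> * \<phi> s = cycle_integral A \<gamma> (H s)"
      using that by (intro cycle_difference_quotient[OF K _ wn(1) \<phi> _ H, symmetric] cycle_in_mono[OF cyc]) auto
    also have "\<dots> = cycle_integral A \<gamma> (\<lambda>t. \<phi> s * (1 / (t - s)) - \<phi> t / (t - s))"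
      by (rule cycle_integral_cong[OF cyc']) (simp add: Hst diff_divide_distrib)
    also have "\<dots> = \<phi> s * cycle_integral A \<gamma> (\<lambda>t. 1 / (t - s)) - cycle_integral A \<gamma> (\<lambda>t. \<phi> t / (t - s))"
      unfolding cycle_integral_diff[OF op cyc' h'(1) h(2)] cycle_integral_cmult[OF op cyc' h(1)] ..
    finally have 1: "2 * of_real pi * \<i> * \<phi> s =
        \<phi> s * cycle_integral A \<gamma> (\<lambda>t. 1 / (t - s)) - cycle_integral A \<gamma> (\<lambda>t. \<phi> t / (t - s))" .
    have "cycle_integral A \<gamma> (\<lambda>t. G t * H s t) = cycle_integral A \<gamma> (\<lambda>t. \<phi> s * (G t / (t - s)) - G t * \<phi> t / (t - s))"
      by (rule cycle_integral_cong[OF cyc']) (simp add: Hst diff_divide_distrib algebra_simps)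
    also have "\<dots> = \<phi> s * cycle_integral A \<gamma> (\<lambda>t. G t / (t - s)) - cycle_integral A \<gamma> (\<lambda>t. G t * \<phi> t / (t - s))"
      unfolding cycle_integral_diff[OF op cyc' h'(2) h(4)] cycle_integral_cmult[OF op cyc' h(3)] ..
    also have "cycle_integral A \<gamma> (\<lambda>t. G t / (t - s)) = G s * cycle_integral A \<gamma> (\<lambda>t. 1 / (t - s))"
      using cyc that by (intro cycle_Cauchy_formula[OF \<Omega> _ _ G wn(2)]) (auto simp: cycle_in_def P_def)
    finally have 2: "cycle_integral A \<gamma> (\<lambda>t. G t * H s t) =
        \<phi> s * (G s * cycle_integral A \<gamma> (\<lambda>t. 1 / (t - s))) - cycle_integral A \<gamma> (\<lambda>t. G t * \<phi> t / (t - s))" .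
    have "2 * of_real pi * \<i> * (G s * \<phi> s) = G s * (2 * of_real pi * \<i> * \<phi> s)"
      by simp
    then show ?thesis
      unfolding E1_def E2_def 1 2 by (simp add: algebra_simps)
  qed
  define E where "E s = (if s \<in> K then E2 s else E1 s)" for s
  have E1: "E1 holomorphic_on (\<Omega> - K)"
    unfolding E1_def by (intro holomorphic_intros inner hol) auto
  have Cauchy: "(\<lambda>s. cycle_integral A \<gamma> (\<lambda>t. q t / (t - s))) holomorphic_on \<Omega> - P" if "q holomorphic_on \<Omega> - K" for q
    by (rule holomorphic_on_subset[OF holomorphic_Cauchy_integral[OF opens(1) cyc that]])
      (auto simp: P_def)
  have E2: "E2 holomorphic_on (\<Omega> - P)"
    unfolding E2_def
    by (intro holomorphic_on_diff holomorphic_on_mult Cauchy hol) auto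
  have "E holomorphic_on (\<Omega> - K) \<union> (\<Omega> - P)"
  proof (rule holomorphic_on_Un[OF _ _ opens])
    show "E holomorphic_on \<Omega> - K"
      using E1 by (rule holomorphic_transform) (auto simp: E_def)
    show "E holomorphic_on \<Omega> - P"
      using E2 by (rule holomorphic_transform) (auto simp: E_def eq)
  qed
  moreover have "(\<Omega> - K) \<union> (\<Omega> - P) = \<Omega>"
    using paths by blast
  ultimately have "(\<lambda>s. F s * E s) holomorphic_on \<Omega>"
    using F by (auto intro: holomorphic_on_mult)
  then have "cycle_integral A \<gamma> (\<lambda>s. F s * E s) = 0"
    using cycle_in_mono[OF cyc] by (intro cycle_Cauchy[OF \<Omega> _ _ wn(2)]) auto
  also have "cycle_integral A \<gamma> (\<lambda>s. F s * E s) = cycle_integral A \<gamma> (\<lambda>s.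
      2 * of_real pi * \<i> * (F s * G s * \<phi> s) - F s * cycle_integral A \<gamma> (\<lambda>t. G t * H s t))"
    by (rule cycle_integral_cong[OF cyc]) (simp add: E_def E1_def algebra_simps)
  also have "\<dots> = 2 * of_real pi * \<i> * cycle_integral A \<gamma> (\<lambda>s. F s * G s * \<phi> s) -
      cycle_integral A \<gamma> (\<lambda>s. F s * cycle_integral A \<gamma> (\<lambda>t. G t * H s t))"
  proof -
    have h: "(\<lambda>s. F s * G s * \<phi> s) holomorphic_on \<Omega> - K"
      by (intro holomorphic_intros hol) auto
    moreover have "(\<lambda>s. F s * cycle_integral A \<gamma> (\<lambda>t. G t * H s t)) holomorphic_on \<Omega> - K"
      by (intro holomorphic_intros hol inner) auto
    moreover have "(\<lambda>s. 2 * of_real pi * \<i> * (F s * G s * \<phi> s)) holomorphic_on \<Omega> - K"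
      by (rule holomorphic_on_mult[OF holomorphic_on_const h])
    ultimately show ?thesis
      using cycle_integral_diff[OF opens(1) cyc] cycle_integral_cmult[OF opens(1) cyc h] by simp
  qed
  finally show ?thesis
    by simp
qed

section \<open>Banach algebras\<close>

text \<open>The sort is a ring with unit in which \<open>0 = 1\<close> is allowed, because the
  operators on a trivial space are an instance. A class such as \<open>ring_1\<close> would exclude
  it.\<close>

definition inverse_pair :: "'a::{ring, monoid_mult} \<Rightarrow> 'a \<Rightarrow> bool" where
  "inverse_pair x y \<longleftrightarrow> x * y = 1 \<and> y * x = 1"

definition ring_inv :: "'a::{ring, monoid_mult} \<Rightarrow> 'a" where
  "ring_inv x = (THE y. inverse_pair x y)"

definition ring_units :: "'a::{ring, monoid_mult} set" where
  "ring_units = {x. \<exists>y. inverse_pair x y}"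

lemma inverse_pair_unique: "inverse_pair x y \<Longrightarrow> inverse_pair x z \<Longrightarrow> y = z"
  unfolding inverse_pair_def by (metis mult.assoc mult.left_neutral mult.right_neutral)

lemma ring_inv_eq: "inverse_pair x y \<Longrightarrow> ring_inv x = y"
  unfolding ring_inv_def using inverse_pair_unique by blast

lemma inverse_pair_ring_inv: "x \<in> ring_units \<Longrightarrow> inverse_pair x (ring_inv x)"
  unfolding ring_units_def using ring_inv_eq by force

lemma ring_inv_mult [simp]:
  "x \<in> ring_units \<Longrightarrow> x * ring_inv x = 1" "x \<in> ring_units \<Longrightarrow> ring_inv x * x = 1"
  using inverse_pair_ring_inv by (auto simp: inverse_pair_def)

lemma ring_inv_commute:
  assumes "x \<in> ring_units" "c * x = x * c"
  shows "c * ring_inv x = ring_inv x * c"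
proof -
  have "c * ring_inv x = (ring_inv x * x) * (c * ring_inv x)"
    using assms by simp
  also have "\<dots> = ring_inv x * (x * c) * ring_inv x"
    by (simp only: mult.assoc)
  also have "\<dots> = ring_inv x * c * (x * ring_inv x)"
    by (simp only: assms(2)[symmetric] mult.assoc)
  finally show ?thesis
    using assms by simp
qed

text \<open>Powers start at one, since the class constraints give no upper bound for the norm of
  \<open>1\<close>.\<close>

lemma norm_power_Suc_le:
  fixes x :: "'a::{real_normed_algebra, monoid_mult}"
  shows "norm (x ^ Suc n) \<le> norm x ^ Suc n"
proof (induction n)
  case (Suc n)
  have "norm (x ^ Suc (Suc n)) \<le> norm x * norm (x ^ Suc n)"
    by (metis norm_mult_ineq power_Suc)
  also have "\<dots> \<le> norm x * norm x ^ Suc n"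
    by (intro mult_left_mono Suc) auto
  finally show ?case
    by simp
qed simp

text \<open>The Neumann series is a two-sided inverse: its partial sums satisfy the geometric
  identity on both sides, and \<open>e ^ k\<close> tends to zero.\<close>

lemma one_minus_unit:
  fixes e :: "'a::{real_normed_algebra, monoid_mult, banach}"
  assumes "norm e < 1"
  shows "1 - e \<in> ring_units"
proof -
  have "summable (\<lambda>n. norm e ^ Suc n)"
    using assms by (subst summable_Suc_iff) (auto intro: summable_geometric)
  then have "summable (\<lambda>n. e ^ Suc n)"
    by (rule summable_comparison_test'[where N = 0]) (rule norm_power_Suc_le)
  then have sm: "summable (\<lambda>n. e ^ n)"
    by (subst (asm) summable_Suc_iff)
  define S where "S = (\<Sum>n. e ^ n)"
  have S: "(\<lambda>k. \<Sum>n<k. e ^ n) \<longlonglongrightarrow> S"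
    using summable_LIMSEQ[OF sm] by (simp add: S_def)
  have "(\<lambda>k. 1 - e ^ k) \<longlonglongrightarrow> 1 - 0"
    by (intro tendsto_intros summable_LIMSEQ_zero sm)
  moreover have "(1 - e) * (\<Sum>n<k. e ^ n) = 1 - e ^ k" for k
  proof (induction k)
    case (Suc k)
    have "(1 - e) * e ^ k = e ^ k - e ^ Suc k"
      by (simp add: left_diff_distrib)
    then show ?case
      by (simp add: distrib_left Suc)
  qed simp
  moreover have "(\<Sum>n<k. e ^ n) * (1 - e) = 1 - e ^ k" for k
  proof (induction k)
    case (Suc k)
    have "e ^ k * (1 - e) = e ^ k - e ^ Suc k"
      by (simp add: right_diff_distrib power_commutes)
    then show ?case
      by (simp add: distrib_right Suc)
  qed simp
  moreover have "(\<lambda>k. (1 - e) * (\<Sum>n<k. e ^ n)) \<longlonglongrightarrow> (1 - e) * S"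
    "(\<lambda>k. (\<Sum>n<k. e ^ n) * (1 - e)) \<longlonglongrightarrow> S * (1 - e)"
    by (intro tendsto_intros S)+
  ultimately have "inverse_pair (1 - e) S"
    using LIMSEQ_unique by (auto simp: inverse_pair_def)
  then show ?thesis
    by (auto simp: ring_units_def)
qed

lemma ring_units_mult:
  assumes "x \<in> ring_units" "y \<in> ring_units"
  shows "x * y \<in> ring_units"
proof -
  have "x * y * (ring_inv y * ring_inv x) = x * (y * ring_inv y) * ring_inv x"
    "(ring_inv y * ring_inv x) * (x * y) = ring_inv y * (ring_inv x * x) * y"
    by (simp_all only: mult.assoc)
  then have "inverse_pair (x * y) (ring_inv y * ring_inv x)"
    using assms by (simp add: inverse_pair_def)
  then show ?thesis
    by (auto simp: ring_units_def)
qed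

lemma ring_units_perturb:
  fixes x :: "'a::{real_normed_algebra, monoid_mult, banach}"
  assumes "x \<in> ring_units" "norm (ring_inv x) * norm (x - x') < 1"
  shows "x' \<in> ring_units"
proof -
  have "norm (ring_inv x * (x - x')) < 1"
    using assms(2) norm_mult_ineq le_less_trans by blast
  then have "x * (1 - ring_inv x * (x - x')) \<in> ring_units"
    using assms(1) one_minus_unit ring_units_mult by blast
  moreover have "x * (1 - ring_inv x * (x - x')) = x - (x * ring_inv x) * (x - x')"
    by (simp only: right_diff_distrib mult.assoc mult_1_right)
  ultimately show ?thesis
    using assms(1) by simp
qed

lemma open_ring_units: "open (ring_units :: 'a::{real_normed_algebra, monoid_mult, banach} set)"
  unfolding open_dist
proof
  fix x :: 'a
  assume x: "x \<in> ring_units"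
  \<comment> \<open>The added \<open>1\<close> keeps the denominator positive even if the inverse
    has norm zero, as in the trivial algebra.\<close>
  define d where "d = 1 / (norm (ring_inv x) + 1)"
  have "norm (ring_inv x) + 1 > 0"
    by (simp add: add_nonneg_pos)
  have "x' \<in> ring_units" if "dist x' x < d" for x'
  proof (rule ring_units_perturb[OF x])
    have "norm (ring_inv x) * norm (x - x') \<le> (norm (ring_inv x) + 1) * norm (x - x')"
      by (intro mult_right_mono) auto
    also have "\<dots> < (norm (ring_inv x) + 1) * d"
      using that \<open>norm (ring_inv x) + 1 > 0\<close> by (intro mult_strict_left_mono) (auto simp: dist_norm norm_minus_commute)
    also have "\<dots> = 1"
      using \<open>norm (ring_inv x) + 1 > 0\<close> by (simp add: d_def)
    finally show "norm (ring_inv x) * norm (x - x') < 1" .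
  qed
  moreover have "d > 0"
    using \<open>norm (ring_inv x) + 1 > 0\<close> by (simp add: d_def)
  ultimately show "\<exists>e>0. \<forall>y. dist y x < e \<longrightarrow> y \<in> ring_units"
    by blast
qed

text \<open>The identity \<open>y^-1 - x^-1 = y^-1 (x - y) x^-1\<close> bounds the difference by a
  multiple of the unknown norm of \<open>y^-1\<close>. Once \<open>norm (x - y) * c < 1 / 2\<close>,
  it also bounds that norm by \<open>2 * c\<close>, which closes the estimate.\<close>

lemma continuous_on_ring_inv:
  "continuous_on (ring_units :: 'a::{real_normed_algebra, monoid_mult, banach} set) ring_inv"
  unfolding continuous_on_def
proof
  fix x :: 'a
  assume x: "x \<in> ring_units"
  define c where "c = norm (ring_inv x)"
  have lim: "((\<lambda>y. norm (x - y)) \<longlongrightarrow> norm (x - x)) (at x within ring_units)"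
    by (intro tendsto_intros)
  then have lim0: "((\<lambda>y. 2 * c * norm (x - y) * c) \<longlongrightarrow> 2 * c * 0 * c) (at x within ring_units)"
    by (intro tendsto_intros) simp
  have "((\<lambda>y. norm (x - y) * c) \<longlongrightarrow> 0 * c) (at x within ring_units)"
    using lim by (intro tendsto_intros) simp
  then have "eventually (\<lambda>y. norm (x - y) * c < 1 / 2) (at x within ring_units)"
    by (auto dest: order_tendstoD(2)[where a = "1 / 2"])
  moreover have "eventually (\<lambda>y. y \<in> ring_units) (at x within ring_units)"
    by (simp add: eventually_at_filter)
  ultimately have "eventually (\<lambda>y. norm (ring_inv y - ring_inv x) \<le> 2 * c * norm (x - y) * c) (at x within ring_units)"
  proof eventually_elim
    case (elim y)
    then have y: "y \<in> ring_units" and small: "norm (x - y) * c < 1 / 2"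
      by auto
      have "ring_inv y - ring_inv x = ring_inv y * (x * ring_inv x) - (ring_inv y * y) * ring_inv x"
        using x y by simp
      also have "\<dots> = ring_inv y * (x - y) * ring_inv x"
        by (simp only: right_diff_distrib left_diff_distrib mult.assoc)
      finally have "norm (ring_inv y - ring_inv x) \<le> norm (ring_inv y * (x - y)) * c"
        unfolding c_def by (metis norm_mult_ineq)
      also have "\<dots> \<le> norm (ring_inv y) * norm (x - y) * c"
        unfolding c_def by (intro mult_right_mono norm_mult_ineq) auto
      finally have le: "norm (ring_inv y - ring_inv x) \<le> norm (ring_inv y) * (norm (x - y) * c)"
        by (simp add: mult.assoc)
      have "norm (ring_inv y) * (norm (x - y) * c) \<le> norm (ring_inv y) * (1 / 2)"
        using small by (intro mult_left_mono) auto
      moreover have "norm (ring_inv y) \<le> norm (ring_inv y - ring_inv x) + c"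
        unfolding c_def by (metis diff_add_cancel norm_triangle_ineq)
      ultimately have "norm (ring_inv y) \<le> 2 * c"
        using le by simp
      then have "norm (ring_inv y) * (norm (x - y) * c) \<le> 2 * c * (norm (x - y) * c)"
        by (intro mult_right_mono) (auto simp: c_def)
      then show ?case
        using le by simp
  qed
  then have "((\<lambda>y. ring_inv y - ring_inv x) \<longlongrightarrow> 0) (at x within ring_units)"
    by (rule Lim_null_comparison) (use lim0 in simp)
  then show "(ring_inv \<longlongrightarrow> ring_inv x) (at x within ring_units)"
    by (simp add: LIM_zero_iff)
qed

section \<open>Holomorphic functions with values in a Banach algebra\<close>

text \<open>Left multiplication by the copy \<open>iota\<close> of the complex numbers makes the
  real algebra a complex vector space. As \<open>j\<close> is not assumed to be central, this is not
  a complex algebra, and commutation with \<open>j\<close> has to be tracked.\<close>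

locale imaginary_unit =
  fixes j :: "'a::{real_normed_algebra, monoid_mult, banach}"
  assumes jj: "j * j = -1"
begin

definition iota :: "complex \<Rightarrow> 'a" where
  "iota z = Re z *\<^sub>R 1 + Im z *\<^sub>R j"

lemma iota_add: "iota (w + z) = iota w + iota z"
  and iota_diff: "iota (w - z) = iota w - iota z"
  and iota_0 [simp]: "iota 0 = 0"
  and iota_1 [simp]: "iota 1 = 1"
  and iota_of_real: "iota (of_real r) = r *\<^sub>R 1"
  by (simp_all add: iota_def algebra_simps)

lemma iota_mult: "iota (w * z) = iota w * iota z"
  by (simp add: iota_def jj algebra_simps)

lemma iota_commute:
  assumes "c * j = j * c"
  shows "iota z * c = c * iota z"
  using assms by (simp add: iota_def algebra_simps)

lemma iota_j [simp]: "iota z * j = j * iota z"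
  by (simp add: iota_commute)

lemma bounded_linear_iota: "bounded_linear iota"
  unfolding iota_def
  by (intro bounded_linear_add bounded_linear_scaleR_const bounded_linear_Re bounded_linear_Im)

lemma norm_iota: "norm (iota z) \<le> (norm (1::'a) + norm j) * norm z"
proof -
  have "norm (iota z) \<le> \<bar>Re z\<bar> * norm (1::'a) + \<bar>Im z\<bar> * norm j"
    unfolding iota_def by (rule norm_triangle_le) simp
  also have "\<dots> \<le> norm z * norm (1::'a) + norm z * norm j"
    by (intro add_mono mult_right_mono abs_Re_le_cmod abs_Im_le_cmod) auto
  finally show ?thesis
    by (simp add: algebra_simps)
qed

text \<open>Complex differentiability for the left structure: the scalar \<open>iota h\<close>
  stands to the left of the derivative \<open>D\<close>.\<close>

definition jholo :: "complex set \<Rightarrow> (complex \<Rightarrow> 'a) \<Rightarrow> bool" where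
  "jholo S f \<longleftrightarrow> (\<forall>z\<in>S. \<exists>D. (f has_derivative (\<lambda>h. iota h * D)) (at z))"

lemma jholo_subset: "jholo S f \<Longrightarrow> S' \<subseteq> S \<Longrightarrow> jholo S' f"
  by (auto simp: jholo_def)

lemma jholo_continuous_on: "jholo S f \<Longrightarrow> continuous_on S f"
  unfolding jholo_def
  by (meson continuous_at_imp_continuous_on has_derivative_continuous)

lemma jholo_const: "jholo S (\<lambda>z. c)"
  unfolding jholo_def by (auto intro!: exI[of _ 0])

lemma jholo_add:
  assumes "jholo S f" "jholo S g"
  shows "jholo S (\<lambda>z. f z + g z)"
  unfolding jholo_def
proof
  fix z assume "z \<in> S"
  then obtain D D' where "(f has_derivative (\<lambda>h. iota h * D)) (at z)" "(g has_derivative (\<lambda>h. iota h * D')) (at z)"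
    using assms(1,2) unfolding jholo_def by blast
  then have "((\<lambda>z. f z + g z) has_derivative (\<lambda>h. iota h * (D + D'))) (at z)"
    by (auto simp: distrib_left intro: has_derivative_add)
  then show "\<exists>D. ((\<lambda>z. f z + g z) has_derivative (\<lambda>h. iota h * D)) (at z)"
    by blast
qed

lemma jholo_sum: "(\<And>r. r \<in> R \<Longrightarrow> jholo S (f r)) \<Longrightarrow> jholo S (\<lambda>z. \<Sum>r\<in>R. f r z)"
  by (induction R rule: infinite_finite_induct) (auto intro: jholo_add jholo_const)

text \<open>In the product rule the scalar \<open>iota h\<close> has to move to the front past
  \<open>f z\<close>, hence a commutation condition on \<open>f\<close> and none on
  \<open>g\<close>.\<close>

lemma jholo_mult:
  assumes "open S" "jholo S f" "jholo S g" and comm: "\<And>z. z \<in> S \<Longrightarrow> f z * j = j * f z"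
  shows "jholo S (\<lambda>z. f z * g z)"
  unfolding jholo_def
proof
  fix z assume z: "z \<in> S"
  then obtain D D' where "(f has_derivative (\<lambda>h. iota h * D)) (at z)" "(g has_derivative (\<lambda>h. iota h * D')) (at z)"
    using assms(2,3) unfolding jholo_def by blast
  then have "((\<lambda>z. f z * g z) has_derivative (\<lambda>h. f z * (iota h * D') + (iota h * D) * g z)) (at z)"
    by (rule has_derivative_mult)
  moreover have "f z * (iota h * D') + (iota h * D) * g z = iota h * (f z * D' + D * g z)" for h
  proof -
    have "f z * (iota h * D') = iota h * (f z * D')"
      using iota_commute[OF comm[OF z], of h] by (simp add: mult.assoc[symmetric])
    then show ?thesis
      by (simp add: distrib_left mult.assoc)
  qed
  ultimately have "((\<lambda>z. f z * g z) has_derivative (\<lambda>h. iota h * (f z * D' + D * g z))) (at z)"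
    by simp
  then show "\<exists>D. ((\<lambda>z. f z * g z) has_derivative (\<lambda>h. iota h * D)) (at z)"
    by blast
qed

lemma jholo_power:
  assumes "open S" "jholo S f" and comm: "\<And>z. z \<in> S \<Longrightarrow> f z * j = j * f z"
  shows "jholo S (\<lambda>z. f z ^ n)"
  by (induction n) (auto intro!: jholo_const jholo_mult assms)

lemma jholo_iota:
  assumes "open S" "F holomorphic_on S"
  shows "jholo S (\<lambda>z. iota (F z))"
  unfolding jholo_def
proof
  fix z assume "z \<in> S"
  then have "(F has_field_derivative deriv F z) (at z)"
    using assms holomorphic_derivI by blast
  then have "(F has_derivative (\<lambda>h. deriv F z * h)) (at z)"
    by (simp add: has_field_derivative_def)
  then have "((\<lambda>z. iota (F z)) has_derivative (\<lambda>h. iota (deriv F z * h))) (at z)"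
    by (rule bounded_linear.has_derivative[OF bounded_linear_iota])
  then show "\<exists>D. ((\<lambda>z. iota (F z)) has_derivative (\<lambda>h. iota h * D)) (at z)"
    by (intro exI[of _ "iota (deriv F z)"]) (simp add: iota_mult[symmetric] mult.commute)
qed

text \<open>The difference quotient is supplied as a function \<open>q\<close>, as in the
  characterization of derivatives by Caratheodory, so that no division in the algebra is
  needed.\<close>

lemma has_iota_derivativeI:
  assumes "open S" "z \<in> S" and eq: "\<And>w. w \<in> S \<Longrightarrow> f w - f z = iota (w - z) * q w"
    and lim: "(q \<longlongrightarrow> D) (at z)" and "q z = D"
  shows "(f has_derivative (\<lambda>h. iota h * D)) (at z)"
  unfolding has_derivative_at_alt
proof (intro conjI allI impI)
  show "bounded_linear (\<lambda>h. iota h * D)"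
    by (intro bounded_linear_mult_left[THEN bounded_linear_compose] bounded_linear_iota)
  fix e :: real assume "e > 0"
  define C where "C = norm (1::'a) + norm j + 1"
  have "C > 0"
    by (simp add: C_def add_nonneg_pos)
  have "eventually (\<lambda>w. dist (q w) D < e / C) (at z)"
    using lim \<open>e > 0\<close> \<open>C > 0\<close> by (intro tendstoD) auto
  moreover have "eventually (\<lambda>w. w \<in> S) (at z)"
    using assms(1,2) eventually_at_topological by blast
  ultimately have "eventually (\<lambda>w. dist (q w) D < e / C \<and> w \<in> S) (at z)"
    by eventually_elim simp
  then obtain d where "d > 0" and d: "\<And>w. w \<noteq> z \<Longrightarrow> dist w z < d \<Longrightarrow> dist (q w) D < e / C \<and> w \<in> S"
    unfolding eventually_at by blast
  have "norm (f w - f z - iota (w - z) * D) \<le> e * norm (w - z)" if "norm (w - z) < d" for w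
  proof (cases "w = z")
    case False
    then have w: "norm (q w - D) \<le> e / C" "w \<in> S"
      using d[of w] that by (auto simp: dist_norm intro: less_imp_le)
    have "norm (f w - f z - iota (w - z) * D) = norm (iota (w - z) * (q w - D))"
      using eq[OF w(2)] by (simp add: right_diff_distrib)
    also have "\<dots> \<le> norm (iota (w - z)) * norm (q w - D)"
      by (rule norm_mult_ineq)
    also have "\<dots> \<le> (C * norm (w - z)) * (e / C)"
    proof (intro mult_mono w)
      have "norm (iota (w - z)) \<le> (norm (1::'a) + norm j) * norm (w - z)"
        by (rule norm_iota)
      also have "\<dots> \<le> C * norm (w - z)"
        by (intro mult_right_mono) (auto simp: C_def)
      finally show "norm (iota (w - z)) \<le> C * norm (w - z)" .
    qed (use \<open>C > 0\<close> in auto)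
    finally show ?thesis
      using \<open>C > 0\<close> by (simp add: mult.commute)
  qed simp
  then show "\<exists>d>0. \<forall>w. norm (w - z) < d \<longrightarrow> norm (f w - f z - iota (w - z) * D) \<le> e * norm (w - z)"
    using \<open>d > 0\<close> by blast
qed

section \<open>Complex-linear functionals and primitives\<close>

text \<open>The complex-linear functional with real part \<open>l\<close>, that is, the usual
  \<open>l x - \<i> l (\<i> x)\<close> for the left structure given by \<open>j\<close>.\<close>

definition cfun :: "('a \<Rightarrow> real) \<Rightarrow> 'a \<Rightarrow> complex" where
  "cfun l x = Complex (l x) (- l (j * x))"

lemma cfun_iota:
  assumes "bounded_linear l"
  shows "cfun l (iota z * x) = z * cfun l x"
proof -
  interpret bounded_linear l by fact
  have *: "iota z * x = Re z *\<^sub>R x + Im z *\<^sub>R (j * x)"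
    by (simp add: iota_def algebra_simps)
  have "j * (iota z * x) = Re z *\<^sub>R (j * x) - Im z *\<^sub>R x"
    unfolding * by (simp add: distrib_left mult.assoc[symmetric] jj)
  then show ?thesis
    by (simp add: cfun_def * complex_eq_iff add diff scaleR)
qed

lemma bounded_linear_cfun:
  assumes "bounded_linear l"
  shows "bounded_linear (cfun l)"
proof -
  have eq: "cfun l = (\<lambda>x. complex_of_real (l x) + complex_of_real (l (j * x)) * (- \<i>))"
    by (auto simp: cfun_def complex_eq_iff)
  have "bounded_linear (\<lambda>x. l (j * x))"
    using assms bounded_linear_mult_right by (rule bounded_linear_compose)
  then show ?thesis
    unfolding eq using assms
    by (intro bounded_linear_add bounded_linear_of_real[THEN bounded_linear_compose]
        bounded_linear_mult_left[THEN bounded_linear_compose])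
qed

lemma cfun_eq_0:
  assumes "\<And>l. bounded_linear l \<Longrightarrow> cfun l x = 0"
  shows "x = 0"
  using assms bounded_linear_functional_separates[of x] by (auto simp: cfun_def complex_eq_iff)

lemma cfun_eqI:
  assumes "\<And>l. bounded_linear l \<Longrightarrow> cfun l x = cfun l y"
  shows "x = y"
  using cfun_eq_0[of "x - y"] assms by (simp add: bounded_linear_cfun linear_diff bounded_linear.linear)

lemma cfun_holomorphic:
  assumes "bounded_linear l" "open S" "jholo S f"
  shows "(\<lambda>z. cfun l (f z)) holomorphic_on S"
proof -
  have "\<exists>D. ((\<lambda>z. cfun l (f z)) has_field_derivative D) (at z)" if z: "z \<in> S" for z
  proof -
    obtain D where "(f has_derivative (\<lambda>h. iota h * D)) (at z)"
      using assms(3) z by (auto simp: jholo_def)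
    then have "((\<lambda>z. cfun l (f z)) has_derivative (\<lambda>h. cfun l (iota h * D))) (at z)"
      by (rule bounded_linear.has_derivative[OF bounded_linear_cfun[OF assms(1)]])
    then show ?thesis
      by (intro exI[of _ "cfun l D"])
        (simp add: has_field_derivative_def cfun_iota[OF assms(1)] mult_commute_abs)
  qed
  then show ?thesis
    using assms(2) by (simp add: holomorphic_on_open)
qed

text \<open>\<open>m a b\<close> is the mean of \<open>f\<close> over the segment, so
  \<open>iota (b - a) * m a b\<close> is the integral along it. Additivity over triangles is tested
  with functionals, to which the scalar theory on a disc applies, and \<open>m z\<close> serves as
  the difference quotient of the primitive at \<open>z\<close>.\<close>

lemma jholo_primitive:
  assumes f: "jholo (ball c r) f"
  obtains g where "\<And>z. z \<in> ball c r \<Longrightarrow> (g has_derivative (\<lambda>h. iota h * f z)) (at z)"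
proof -
  have cont: "continuous_on (ball c r) f"
    using f by (rule jholo_continuous_on)
  define m where "m a b = integral {0..1} (\<lambda>t. f (linepath a b t))" for a b
  have seg: "linepath a b t \<in> ball c r" if "a \<in> ball c r" "b \<in> ball c r" "t \<in> {0..1}" for a b t
    using that convex_ball[of c r]
    by (metis closed_segment_subset linepath_in_path subsetD)
  have contl: "continuous_on {0..1} (\<lambda>t. f (linepath a b t))" if "a \<in> ball c r" "b \<in> ball c r" for a b
    using that by (intro continuous_on_compose2[OF cont] continuous_intros continuous_on_linepath) (auto intro: seg)
  have int: "(\<lambda>t. f (linepath a b t)) integrable_on {0..1}" if "a \<in> ball c r" "b \<in> ball c r" for a b
    using contl[OF that] by (rule integrable_continuous_real)
  have cfun_m: "cfun l (iota (b - a) * m a b) = contour_integral (linepath a b) (\<lambda>z. cfun l (f z))"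
    if "bounded_linear l" "a \<in> ball c r" "b \<in> ball c r" for l a b
  proof -
    have "cfun l (m a b) = integral {0..1} (cfun l \<circ> (\<lambda>t. f (linepath a b t)))"
      unfolding m_def using integral_linear[OF int[OF that(2,3)] bounded_linear_cfun[OF that(1)]] by simp
    then have "cfun l (iota (b - a) * m a b) = (b - a) * integral {0..1} (\<lambda>t. cfun l (f (linepath a b t)))"
      by (simp add: cfun_iota[OF that(1)] o_def)
    also have "\<dots> = integral {0..1} (\<lambda>t. (b - a) * cfun l (f (linepath a b t)))"
      by simp
    finally show ?thesis
      unfolding contour_integral_integral
      by (simp add: vector_derivative_linepath_within mult.commute cong: integral_cong)
  qed
  define g where "g z = iota (z - c) * m c z" for z
  have diff: "g w - g z = iota (w - z) * m z w" if "z \<in> ball c r" "w \<in> ball c r" for z w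
  proof (rule cfun_eqI)
    fix l :: "'a \<Rightarrow> real"
    assume l: "bounded_linear l"
    interpret cl: bounded_linear "cfun l"
      by (rule bounded_linear_cfun[OF l])
    have "c \<in> ball c r"
      using that(1) by (metis centre_in_ball empty_iff ball_eq_empty not_le)
    have "(\<lambda>z. cfun l (f z)) holomorphic_on ball c r"
      by (rule cfun_holomorphic[OF l open_ball f])
    then obtain h where "\<And>x. x \<in> ball c r \<Longrightarrow> (h has_field_derivative cfun l (f x)) (at x within ball c r)"
      using holomorphic_convex_primitive'[OF convex_ball open_ball] by blast
    then have *: "contour_integral (linepath a b) (\<lambda>z. cfun l (f z)) = h b - h a"
      if "a \<in> ball c r" "b \<in> ball c r" for a b
      using contour_integral_primitive[of "ball c r" h "\<lambda>z. cfun l (f z)" "linepath a b"] that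
        closed_segment_subset[OF _ _ convex_ball] contour_integral_unique by fastforce
    show "cfun l (g w - g z) = cfun l (iota (w - z) * m z w)"
      using that \<open>c \<in> ball c r\<close> by (simp add: cl.diff g_def cfun_m[OF l] *)
  qed
  have "(g has_derivative (\<lambda>h. iota h * f z)) (at z)" if z: "z \<in> ball c r" for z
  proof (rule has_iota_derivativeI[OF open_ball z diff[OF z]])
    show "m z z = f z"
      by (simp add: m_def)
    show "((\<lambda>w. m z w) \<longlongrightarrow> f z) (at z)"
    proof (rule tendstoI)
      fix e :: real assume "e > 0"
      have "isCont f z"
        using cont z by (simp add: continuous_on_eq_continuous_at)
      then obtain d where "d > 0" and d: "\<And>w. dist w z < d \<Longrightarrow> dist (f w) (f z) < e / 2"
        using \<open>e > 0\<close> unfolding continuous_at_eps_delta by (meson half_gt_zero)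
      obtain d' where "d' > 0" "ball z d' \<subseteq> ball c r"
        using z open_ball open_contains_ball by metis
      have "dist (m z w) (f z) < e" if w: "dist w z < min d d'" for w
      proof -
        have "w \<in> ball c r"
          using w \<open>ball z d' \<subseteq> ball c r\<close> by (meson dist_commute_lessI mem_ball min_less_iff_conj subsetD)
        have "norm (f (linepath z w t) - f z) \<le> e / 2" if "t \<in> {0..1}" for t
        proof -
          have "dist (linepath z w t) z \<le> dist w z"
            using linepath_in_path[OF that, of z w] by (metis dist_commute dist_in_closed_segment)
          then show ?thesis
            using d[of "linepath z w t"] w by (simp add: dist_norm)
        qed
        then have "norm (integral {0..1} (\<lambda>t. f (linepath z w t) - f z)) \<le> (e / 2) * (1 - 0)"
          by (intro integral_bound continuous_on_diff contl z \<open>w \<in> ball c r\<close>) auto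
        moreover have "integral {0..1} (\<lambda>t. f (linepath z w t) - f z) = m z w - f z"
          using Henstock_Kurzweil_Integration.integral_diff[OF int[OF z \<open>w \<in> ball c r\<close>] integrable_const_ivl, of "f z"]
          by (simp add: m_def)
        ultimately show ?thesis
          using \<open>e > 0\<close> by (simp add: dist_norm)
      qed
      then show "eventually (\<lambda>w. dist (m z w) (f z) < e) (at z)"
        unfolding eventually_at using \<open>d > 0\<close> \<open>d' > 0\<close> by (intro exI[of _ "min d d'"]) auto
    qed
  qed
  with that show ?thesis
    by blast
qed

end

section \<open>The spectrum of the quadratic pencil\<close>

text \<open>This is \<open>(z^2 + B) (cnj z^2 + B)\<close> multiplied out, which contains no
  imaginary unit. The spectrum defined through this product instead of \<open>z^2 + B\<close> is the
  same for all imaginary units and symmetric under conjugation.\<close>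

definition resolvent_norm :: "'a::{real_normed_algebra, monoid_mult, banach} \<Rightarrow> complex \<Rightarrow> 'a" where
  "resolvent_norm B z = (norm z ^ 4) *\<^sub>R 1 + (2 * Re (z\<^sup>2)) *\<^sub>R B + B * B"

definition quadratic_spectrum :: "'a::{real_normed_algebra, monoid_mult, banach} \<Rightarrow> complex set" where
  "quadratic_spectrum B = {z. resolvent_norm B z \<notin> ring_units}"

lemma resolvent_norm_cnj [simp]: "resolvent_norm B (cnj z) = resolvent_norm B z"
  by (simp add: resolvent_norm_def flip: complex_cnj_power)

lemma cnj_quadratic_spectrum [simp]: "cnj z \<in> quadratic_spectrum B \<longleftrightarrow> z \<in> quadratic_spectrum B"
  by (simp add: quadratic_spectrum_def)

lemma resolvent_norm_commute: "c * B = B * c \<Longrightarrow> c * resolvent_norm B z = resolvent_norm B z * c"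
  unfolding resolvent_norm_def
  by (simp add: algebra_simps) (metis mult.assoc)

lemma continuous_resolvent_norm: "continuous_on S (resolvent_norm B)"
  unfolding resolvent_norm_def by (intro continuous_intros)

lemma closed_quadratic_spectrum: "closed (quadratic_spectrum B)"
proof -
  have "open (resolvent_norm B -` ring_units \<inter> UNIV)"
    using continuous_resolvent_norm[of UNIV B] open_ring_units
    by (simp only: continuous_on_open_vimage open_UNIV) blast
  moreover have "resolvent_norm B -` ring_units \<inter> UNIV = - quadratic_spectrum B"
    by (auto simp: quadratic_spectrum_def)
  ultimately show ?thesis
    by (simp add: closed_def)
qed

section \<open>Contour integrals with values in the algebra\<close>

context imaginary_unit
begin

definition path_int :: "(real \<Rightarrow> complex) \<Rightarrow> (complex \<Rightarrow> 'a) \<Rightarrow> 'a" where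
  "path_int \<gamma> f = integral {0..1} (\<lambda>t. iota (vector_derivative \<gamma> (at t within {0..1})) * f (\<gamma> t))"

text \<open>The derivative of a valid path may be unbounded near the finitely many exceptional
  points, so piecewise continuity does not yield integrability. Locally \<open>f\<close> has a
  primitive \<open>g\<close>, and the fundamental theorem with finitely many exceptions integrates
  the derivative of \<open>g \<circ> \<gamma>\<close>; the small intervals are then put
  together.\<close>

lemma path_integrable:
  assumes "open S" "valid_path \<gamma>" "path_image \<gamma> \<subseteq> S" "jholo S f"
  shows "(\<lambda>t. iota (vector_derivative \<gamma> (at t within {0..1})) * f (\<gamma> t)) integrable_on {0..1}"
proof -
  obtain k where k: "finite k" "\<gamma> C1_differentiable_on {0..1} - k"
    using assms(2) unfolding valid_path_def piecewise_C1_differentiable_on_def by blast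
  have cont: "continuous_on {0..1} \<gamma>"
    using assms(2) by (simp add: valid_path_imp_path path_def[symmetric])
  let ?f = "\<lambda>t. iota (vector_derivative \<gamma> (at t within {0..1})) * f (\<gamma> t)"
  have "\<exists>d>0. \<forall>u v. x \<in> cbox u v \<and> cbox u v \<subseteq> ball x d \<and> cbox u v \<subseteq> cbox 0 1 \<longrightarrow> ?f integrable_on cbox u v"
    if x: "x \<in> cbox 0 1" for x :: real
  proof -
    have "\<gamma> x \<in> S"
      using assms(3) x by (auto simp: path_image_def)
    then obtain r where "r > 0" and r: "ball (\<gamma> x) r \<subseteq> S"
      using assms(1) open_contains_ball by blast
    obtain g where g: "\<And>z. z \<in> ball (\<gamma> x) r \<Longrightarrow> (g has_derivative (\<lambda>h. iota h * f z)) (at z)"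
      using jholo_primitive jholo_subset[OF assms(4) r] by blast
    have g_cont: "continuous_on (ball (\<gamma> x) r) g"
      using g by (meson continuous_at_imp_continuous_on has_derivative_continuous)
    obtain d where "d > 0" and d: "\<And>y. y \<in> {0..1} \<Longrightarrow> dist y x < d \<Longrightarrow> dist (\<gamma> y) (\<gamma> x) < r"
      using cont x \<open>r > 0\<close> unfolding continuous_on_iff by (metis box_real(2))
    have "?f integrable_on {u..v}" if uv: "x \<in> {u..v}" "{u..v} \<subseteq> ball x d" "{u..v} \<subseteq> {0..1}" for u v
    proof -
      have near: "\<gamma> t \<in> ball (\<gamma> x) r" if "t \<in> {u..v}" for t
        using d[of t] uv that by (auto simp: dist_commute subset_iff)
      have "(?f has_integral (g \<circ> \<gamma>) v - (g \<circ> \<gamma>) u) {u..v}"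
      proof (rule fundamental_theorem_of_calculus_interior_strong[OF k(1)])
        show "u \<le> v"
          using uv by simp
        show "continuous_on {u..v} (g \<circ> \<gamma>)"
          using near uv(3) continuous_on_subset[OF cont]
          by (intro continuous_on_compose continuous_on_subset[OF g_cont]) auto
        fix t assume t: "t \<in> {u<..<v} - k"
        moreover have "u \<in> {0..1}" "v \<in> {0..1}"
          using uv(1) subsetD[OF uv(3), of u] subsetD[OF uv(3), of v] by auto
        ultimately have "t \<in> {0..1} - k" "0 < t" "t < 1"
          by auto
        then obtain D where D: "(\<gamma> has_vector_derivative D) (at t)"
          using k(2) unfolding C1_differentiable_on_def by blast
        have "vector_derivative \<gamma> (at t within {0..1}) = D"
          using vector_derivative_at[OF D] \<open>0 < t\<close> \<open>t < 1\<close> by (simp add: at_within_Icc_at)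
        have "(g has_derivative (\<lambda>h. iota h * f (\<gamma> t))) (at (\<gamma> t))"
          using t by (intro g near) auto
        then have "((g \<circ> \<gamma>) has_derivative ((\<lambda>h. iota h * f (\<gamma> t)) \<circ> (\<lambda>x. x *\<^sub>R D))) (at t)"
          using D unfolding has_vector_derivative_def by (intro diff_chain_at)
        moreover have "iota (x *\<^sub>R D) = x *\<^sub>R iota D" for x
          by (simp add: iota_def algebra_simps)
        ultimately show "((g \<circ> \<gamma>) has_vector_derivative ?f t) (at t)"
          unfolding \<open>vector_derivative \<gamma> (at t within {0..1}) = D\<close>
          by (simp add: has_vector_derivative_def o_def)
      qed
      then show ?thesis
        by blast
    qed
    then show ?thesis
      using \<open>d > 0\<close> by (intro exI[of _ d]) auto
  qed
  then have "?f integrable_on cbox 0 1"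
    by (intro integrable_on_little_subintervals) blast
  then show ?thesis
    by simp
qed

lemma cfun_path_int:
  assumes "bounded_linear l" "open S" "valid_path \<gamma>" "path_image \<gamma> \<subseteq> S" "jholo S f"
  shows "cfun l (path_int \<gamma> f) = contour_integral \<gamma> (\<lambda>z. cfun l (f z))"
proof -
  have "((\<lambda>t. iota (vector_derivative \<gamma> (at t within {0..1})) * f (\<gamma> t)) has_integral path_int \<gamma> f) {0..1}"
    unfolding path_int_def by (intro integrable_integral path_integrable[OF assms(2-5)])
  from has_integral_linear[OF this bounded_linear_cfun[OF assms(1)]]
  have "((\<lambda>z. cfun l (f z)) has_contour_integral cfun l (path_int \<gamma> f)) \<gamma>"
    unfolding has_contour_integral_def by (simp only: o_def cfun_iota[OF assms(1)] mult.commute)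
  then show ?thesis
    by (rule contour_integral_unique[symmetric])
qed

definition cycle_int :: "'i set \<Rightarrow> ('i \<Rightarrow> real \<Rightarrow> complex) \<Rightarrow> (complex \<Rightarrow> 'a) \<Rightarrow> 'a" where
  "cycle_int A \<gamma> f = iota (1 / (2 * of_real pi * \<i>)) * (\<Sum>i\<in>A. path_int (\<gamma> i) f)"

lemma cfun_cycle_int:
  assumes "bounded_linear l" "open S" "cycle_in S A \<gamma>" "jholo S f"
  shows "cfun l (cycle_int A \<gamma> f) = 1 / (2 * of_real pi * \<i>) * cycle_integral A \<gamma> (\<lambda>z. cfun l (f z))"
proof -
  interpret cl: bounded_linear "cfun l"
    by (rule bounded_linear_cfun[OF assms(1)])
  have "cfun l (path_int (\<gamma> i) f) = contour_integral (\<gamma> i) (\<lambda>z. cfun l (f z))" if "i \<in> A" for i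
    using assms(3) that by (intro cfun_path_int[OF assms(1,2) _ _ assms(4)]) (auto simp: cycle_in_def)
  then show ?thesis
    by (simp add: cycle_int_def cfun_iota[OF assms(1)] cl.sum cycle_integral_def)
qed

text \<open>The functionals \<open>cfun l\<close> are not multiplicative, but a fixed factor can be
  absorbed into \<open>l\<close>: on the right always, on the left if it commutes with
  \<open>j\<close>.\<close>

lemma cfun_mult_right: "cfun l (x * c) = cfun (\<lambda>y. l (y * c)) x"
  by (simp add: cfun_def mult.assoc)

lemma cfun_mult_left: "c * j = j * c \<Longrightarrow> cfun l (c * x) = cfun (\<lambda>y. l (c * y)) x"
  by (simp add: cfun_def mult.assoc[symmetric])

lemma bounded_linear_mult_functional:
  fixes l :: "'a \<Rightarrow> real"
  assumes "bounded_linear l"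
  shows "bounded_linear (\<lambda>y. l (y * c))" "bounded_linear (\<lambda>y. l (c * y))"
  using bounded_linear_compose[OF assms bounded_linear_mult_left]
    bounded_linear_compose[OF assms bounded_linear_mult_right] by auto

lemma cycle_int_homologous:
  assumes "open S" "cycle_in S A \<gamma>" "cycle_in S C \<delta>" "jholo S f"
    and "\<And>z. z \<notin> S \<Longrightarrow> cycle_winding A \<gamma> z = cycle_winding C \<delta> z"
  shows "cycle_int A \<gamma> f = cycle_int C \<delta> f"
proof (rule cfun_eqI)
  fix l :: "'a \<Rightarrow> real" assume l: "bounded_linear l"
  show "cfun l (cycle_int A \<gamma> f) = cfun l (cycle_int C \<delta> f)"
    using cycle_integral_homologous[OF assms(1-3) cfun_holomorphic[OF l assms(1,4)] assms(5)]
    by (simp add: cfun_cycle_int[OF l assms(1,2,4)] cfun_cycle_int[OF l assms(1,3,4)])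
qed

text \<open>The product of two integrals is read as an iterated integral, with \<open>W r\<close> as
  the inner one, a constant that functionals can absorb. As \<open>u r s\<close> commutes with
  \<open>j\<close>, the scalar \<open>iota (G t)\<close> moves past it, and the sum over
  \<open>r\<close> becomes the kernel \<open>H\<close> of the scalar theorem on iterated
  integrals.\<close>

theorem cycle_int_product:
  assumes \<Omega>: "open \<Omega>" and K: "compact K" and cyc: "cycle_in (\<Omega> - K) A \<gamma>"
    and wn: "\<And>z. z \<in> K \<Longrightarrow> cycle_winding A \<gamma> z = 1" "\<And>z. z \<notin> \<Omega> \<Longrightarrow> cycle_winding A \<gamma> z = 0"
    and F: "F holomorphic_on \<Omega>" and G: "G holomorphic_on \<Omega>"
    and R: "finite R" and u: "\<And>r. r \<in> R \<Longrightarrow> jholo (- K) (u r)" "\<And>r z. r \<in> R \<Longrightarrow> z \<notin> K \<Longrightarrow> u r z * j = j * u r z"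
    and v: "\<And>r. r \<in> R \<Longrightarrow> jholo (- K) (v r)"
    and \<phi>: "jholo (- K) \<phi>" "(\<phi> \<longlongrightarrow> 0) at_infinity"
    and uv: "\<And>s t. s \<notin> K \<Longrightarrow> t \<notin> K \<Longrightarrow> iota (t - s) * (\<Sum>r\<in>R. u r s * v r t) = \<phi> s - \<phi> t"
  shows "(\<Sum>r\<in>R. cycle_int A \<gamma> (\<lambda>z. iota (F z) * u r z) * cycle_int A \<gamma> (\<lambda>z. iota (G z) * v r z)) =
    cycle_int A \<gamma> (\<lambda>z. iota (F z * G z) * \<phi> z)"
proof (rule cfun_eqI)
  fix l :: "'a \<Rightarrow> real" assume l: "bounded_linear l"
  interpret cl: bounded_linear "cfun l"
    by (rule bounded_linear_cfun[OF l])
  let ?c = "1 / (2 * complex_of_real pi * \<i>)"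
  have op: "open (\<Omega> - K)" "open (- K)"
    using \<Omega> K by (auto intro: open_Diff compact_imp_closed)
  have sub: "jholo (\<Omega> - K) f" if "jholo (- K) f" for f
    using that by (rule jholo_subset) auto
  have FG: "jholo (\<Omega> - K) (\<lambda>z. iota (h z) * f z)" if "h holomorphic_on \<Omega>" "jholo (- K) f" for h f
    using that by (intro jholo_mult[OF op(1)] jholo_iota[OF op(1)] sub) (auto intro: holomorphic_on_subset)
  define H where "H s t = cfun l (\<Sum>r\<in>R. u r s * v r t)" for s t
  define W where "W r = cycle_int A \<gamma> (\<lambda>z. iota (G z) * v r z)" for r
  \<comment> \<open>Besides evaluating the inner integral, this shows that it is holomorphic in
    \<open>s\<close>, because the right-hand side is.\<close>
  have uW: "cycle_integral A \<gamma> (\<lambda>t. G t * H s t) = 2 * of_real pi * \<i> * cfun l (\<Sum>r\<in>R. u r s * W r)"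
    if s: "s \<in> \<Omega> - K" for s
  proof -
    have "?c * cycle_integral A \<gamma> (\<lambda>t. cfun l (u r s * (iota (G t) * v r t))) = cfun l (u r s * W r)" if "r \<in> R" for r
      unfolding W_def using s that
      by (simp add: cfun_mult_left u(2) cfun_cycle_int[OF bounded_linear_mult_functional(2)[OF l] op(1) cyc FG[OF G v]])
    then have *: "cycle_integral A \<gamma> (\<lambda>t. cfun l (u r s * (iota (G t) * v r t))) = 2 * of_real pi * \<i> * cfun l (u r s * W r)"
      if "r \<in> R" for r
      using that by (simp add: field_simps)
    have hol: "(\<lambda>t. cfun l (u r s * (iota (G t) * v r t))) holomorphic_on \<Omega> - K" if "r \<in> R" for r
      using s that by (intro cfun_holomorphic[OF l op(1)] jholo_mult[OF op(1) jholo_const] FG G v) (auto simp: u(2))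
    have "cycle_integral A \<gamma> (\<lambda>t. G t * H s t) = cycle_integral A \<gamma> (\<lambda>t. \<Sum>r\<in>R. cfun l (u r s * (iota (G t) * v r t)))"
    proof (rule cycle_integral_cong[OF cyc])
      fix t
      have "G t * cfun l (u r s * v r t) = cfun l (u r s * (iota (G t) * v r t))" if "r \<in> R" for r
      proof -
        have "iota (G t) * (u r s * v r t) = u r s * (iota (G t) * v r t)"
          using s that iota_commute[OF u(2), of r s "G t"] by (simp add: mult.assoc[symmetric])
        then show ?thesis
          by (simp add: cfun_iota[OF l, symmetric])
      qed
      then show "G t * H s t = (\<Sum>r\<in>R. cfun l (u r s * (iota (G t) * v r t)))"
        by (simp add: H_def cl.sum sum_distrib_left)
    qed
    also have "\<dots> = (\<Sum>r\<in>R. cycle_integral A \<gamma> (\<lambda>t. cfun l (u r s * (iota (G t) * v r t))))"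
      by (rule cycle_integral_sum[OF op(1) cyc R hol])
    also have "\<dots> = 2 * of_real pi * \<i> * cfun l (\<Sum>r\<in>R. u r s * W r)"
      by (simp add: * cl.sum sum_distrib_left)
    finally show ?thesis .
  qed
  have jW: "jholo (\<Omega> - K) (\<lambda>s. \<Sum>r\<in>R. u r s * W r)"
    by (intro jholo_sum jholo_mult[OF op(1)] jholo_const sub u) auto
  have "cfun l (\<Sum>r\<in>R. cycle_int A \<gamma> (\<lambda>z. iota (F z) * u r z) * W r) =
      cfun l (cycle_int A \<gamma> (\<lambda>s. iota (F s) * (\<Sum>r\<in>R. u r s * W r)))"
  proof -
    have "cfun l (cycle_int A \<gamma> (\<lambda>z. iota (F z) * u r z) * W r) =
        ?c * cycle_integral A \<gamma> (\<lambda>s. F s * cfun l (u r s * W r))" if "r \<in> R" for r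
      unfolding cfun_mult_right[of l _ "W r"]
      by (subst cfun_cycle_int[OF bounded_linear_mult_functional(1)[OF l] op(1) cyc FG[OF F u(1)[OF that]]])
        (simp add: cfun_iota[OF bounded_linear_mult_functional(1)[OF l]])
    then have "cfun l (\<Sum>r\<in>R. cycle_int A \<gamma> (\<lambda>z. iota (F z) * u r z) * W r) =
        (\<Sum>r\<in>R. ?c * cycle_integral A \<gamma> (\<lambda>s. F s * cfun l (u r s * W r)))"
      by (simp add: cl.sum)
    also have "\<dots> = ?c * cycle_integral A \<gamma> (\<lambda>s. \<Sum>r\<in>R. F s * cfun l (u r s * W r))"
    proof -
      have hol: "(\<lambda>s. F s * cfun l (u r s * W r)) holomorphic_on \<Omega> - K" if "r \<in> R" for r
        using that by (intro holomorphic_on_mult cfun_holomorphic[OF l op(1)] holomorphic_on_subset[OF F]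
            jholo_mult[OF op(1)] jholo_const sub u) auto
      then show ?thesis
        using cycle_integral_sum[OF op(1) cyc R] by (simp add: sum_distrib_left)
    qed
    also have "\<dots> = cfun l (cycle_int A \<gamma> (\<lambda>s. iota (F s) * (\<Sum>r\<in>R. u r s * W r)))"
      unfolding cfun_cycle_int[OF l op(1) cyc jholo_mult[OF op(1) jholo_iota[OF op(1) holomorphic_on_subset[OF F]] jW iota_j, OF Diff_subset]]
      by (simp add: cfun_iota[OF l] cl.sum sum_distrib_left)
    finally show ?thesis .
  qed
  also have "\<dots> = ?c * cycle_integral A \<gamma> (\<lambda>s. F s * (?c * cycle_integral A \<gamma> (\<lambda>t. G t * H s t)))"
    unfolding cfun_cycle_int[OF l op(1) cyc jholo_mult[OF op(1) jholo_iota[OF op(1) holomorphic_on_subset[OF F]] jW iota_j, OF Diff_subset]]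
    by (intro arg_cong2[where f = times] refl cycle_integral_cong[OF cyc]) (simp add: cfun_iota[OF l] uW)
  also have "cycle_integral A \<gamma> (\<lambda>s. F s * (?c * cycle_integral A \<gamma> (\<lambda>t. G t * H s t))) =
      ?c * cycle_integral A \<gamma> (\<lambda>s. F s * cycle_integral A \<gamma> (\<lambda>t. G t * H s t))"
  proof -
    have "(\<lambda>s. F s * (2 * of_real pi * \<i> * cfun l (\<Sum>r\<in>R. u r s * W r))) holomorphic_on \<Omega> - K"
      by (intro holomorphic_intros cfun_holomorphic[OF l op(1) jW] holomorphic_on_subset[OF F]) auto
    then have "(\<lambda>s. F s * cycle_integral A \<gamma> (\<lambda>t. G t * H s t)) holomorphic_on \<Omega> - K"
      by (rule holomorphic_transform) (simp add: uW)
    from cycle_integral_cmult[OF op(1) cyc this, of ?c] show ?thesis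
      by (simp add: mult.left_commute)
  qed
  also have "cycle_integral A \<gamma> (\<lambda>s. F s * cycle_integral A \<gamma> (\<lambda>t. G t * H s t)) =
      2 * of_real pi * \<i> * cycle_integral A \<gamma> (\<lambda>s. F s * G s * cfun l (\<phi> s))"
  proof (rule cycle_double_integral[OF \<Omega> K cyc wn F G])
    show "(\<lambda>z. cfun l (\<phi> z)) holomorphic_on - K"
      by (rule cfun_holomorphic[OF l op(2) \<phi>(1)])
    show "((\<lambda>z. cfun l (\<phi> z)) \<longlongrightarrow> 0) at_infinity"
      using cl.tendsto_zero[OF \<phi>(2)] .
    show "H s holomorphic_on - K" if "s \<notin> K" for s
      unfolding H_def using that
      by (intro cfun_holomorphic[OF l op(2)] jholo_sum jholo_mult[OF op(2) jholo_const] v) (simp_all add: u(2))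
    show "H s t * (t - s) = cfun l (\<phi> s) - cfun l (\<phi> t)" if "s \<notin> K" "t \<notin> K" for s t
      using uv[OF that] by (simp add: H_def cfun_iota[OF l, symmetric] mult.commute cl.diff[symmetric])
    have "(\<lambda>s. 2 * of_real pi * \<i> * cfun l (\<Sum>r\<in>R. u r s * W r)) holomorphic_on \<Omega> - K"
      by (intro holomorphic_intros cfun_holomorphic[OF l op(1) jW])
    then show "(\<lambda>s. cycle_integral A \<gamma> (\<lambda>t. G t * H s t)) holomorphic_on \<Omega> - K"
      by (rule holomorphic_transform) (simp add: uW)
  qed
  also have "?c * (?c * (2 * of_real pi * \<i> * cycle_integral A \<gamma> (\<lambda>s. F s * G s * cfun l (\<phi> s)))) =
      cfun l (cycle_int A \<gamma> (\<lambda>z. iota (F z * G z) * \<phi> z))"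
    by (subst cfun_cycle_int[OF l op(1) cyc FG[OF holomorphic_on_mult[OF F G] \<phi>(1)]]) (simp add: cfun_iota[OF l])
  finally show "cfun l (\<Sum>r\<in>R. cycle_int A \<gamma> (\<lambda>z. iota (F z) * u r z) * cycle_int A \<gamma> (\<lambda>z. iota (G z) * v r z)) =
      cfun l (cycle_int A \<gamma> (\<lambda>z. iota (F z * G z) * \<phi> z))"
    by (simp add: W_def)
qed

end

section \<open>The resolvent of a square root\<close>

locale imaginary_unit_op = imaginary_unit j for j :: "'a::{real_normed_algebra, monoid_mult, banach}" +
  fixes B :: 'a
  assumes jB: "B * j = j * B"
begin

abbreviation K :: "complex set" where
  "K \<equiv> quadratic_spectrum B"

text \<open>The inverse of \<open>z^2 + B\<close> in the form conjugate over norm, as for complex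
  numbers; only an element without imaginary unit has to be inverted.\<close>

definition res :: "complex \<Rightarrow> 'a" where
  "res z = (iota (cnj (z\<^sup>2)) + B) * ring_inv (resolvent_norm B z)"

lemma iota_B: "iota z * B = B * iota z"
  by (rule iota_commute[OF jB])

lemma iota_iota: "iota z * iota w = iota w * iota z"
  by (simp only: iota_mult[symmetric] mult.commute)

lemma resolvent_norm_factor: "(iota (z\<^sup>2) + B) * (iota (cnj (z\<^sup>2)) + B) = resolvent_norm B z"
proof -
  have "(iota (z\<^sup>2) + B) * (iota (cnj (z\<^sup>2)) + B) =
      iota (z\<^sup>2 * cnj (z\<^sup>2)) + iota (z\<^sup>2 + cnj (z\<^sup>2)) * B + B * B"
    by (simp add: distrib_left distrib_right iota_mult iota_add iota_B)
  also have "z\<^sup>2 * cnj (z\<^sup>2) = of_real (norm z ^ 4)"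
    by (simp only: complex_norm_square[symmetric] norm_power power_mult[symmetric]) simp
  also have "z\<^sup>2 + cnj (z\<^sup>2) = of_real (2 * Re (z\<^sup>2))"
    by (rule complex_add_cnj)
  finally show ?thesis
    by (simp only: iota_of_real resolvent_norm_def scaleR_left_distrib mult_scaleR_left mult_1_left)
qed

lemma res_inverse:
  assumes "z \<notin> K"
  shows "inverse_pair (iota (z\<^sup>2) + B) (res z)"
proof -
  have N: "resolvent_norm B z \<in> ring_units"
    using assms by (simp add: quadratic_spectrum_def)
  have "(iota (z\<^sup>2) + B) * B = B * (iota (z\<^sup>2) + B)"
    by (simp add: distrib_left distrib_right iota_B)
  then have c: "(iota (z\<^sup>2) + B) * ring_inv (resolvent_norm B z) = ring_inv (resolvent_norm B z) * (iota (z\<^sup>2) + B)"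
    using N by (intro ring_inv_commute resolvent_norm_commute)
  have "(iota (z\<^sup>2) + B) * res z = resolvent_norm B z * ring_inv (resolvent_norm B z)"
    by (simp only: res_def mult.assoc[symmetric] resolvent_norm_factor)
  moreover have "res z * (iota (z\<^sup>2) + B) = resolvent_norm B (cnj z) * ring_inv (resolvent_norm B z)"
    unfolding resolvent_norm_factor[symmetric, of "cnj z"] res_def
    by (simp add: mult.assoc c flip: complex_cnj_power)
  ultimately show ?thesis
    using N by (simp add: inverse_pair_def)
qed

lemma res_mult [simp]:
  "z \<notin> K \<Longrightarrow> (iota (z\<^sup>2) + B) * res z = 1" "z \<notin> K \<Longrightarrow> res z * (iota (z\<^sup>2) + B) = 1"
  using res_inverse by (auto simp: inverse_pair_def)

lemma res_eq_ring_inv: "z \<notin> K \<Longrightarrow> ring_inv (iota (z\<^sup>2) + B) = res z"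
  by (rule ring_inv_eq[OF res_inverse])

lemma res_commute:
  assumes "z \<notin> K" "c * B = B * c" "c * j = j * c"
  shows "c * res z = res z * c"
proof -
  have "c * (iota (z\<^sup>2) + B) = (iota (z\<^sup>2) + B) * c"
    using assms by (simp add: distrib_left distrib_right iota_commute)
  then show ?thesis
    using ring_inv_commute[of "iota (z\<^sup>2) + B" c] res_inverse[OF assms(1)]
    by (auto simp: res_eq_ring_inv[OF assms(1)] ring_units_def)
qed

lemma res_j: "z \<notin> K \<Longrightarrow> res z * j = j * res z"
  by (metis res_commute jB)

lemma res_power_j: "z \<notin> K \<Longrightarrow> res z ^ n * j = j * res z ^ n"
  by (rule power_commuting_commutes[OF res_j])

lemma iota_res: "z \<notin> K \<Longrightarrow> iota w * res z = res z * iota w"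
  by (rule iota_commute[OF res_j])

lemma iota_res_power: "z \<notin> K \<Longrightarrow> iota w * res z ^ n = res z ^ n * iota w"
  by (rule iota_commute[OF res_power_j])

text \<open>Inserting each factor together with its inverse into the other resolvent makes
  \<open>B\<close> cancel from the difference.\<close>

lemma res_diff:
  assumes "s \<notin> K" "t \<notin> K"
  shows "res s - res t = iota (t\<^sup>2 - s\<^sup>2) * (res s * res t)"
proof -
  have "res s - res t = res s * ((iota (t\<^sup>2) + B) * res t) - (res s * (iota (s\<^sup>2) + B)) * res t"
    using assms by simp
  also have "\<dots> = res s * iota (t\<^sup>2 - s\<^sup>2) * res t"
    by (simp add: mult.assoc[symmetric] iota_diff distrib_left distrib_right right_diff_distrib left_diff_distrib)
  finally show ?thesis
    using iota_res[OF assms(1)] by (simp add: mult.assoc[symmetric])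
qed

lemma open_K: "open (- K)"
  using closed_quadratic_spectrum by (simp add: open_closed)

lemma continuous_on_res: "continuous_on (- K) res"
proof -
  have "continuous_on (- K) (\<lambda>z. ring_inv (resolvent_norm B z))"
    by (rule continuous_on_compose2[OF continuous_on_ring_inv continuous_resolvent_norm])
      (auto simp: quadratic_spectrum_def)
  then show ?thesis
    unfolding res_def
    by (intro continuous_intros linear_continuous_on_compose[OF _ bounded_linear_iota[THEN bounded_linear.linear]]
        bounded_linear.continuous_on[OF bounded_linear_iota])
qed

text \<open>The resolvent equation supplies the difference quotient
  \<open>- (w + z) res w res z\<close>, whose limit is \<open>- 2 z (res z)^2\<close>. Continuity of
  inversion is the only analytic input.\<close>

lemma jholo_res: "jholo (- K) res"
  unfolding jholo_def
proof
  fix z assume z: "z \<in> - K"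
  have "(res has_derivative (\<lambda>h. iota h * (- iota (z + z) * (res z * res z)))) (at z)"
  proof (rule has_iota_derivativeI[OF open_K z])
    show "res w - res z = iota (w - z) * (- iota (w + z) * (res w * res z))" if "w \<in> - K" for w
    proof -
      have "z\<^sup>2 - w\<^sup>2 = - ((w - z) * (w + z))"
        by (simp add: power2_eq_square algebra_simps)
      then have "iota (z\<^sup>2 - w\<^sup>2) = - (iota (w - z) * iota (w + z))"
        using iota_diff[of 0] by (simp add: iota_mult)
      then show ?thesis
        using res_diff[of w z] that z by (simp add: mult.assoc)
    qed
    have "isCont res z"
      using continuous_on_res z open_K by (simp add: continuous_on_eq_continuous_at)
    then show "((\<lambda>w. - iota (w + z) * (res w * res z)) \<longlongrightarrow> - iota (z + z) * (res z * res z)) (at z)"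
      by (intro tendsto_intros bounded_linear.tendsto[OF bounded_linear_iota]) (simp_all add: isCont_def)
  qed simp
  then show "\<exists>D. (res has_derivative (\<lambda>h. iota h * D)) (at z)"
    by blast
qed

lemma jholo_res_power: "jholo (- K) (\<lambda>z. res z ^ n)"
  by (rule jholo_power[OF open_K jholo_res]) (simp add: res_j)

text \<open>The estimate is self-referential: \<open>z^2 res z = 1 - B res z\<close> bounds
  \<open>res z\<close> by itself, and for \<open>norm z ^ 2 \<ge> 2 * C * norm B\<close> the term
  with \<open>B\<close> is absorbed into the left-hand side. The resulting quadratic decay leaves
  room for the factor \<open>iota z\<close>.\<close>

lemma
  assumes "bounded K"
  shows res_tendsto_0: "(res \<longlongrightarrow> 0) at_infinity"
    and iota_res_tendsto_0: "((\<lambda>z. iota z * res z) \<longlongrightarrow> 0) at_infinity"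
proof -
  define C where "C = norm (1::'a) + norm j"
  define d where "d = norm (1::'a) + 1"
  have "C \<ge> 0" "d > 0"
    by (auto simp: C_def d_def add_nonneg_pos)
  obtain b where b: "K \<subseteq> ball 0 b"
    using assms by (meson bounded_subset_ballD)
  have bound: "norm (res z) \<le> 2 * C * d / norm z ^ 2"
    if z: "b \<le> norm z" "2 * C * norm B \<le> norm z ^ 2" "0 < norm z" for z
  proof -
    have "z \<notin> K"
      using b z by auto
    then have "iota (z\<^sup>2) * res z = 1 - B * res z"
      using res_mult(1)[of z] by (simp add: distrib_right eq_diff_eq)
    moreover have "iota (1 / z\<^sup>2) * (iota (z\<^sup>2) * res z) = res z"
      using z by (simp add: mult.assoc[symmetric] iota_mult[symmetric])
    ultimately have "res z = iota (1 / z\<^sup>2) * (1 - B * res z)"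
      by simp
    then have "norm (res z) \<le> norm (iota (1 / z\<^sup>2)) * norm (1 - B * res z)"
      by (metis norm_mult_ineq)
    also have "\<dots> \<le> (C * norm (1 / z\<^sup>2)) * (d + norm B * norm (res z))"
    proof (intro mult_mono)
      show "norm (iota (1 / z\<^sup>2)) \<le> C * norm (1 / z\<^sup>2)"
        unfolding C_def by (rule norm_iota)
      have "norm (1 - B * res z) \<le> norm (1::'a) + norm (B * res z)"
        by (rule norm_triangle_ineq4)
      also have "\<dots> \<le> d + norm B * norm (res z)"
        unfolding d_def by (intro add_mono norm_mult_ineq) auto
      finally show "norm (1 - B * res z) \<le> d + norm B * norm (res z)" .
    qed (use \<open>C \<ge> 0\<close> in auto)
    finally have "norm (res z) * norm z ^ 2 \<le> C * (d + norm B * norm (res z))"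
      using z by (simp add: norm_divide norm_power field_simps)
    moreover have "2 * C * norm B * norm (res z) \<le> norm z ^ 2 * norm (res z)"
      using z by (intro mult_right_mono) auto
    ultimately have "norm (res z) * norm z ^ 2 \<le> 2 * C * d"
      by (simp add: algebra_simps)
    then show ?thesis
      using z by (simp add: field_simps)
  qed
  have "filterlim (norm :: complex \<Rightarrow> real) at_top at_infinity"
    by (rule filterlim_norm_at_top)
  then have large: "eventually (\<lambda>z::complex. R \<le> norm z) at_infinity" for R
    by (simp add: filterlim_at_top)
  have "eventually (\<lambda>z::complex. b \<le> norm z \<and> 2 * C * norm B \<le> norm z ^ 2 \<and> 0 < norm z) at_infinity"
    using large[of "max b (max 1 (2 * C * norm B))"]
  proof eventually_elim
    case (elim z)
    then have "1 * (2 * C * norm B) \<le> norm z * norm z"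
      using \<open>C \<ge> 0\<close> by (intro mult_mono) auto
    with elim show ?case
      by (auto simp: power2_eq_square)
  qed
  note ev = this
  have inv0: "((\<lambda>z::complex. inverse (norm z)) \<longlongrightarrow> 0) at_infinity"
    by (rule tendsto_inverse_0_at_top[OF filterlim_norm_at_top])
  show "(res \<longlongrightarrow> 0) at_infinity"
  proof (rule Lim_null_comparison)
    show "eventually (\<lambda>z. norm (res z) \<le> 2 * C * d * (inverse (norm z) * inverse (norm z))) at_infinity"
      using ev by eventually_elim (use bound in \<open>auto simp: power2_eq_square divide_inverse\<close>)
    have "((\<lambda>z::complex. 2 * C * d * (inverse (norm z) * inverse (norm z))) \<longlongrightarrow> 2 * C * d * (0 * 0)) at_infinity"
      by (intro tendsto_intros inv0)
    then show "((\<lambda>z::complex. 2 * C * d * (inverse (norm z) * inverse (norm z))) \<longlongrightarrow> 0) at_infinity"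
      by simp
  qed
  show "((\<lambda>z. iota z * res z) \<longlongrightarrow> 0) at_infinity"
  proof (rule Lim_null_comparison)
    show "eventually (\<lambda>z. norm (iota z * res z) \<le> C * (2 * C * d) * inverse (norm z)) at_infinity"
      using ev
    proof eventually_elim
      case (elim z)
      have "norm (iota z * res z) \<le> norm (iota z) * norm (res z)"
        by (rule norm_mult_ineq)
      also have "\<dots> \<le> (C * norm z) * (2 * C * d / norm z ^ 2)"
        using elim \<open>C \<ge> 0\<close> norm_iota[of z] by (intro mult_mono bound) (auto simp: C_def)
      also have "\<dots> = C * (2 * C * d) * inverse (norm z)"
        using elim by (simp add: power2_eq_square field_simps)
      finally show ?case .
    qed
    have "((\<lambda>z::complex. C * (2 * C * d) * inverse (norm z)) \<longlongrightarrow> C * (2 * C * d) * 0) at_infinity"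
      by (intro tendsto_intros inv0)
    then show "((\<lambda>z::complex. C * (2 * C * d) * inverse (norm z)) \<longlongrightarrow> 0) at_infinity"
      by simp
  qed
qed

lemma res_power_tendsto_0:
  assumes "bounded K"
  shows "((\<lambda>z. res z ^ Suc n) \<longlongrightarrow> 0) at_infinity"
    and "((\<lambda>z. iota z * res z ^ Suc n) \<longlongrightarrow> 0) at_infinity"
  using tendsto_mult[OF res_tendsto_0[OF assms] tendsto_power[OF res_tendsto_0[OF assms], of n]]
    tendsto_mult[OF iota_res_tendsto_0[OF assms] tendsto_power[OF res_tendsto_0[OF assms], of n]]
  by (simp_all add: mult.assoc)

text \<open>By the resolvent equation each summand times \<open>t^2 - s^2\<close> is the difference
  of two consecutive products \<open>res s ^ k * res t ^ (n - k)\<close>.\<close>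

lemma res_telescope:
  assumes "s \<notin> K" "t \<notin> K"
  shows "iota (t\<^sup>2 - s\<^sup>2) * (\<Sum>k<n. res s ^ Suc k * res t ^ (n - k)) = res s ^ n - res t ^ n"
proof -
  have "iota (t\<^sup>2 - s\<^sup>2) * (res s ^ Suc k * res t ^ (n - k)) =
      res s ^ Suc k * res t ^ (n - Suc k) - res s ^ k * res t ^ (n - k)" if "k < n" for k
  proof -
    have n: "n - k = Suc (n - Suc k)"
      using that by simp
    have "iota (t\<^sup>2 - s\<^sup>2) * (res s ^ Suc k * res t ^ (n - k)) =
        (iota (t\<^sup>2 - s\<^sup>2) * res s ^ k) * (res s * res t) * res t ^ (n - Suc k)"
      unfolding n by (simp add: mult.assoc power_Suc2 del: power_Suc) (simp add: power_commutes)
    also have "\<dots> = res s ^ k * (iota (t\<^sup>2 - s\<^sup>2) * (res s * res t)) * res t ^ (n - Suc k)"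
      using iota_res_power[OF assms(1)] by (simp add: mult.assoc)
    also have "\<dots> = res s ^ k * (res s - res t) * res t ^ (n - Suc k)"
      by (simp add: res_diff[OF assms])
    also have "\<dots> = res s ^ Suc k * res t ^ (n - Suc k) - res s ^ k * res t ^ (n - k)"
      unfolding n by (simp add: right_diff_distrib left_diff_distrib mult.assoc power_commutes)
    finally show ?thesis .
  qed
  then have "iota (t\<^sup>2 - s\<^sup>2) * (\<Sum>k<n. res s ^ Suc k * res t ^ (n - k)) =
      (\<Sum>k<n. res s ^ Suc k * res t ^ (n - Suc k) - res s ^ k * res t ^ (n - k))"
    by (simp add: sum_distrib_left)
  also have "\<dots> = res s ^ n * res t ^ (n - n) - res s ^ 0 * res t ^ (n - 0)"
    by (rule sum_lessThan_telescope)
  finally show ?thesis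
    by simp
qed

end

section \<open>Integrals of resolvent powers around the spectrum\<close>

definition surrounds :: "complex set \<Rightarrow> complex set \<Rightarrow> 'i set \<Rightarrow> ('i \<Rightarrow> real \<Rightarrow> complex) \<Rightarrow> bool" where
  "surrounds \<Omega> K A \<gamma> \<longleftrightarrow> open \<Omega> \<and> compact K \<and> K \<subseteq> \<Omega> \<and> cycle_in (\<Omega> - K) A \<gamma> \<and>
     (\<forall>z\<in>K. cycle_winding A \<gamma> z = 1) \<and> (\<forall>z. z \<notin> \<Omega> \<longrightarrow> cycle_winding A \<gamma> z = 0)"

context imaginary_unit
begin

lemma cycle_int_mult_left:
  assumes "open S" "cycle_in S A \<gamma>" "jholo S f" "c * j = j * c"
  shows "cycle_int A \<gamma> (\<lambda>z. c * f z) = c * cycle_int A \<gamma> f"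
proof -
  have "path_int (\<gamma> i) (\<lambda>z. c * f z) = c * path_int (\<gamma> i) f" if "i \<in> A" for i
  proof -
    have "valid_path (\<gamma> i)" "path_image (\<gamma> i) \<subseteq> S"
      using assms(2) that by (auto simp: cycle_in_def)
    from integral_linear[OF path_integrable[OF assms(1) this assms(3)] bounded_linear_mult_right[of c]]
    have "c * path_int (\<gamma> i) f =
        integral {0..1} (\<lambda>t. c * (iota (vector_derivative (\<gamma> i) (at t within {0..1})) * f (\<gamma> i t)))"
      by (simp add: path_int_def o_def)
    also have "\<dots> = path_int (\<gamma> i) (\<lambda>z. c * f z)"
      unfolding path_int_def using iota_commute[OF assms(4)] by (simp only: mult.assoc[symmetric])
    finally show ?thesis ..
  qed
  then have "(\<Sum>i\<in>A. path_int (\<gamma> i) (\<lambda>z. c * f z)) = c * (\<Sum>i\<in>A. path_int (\<gamma> i) f)"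
    by (simp add: sum_distrib_left)
  then show ?thesis
    using iota_commute[OF assms(4)] by (simp add: cycle_int_def mult.assoc[symmetric])
qed

end

text \<open>Real and imaginary part of the \<open>m\<close>-th power of the resolvent, as a pair
  computed without an imaginary unit. Off the spectrum both commute with everything that commutes
  with \<open>B\<close>; this includes \<open>T\<close>, which need not commute with
  \<open>j\<close>.\<close>

primrec res_parts :: "'a::{real_normed_algebra, monoid_mult, banach} \<Rightarrow> complex \<Rightarrow> nat \<Rightarrow> 'a \<times> 'a" where
  "res_parts B z 0 = (1, 0)"
| "res_parts B z (Suc m) =
    (let M = ring_inv (resolvent_norm B z);
         P = (Re (z\<^sup>2) *\<^sub>R 1 + B) * M; Q = - Im (z\<^sup>2) *\<^sub>R M
     in (P * fst (res_parts B z m) - Q * snd (res_parts B z m),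
         P * snd (res_parts B z m) + Q * fst (res_parts B z m)))"

lemma commute_mult: "c * x = x * c \<Longrightarrow> c * y = y * c \<Longrightarrow> c * (x * y) = x * y * (c::'a::{ring, monoid_mult})"
  by (metis mult.assoc)

lemma res_parts_commute:
  assumes "c * B = B * c" "z \<notin> quadratic_spectrum B"
  shows "c * fst (res_parts B z m) = fst (res_parts B z m) * c \<and>
    c * snd (res_parts B z m) = snd (res_parts B z m) * c"
proof (induction m)
  case (Suc m)
  let ?M = "ring_inv (resolvent_norm B z)"
  have M: "c * ?M = ?M * c"
    using assms by (intro ring_inv_commute resolvent_norm_commute) (auto simp: quadratic_spectrum_def)
  have P: "c * ((Re (z\<^sup>2) *\<^sub>R 1 + B) * ?M) = (Re (z\<^sup>2) *\<^sub>R 1 + B) * ?M * c"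
    using M assms(1) by (intro commute_mult) (simp_all add: distrib_left distrib_right)
  have Q: "c * (- Im (z\<^sup>2) *\<^sub>R ?M) = (- Im (z\<^sup>2) *\<^sub>R ?M) * c"
    using M by simp
  show ?case
    using commute_mult[OF P] commute_mult[OF Q] Suc
    by (simp add: Let_def distrib_left distrib_right right_diff_distrib left_diff_distrib)
qed simp

text \<open>The mean over \<open>j\<close> and \<open>- j\<close> of the normalized integrand: the
  part in which no imaginary unit occurs.\<close>

definition real_integrand :: "'a::{real_normed_algebra, monoid_mult, banach} \<Rightarrow> nat \<Rightarrow> (complex \<Rightarrow> complex) \<Rightarrow>
    (real \<Rightarrow> complex) \<Rightarrow> real \<Rightarrow> 'a" where
  "real_integrand B m F \<gamma> t =
     (let w = 1 / (2 * of_real pi * \<i>) * (vector_derivative \<gamma> (at t within {0..1}) * F (\<gamma> t))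
      in Re w *\<^sub>R fst (res_parts B (\<gamma> t) m) - Im w *\<^sub>R snd (res_parts B (\<gamma> t) m))"

definition real_cycle_int :: "'a::{real_normed_algebra, monoid_mult, banach} \<Rightarrow> nat \<Rightarrow> 'i set \<Rightarrow>
    ('i \<Rightarrow> real \<Rightarrow> complex) \<Rightarrow> (complex \<Rightarrow> complex) \<Rightarrow> 'a" where
  "real_cycle_int B m A \<gamma> F = (\<Sum>i\<in>A. integral {0..1} (real_integrand B m F (\<gamma> i)))"

context imaginary_unit_op
begin

lemma neg: "imaginary_unit_op (- j) B"
  by unfold_locales (simp_all add: jj jB)

lemma neg_iota: "imaginary_unit.iota (- j) z = iota (cnj z)"
proof -
  interpret neg: imaginary_unit_op "- j" B
    by (rule neg)
  show ?thesis
    by (simp add: neg.iota_def iota_def)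
qed

lemma neg_res: "imaginary_unit_op.res (- j) B z = res (cnj z)"
proof -
  interpret neg: imaginary_unit_op "- j" B
    by (rule neg)
  show ?thesis
    by (simp add: neg.res_def res_def neg_iota flip: complex_cnj_power)
qed

definition power_int :: "nat \<Rightarrow> 'i set \<Rightarrow> ('i \<Rightarrow> real \<Rightarrow> complex) \<Rightarrow> (complex \<Rightarrow> complex) \<Rightarrow> 'a" where
  "power_int m A \<gamma> F = cycle_int A \<gamma> (\<lambda>z. iota (F z) * res z ^ m)"

lemma jholo_power_int:
  assumes "open S" "S \<inter> K = {}" "F holomorphic_on S"
  shows "jholo S (\<lambda>z. iota (F z) * res z ^ m)"
  using assms by (intro jholo_mult jholo_iota jholo_subset[OF jholo_res_power]) auto

lemma surroundsD:
  assumes "surrounds \<Omega> K A \<gamma>"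
  shows "open \<Omega>" "compact K" "K \<subseteq> \<Omega>" "cycle_in (\<Omega> - K) A \<gamma>" "open (\<Omega> - K)" "bounded K"
    "\<And>z. z \<in> K \<Longrightarrow> cycle_winding A \<gamma> z = 1" "\<And>z. z \<notin> \<Omega> \<Longrightarrow> cycle_winding A \<gamma> z = 0"
  using assms unfolding surrounds_def by (auto intro: open_Diff compact_imp_closed compact_imp_bounded)

lemma power_int_homologous:
  assumes "surrounds \<Omega> K A \<gamma>" "surrounds \<Omega> K C \<delta>" "F holomorphic_on \<Omega>"
  shows "power_int m A \<gamma> F = power_int m C \<delta> F"
  unfolding power_int_def
proof (rule cycle_int_homologous[OF surroundsD(5)[OF assms(1)] surroundsD(4)[OF assms(1)] surroundsD(4)[OF assms(2)]])
  show "jholo (\<Omega> - K) (\<lambda>z. iota (F z) * res z ^ m)"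
    using surroundsD(5)[OF assms(1)] assms(3)
    by (intro jholo_power_int) (auto intro: holomorphic_on_subset)
  show "cycle_winding A \<gamma> z = cycle_winding C \<delta> z" if "z \<notin> \<Omega> - K" for z
    using that surroundsD(7,8)[OF assms(1)] surroundsD(7,8)[OF assms(2)] by auto
qed

lemma cycle_int_times_ident:
  "cycle_int A \<gamma> (\<lambda>z. iota (F z) * (iota z * res z ^ m)) = power_int m A \<gamma> (\<lambda>z. z * F z)"
  by (simp only: power_int_def iota_mult iota_iota mult.assoc[symmetric])

text \<open>The coefficient of \<open>T\<close> in the product formula. The Boolean index tells
  whether a term of the factor \<open>s + t\<close> goes to the left or to the right integral.
  Multiplication by \<open>t - s\<close> produces \<open>t^2 - s^2\<close>, to which the telescoping
  identity applies. The case \<open>n = 0\<close> is excluded because \<open>res z ^ n\<close> has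
  to vanish at infinity.\<close>

lemma power_int_product_mixed:
  assumes sur: "surrounds \<Omega> K A \<gamma>" and F: "F holomorphic_on \<Omega>" and G: "G holomorphic_on \<Omega>" and "n > 0"
  shows "(\<Sum>k<n. power_int (Suc k) A \<gamma> (\<lambda>z. z * F z) * power_int (n - k) A \<gamma> G
      + power_int (Suc k) A \<gamma> F * power_int (n - k) A \<gamma> (\<lambda>z. z * G z)) =
    power_int n A \<gamma> (\<lambda>z. F z * G z)"
proof -
  define u where "u r s = (if snd r then iota s else 1) * res s ^ Suc (fst r)" for r :: "nat \<times> bool" and s
  define v where "v r t = (if snd r then 1 else iota t) * res t ^ (n - fst r)" for r :: "nat \<times> bool" and t
  have iota: "jholo (- K) iota"
    using jholo_iota[OF open_K holomorphic_on_ident] by simp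
  have sum_R: "(\<Sum>r\<in>{..<n} \<times> UNIV. h r) = (\<Sum>k<n. h (k, True) + h (k, False))" for h :: "nat \<times> bool \<Rightarrow> 'a"
    by (simp add: sum.cartesian_product' UNIV_bool add.commute)
  have "(\<Sum>r\<in>{..<n} \<times> UNIV. cycle_int A \<gamma> (\<lambda>z. iota (F z) * u r z) * cycle_int A \<gamma> (\<lambda>z. iota (G z) * v r z)) =
    cycle_int A \<gamma> (\<lambda>z. iota (F z * G z) * res z ^ n)"
  proof (rule cycle_int_product[OF surroundsD(1,2,4,7,8)[OF sur] F G])
    show "finite ({..<n} \<times> (UNIV :: bool set))"
      by simp
    show "jholo (- K) (u r)" "jholo (- K) (v r)" for r
      unfolding u_def v_def
      by (cases "snd r"; simp del: power_Suc; intro jholo_mult open_K iota jholo_res_power iota_j)+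
    show "u r z * j = j * u r z" if "z \<notin> K" for r z
      unfolding u_def using res_power_j[OF that, of "Suc (fst r)"] iota_j[of z]
      by (cases "snd r"; simp del: power_Suc iota_j) (metis mult.assoc)
    show "jholo (- K) (\<lambda>z. res z ^ n)"
      by (rule jholo_res_power)
    show "((\<lambda>z. res z ^ n) \<longlongrightarrow> 0) at_infinity"
      using res_power_tendsto_0(1)[OF surroundsD(6)[OF sur], of "n - 1"] \<open>n > 0\<close> by simp
    fix s t assume s: "s \<notin> K" and t: "t \<notin> K"
    have "u (k, True) s * v (k, True) t + u (k, False) s * v (k, False) t =
        iota (s + t) * (res s ^ Suc k * res t ^ (n - k))" for k
    proof -
      have "res s ^ Suc k * (iota t * res t ^ (n - k)) = iota t * (res s ^ Suc k * res t ^ (n - k))"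
        using iota_res_power[OF s, of t "Suc k"] by (simp only: mult.assoc[symmetric])
      then show ?thesis
        by (simp add: u_def v_def iota_add distrib_right mult.assoc del: power_Suc)
    qed
    then have "iota (t - s) * (\<Sum>r\<in>{..<n} \<times> UNIV. u r s * v r t) =
        iota (t - s) * (iota (s + t) * (\<Sum>k<n. res s ^ Suc k * res t ^ (n - k)))"
      unfolding sum_R by (simp add: sum_distrib_left)
    also have "\<dots> = iota (t\<^sup>2 - s\<^sup>2) * (\<Sum>k<n. res s ^ Suc k * res t ^ (n - k))"
    proof -
      have "(t - s) * (s + t) = t\<^sup>2 - s\<^sup>2"
        by (simp add: power2_eq_square algebra_simps)
      then show ?thesis
        by (simp only: mult.assoc[symmetric] iota_mult[symmetric])
    qed
    also have "\<dots> = res s ^ n - res t ^ n"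
      by (rule res_telescope[OF s t])
    finally show "iota (t - s) * (\<Sum>r\<in>{..<n} \<times> UNIV. u r s * v r t) = res s ^ n - res t ^ n" .
  qed
  then show ?thesis
    by (simp only: sum_R u_def v_def fst_conv snd_conv if_True if_False mult_1_left
        cycle_int_times_ident power_int_def[symmetric])
qed

text \<open>The part of the product formula without \<open>T\<close>: in
  \<open>(s + T) (t + T)\<close> it consists of \<open>s t\<close> and \<open>T^2 = - B\<close>, and
  the family with second index \<open>2\<close> is the sum of lower order. Rewriting
  \<open>B res s ^ (k + 1)\<close> as \<open>res s ^ k - s^2 res s ^ (k + 1)\<close> turns the first
  two families into multiples of \<open>s (s + t)\<close> minus a shifted sum, which cancels the
  third family up to one power of \<open>res t\<close>.\<close>

lemma power_int_product_scalar:
  assumes sur: "surrounds \<Omega> K A \<gamma>" and F: "F holomorphic_on \<Omega>" and G: "G holomorphic_on \<Omega>"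
  shows "(\<Sum>k<Suc n. power_int (Suc k) A \<gamma> (\<lambda>z. z * F z) * power_int (Suc n - k) A \<gamma> (\<lambda>z. z * G z)
      - B * power_int (Suc k) A \<gamma> F * power_int (Suc n - k) A \<gamma> G)
      + (\<Sum>k<n. power_int (Suc k) A \<gamma> F * power_int (n - k) A \<gamma> G) =
    power_int (Suc n) A \<gamma> (\<lambda>z. z * (F z * G z))"
proof -
  define u where "u r s = (if snd r = 0 then iota s else if snd r = 1 then - B else 1) * res s ^ Suc (fst r)"
    for r :: "nat \<times> nat" and s
  define v where "v r t = (if snd r = 0 then iota t else 1) * res t ^ ((if snd r = 2 then n else Suc n) - fst r)"
    for r :: "nat \<times> nat" and t
  define R :: "(nat \<times> nat) set" where "R = {..<Suc n} \<times> {0, 1} \<union> {..<n} \<times> {2}"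
  have iota: "jholo (- K) iota"
    using jholo_iota[OF open_K holomorphic_on_ident] by simp
  have sum_R: "(\<Sum>r\<in>R. h r) = (\<Sum>k<Suc n. h (k, 0) + h (k, 1)) + (\<Sum>k<n. h (k, 2))" for h :: "nat \<times> nat \<Rightarrow> 'a"
    unfolding R_def by (subst sum.union_disjoint) (auto simp: sum.cartesian_product')
  have "(\<Sum>r\<in>R. cycle_int A \<gamma> (\<lambda>z. iota (F z) * u r z) * cycle_int A \<gamma> (\<lambda>z. iota (G z) * v r z)) =
    cycle_int A \<gamma> (\<lambda>z. iota (F z * G z) * (iota z * res z ^ Suc n))"
  proof (rule cycle_int_product[OF surroundsD(1,2,4,7,8)[OF sur] F G])
    show "finite R"
      by (simp add: R_def)
    have 0: "jholo (- K) (\<lambda>s. iota s * res s ^ m)" for m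
      by (intro jholo_mult open_K iota jholo_res_power iota_j)
    have 1: "jholo (- K) (\<lambda>s. - B * res s ^ m)" for m
      by (rule jholo_mult[OF open_K jholo_const jholo_res_power]) (simp add: jB)
    show "jholo (- K) (u r)" for r
      unfolding u_def using 0 1 jholo_res_power
      by (cases "snd r = 0"; cases "snd r = 1"; simp del: power_Suc mult_minus_left)
    show "jholo (- K) (v r)" for r
      unfolding v_def using 0 jholo_res_power by (cases "snd r = 0"; simp)
    show "u r z * j = j * u r z" if "z \<notin> K" for r z
    proof -
      have "x * res z ^ Suc (fst r) * j = j * (x * res z ^ Suc (fst r))" if "x * j = j * x" for x
        using res_power_j[OF \<open>z \<notin> K\<close>, of "Suc (fst r)"] that by (metis mult.assoc)
      then show ?thesis
        unfolding u_def by (simp add: jB del: power_Suc)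
    qed
    show "jholo (- K) (\<lambda>z. iota z * res z ^ Suc n)"
      by (intro jholo_mult open_K iota jholo_res_power iota_j)
    show "((\<lambda>z. iota z * res z ^ Suc n) \<longlongrightarrow> 0) at_infinity"
      by (rule res_power_tendsto_0(2)[OF surroundsD(6)[OF sur]])
    fix s t assume s: "s \<notin> K" and t: "t \<notin> K"
    let ?S = "\<Sum>k<Suc n. res s ^ Suc k * res t ^ (Suc n - k)"
    have "u (k, 0) s * v (k, 0) t + u (k, 1) s * v (k, 1) t =
        iota (s * (s + t)) * (res s ^ Suc k * res t ^ (Suc n - k)) - res s ^ k * res t ^ (Suc n - k)" for k
    proof -
      have "res s ^ Suc k * (iota t * res t ^ (Suc n - k)) = iota t * (res s ^ Suc k * res t ^ (Suc n - k))"
        using iota_res_power[OF s, of t "Suc k"] by (simp only: mult.assoc[symmetric])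
      moreover have "B * res s ^ Suc k = res s ^ k - iota (s\<^sup>2) * res s ^ Suc k"
      proof -
        have "(iota (s\<^sup>2) + B) * res s ^ Suc k = res s ^ k"
          using s by (simp add: mult.assoc[symmetric])
        then show ?thesis
          by (simp only: distrib_right eq_diff_eq add.commute)
      qed
      ultimately show ?thesis
        by (simp add: u_def v_def mult.assoc iota_mult iota_add distrib_left distrib_right power2_eq_square
            right_diff_distrib left_diff_distrib del: power_Suc)
    qed
    then have "(\<Sum>r\<in>R. u r s * v r t) = iota (s * (s + t)) * ?S
        - (\<Sum>k<Suc n. res s ^ k * res t ^ (Suc n - k)) + (\<Sum>k<n. res s ^ Suc k * res t ^ (n - k))"
      unfolding sum_R by (simp only: sum_subtractf sum_distrib_left) (simp add: u_def v_def)
    \<comment> \<open>The term \<open>k = 0\<close> is split off; the rest is exactly the third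
      family.\<close>
    also have "(\<Sum>k<Suc n. res s ^ k * res t ^ (Suc n - k)) =
        res t ^ Suc n + (\<Sum>k<n. res s ^ Suc k * res t ^ (n - k))"
      by (subst sum.lessThan_Suc_shift) simp
    finally have "iota (t - s) * (\<Sum>r\<in>R. u r s * v r t) =
        iota (t - s) * (iota (s * (s + t)) * ?S) - iota (t - s) * res t ^ Suc n"
      by (simp add: right_diff_distrib del: power_Suc)
    also have "iota (t - s) * (iota (s * (s + t)) * ?S) = iota s * (iota (t\<^sup>2 - s\<^sup>2) * ?S)"
    proof -
      have "(t - s) * (s * (s + t)) = s * (t\<^sup>2 - s\<^sup>2)"
        by (simp add: power2_eq_square algebra_simps)
      then show ?thesis
        by (simp only: mult.assoc[symmetric] iota_mult[symmetric])
    qed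
    also have "iota (t\<^sup>2 - s\<^sup>2) * ?S = res s ^ Suc n - res t ^ Suc n"
      by (rule res_telescope[OF s t])
    \<comment> \<open>This is \<open>s (p - q) - (t - s) q = s p - t q\<close> for the powers
      \<open>p\<close> and \<open>q\<close> of the two resolvents.\<close>
    finally show "iota (t - s) * (\<Sum>r\<in>R. u r s * v r t) = iota s * res s ^ Suc n - iota t * res t ^ Suc n"
      by (simp add: iota_diff right_diff_distrib left_diff_distrib del: power_Suc)
  qed
  moreover have "cycle_int A \<gamma> (\<lambda>z. iota (F z) * (- B * res z ^ Suc k)) = - B * power_int (Suc k) A \<gamma> F" for k
  proof -
    have "cycle_int A \<gamma> (\<lambda>z. - B * (iota (F z) * res z ^ Suc k)) = - B * power_int (Suc k) A \<gamma> F"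
      unfolding power_int_def using surroundsD(5)[OF sur]
      by (intro cycle_int_mult_left[OF surroundsD(5,4)[OF sur] jholo_power_int])
        (auto simp: jB intro: holomorphic_on_subset[OF F])
    moreover have "iota (F z) * (- B * x) = - B * (iota (F z) * x)" for z x
      using iota_B[of "F z"] by (simp add: mult.assoc[symmetric])
    ultimately show ?thesis
      by simp
  qed
  moreover have "(0::nat) \<noteq> 1" "(0::nat) \<noteq> 2" "(1::nat) \<noteq> 0" "(1::nat) \<noteq> 2" "(2::nat) \<noteq> 0" "(2::nat) \<noteq> 1"
    by auto
  ultimately show ?thesis
    by (simp only: sum_R u_def v_def fst_conv snd_conv if_True if_False refl mult_1_left
        cycle_int_times_ident power_int_def[symmetric] mult_minus_left diff_conv_add_uminus)
qed

end

section \<open>Independence of the imaginary unit\<close>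

context imaginary_unit_op
begin

text \<open>Pairs multiply like complex numbers because all the coefficients commute with
  \<open>j\<close>.\<close>

lemma res_power_parts:
  assumes z: "z \<notin> K"
  shows "res z ^ m = fst (res_parts B z m) + snd (res_parts B z m) * j"
proof (induction m)
  case (Suc m)
  define M where "M = ring_inv (resolvent_norm B z)"
  define P where "P = (Re (z\<^sup>2) *\<^sub>R 1 + B) * M"
  define Q where "Q = - Im (z\<^sup>2) *\<^sub>R M"
  define X where "X = fst (res_parts B z m)"
  define Y where "Y = snd (res_parts B z m)"
  have jM: "j * M = M * j"
    unfolding M_def using z jB
    by (intro ring_inv_commute resolvent_norm_commute) (auto simp: quadratic_spectrum_def)
  have jX: "j * X = X * j" and jY: "j * Y = Y * j"
    using res_parts_commute[of j B z m] z jB by (auto simp: X_def Y_def)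
  have "res z = P + Q * j"
    unfolding res_def P_def Q_def M_def[symmetric]
    by (simp add: iota_def distrib_right left_diff_distrib jM flip: complex_cnj_power)
  then have "res z ^ Suc m = (P + Q * j) * (X + Y * j)"
    using Suc by (simp add: X_def Y_def)
  also have "\<dots> = P * X + Q * Y * (j * j) + (P * Y + Q * X) * j"
    by (simp add: distrib_left distrib_right mult.assoc jX jY) (simp only: mult.assoc[symmetric] jX jY)
  also have "\<dots> = (P * X - Q * Y) + (P * Y + Q * X) * j"
    by (simp add: jj)
  finally show ?case
    by (simp add: Let_def P_def Q_def M_def X_def Y_def)
qed simp

text \<open>Replacing \<open>j\<close> by \<open>- j\<close> conjugates all scalars, which amounts
  to integrating over the conjugate contour. That contour, once reversed, is homologous to the
  original one, and the sign from the reversal cancels the sign of the conjugated factor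
  \<open>1 / (2 \<pi> \<i>)\<close>.\<close>

lemma power_int_neg:
  assumes sur: "surrounds \<Omega> K A \<gamma>" and \<Omega>: "\<And>z. z \<in> \<Omega> \<Longrightarrow> cnj z \<in> \<Omega>"
    and F: "F holomorphic_on \<Omega>" "\<And>z. z \<in> \<Omega> \<Longrightarrow> F (cnj z) = cnj (F z)"
  shows "imaginary_unit_op.power_int (- j) B m A \<gamma> F = power_int m A \<gamma> F"
proof -
  interpret neg: imaginary_unit_op "- j" B
    by (rule neg)
  note S = surroundsD[OF sur]
  define f where "f z = iota (F z) * res z ^ m" for z
  have f: "jholo (\<Omega> - K) f"
    unfolding f_def by (intro jholo_power_int S(5) holomorphic_on_subset[OF F(1)]) auto
  have conj_path: "neg.path_int (\<gamma> i) (\<lambda>z. neg.iota (F z) * neg.res z ^ m) = path_int (cnj \<circ> \<gamma> i) f"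
    if i: "i \<in> A" for i
  proof -
    have "valid_path (\<gamma> i)" and im: "path_image (\<gamma> i) \<subseteq> \<Omega> - K"
      using S(4) i by (auto simp: cycle_in_def)
    then obtain k where k: "finite k" "\<gamma> i C1_differentiable_on {0..1} - k"
      unfolding valid_path_def piecewise_C1_differentiable_on_def by blast
    show ?thesis
      unfolding path_int_def neg.path_int_def
    proof (rule integral_spike)
      \<comment> \<open>The end points are removed as well, since the derivative within the interval
        is one-sided there.\<close>
      show "negligible (insert 0 (insert 1 k))"
        using k(1) by (intro negligible_finite) simp
      fix t :: real assume t: "t \<in> {0..1} - insert 0 (insert 1 k)"
      then have "\<gamma> i differentiable at t"
        using k(2) by (auto simp: C1_differentiable_on_eq)
      then have "vector_derivative (cnj \<circ> \<gamma> i) (at t) = cnj (vector_derivative (\<gamma> i) (at t))"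
        by (simp add: o_def vector_derivative_cnj)
      moreover have "F (cnj (\<gamma> i t)) = cnj (F (\<gamma> i t))"
        using im t by (intro F) (auto simp: path_image_def image_subset_iff)
      ultimately show "iota (vector_derivative (cnj \<circ> \<gamma> i) (at t within {0..1})) * f ((cnj \<circ> \<gamma> i) t) =
          neg.iota (vector_derivative (\<gamma> i) (at t within {0..1})) * (neg.iota (F (\<gamma> i t)) * neg.res (\<gamma> i t) ^ m)"
        using t by (simp add: at_within_Icc_at f_def neg_iota neg_res)
    qed
  qed
  define \<delta> where "\<delta> i = cnj \<circ> \<gamma> i" for i
  have cyc: "cycle_in (\<Omega> - K) A \<delta>"
    unfolding \<delta>_def using S(4) \<Omega>
    by (auto simp: cycle_in_def valid_path_cnj pathstart_compose pathfinish_compose path_image_compose; blast)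
  have cyc': "cycle_in (\<Omega> - K) A (\<lambda>i. reversepath (\<delta> i))"
    using cyc by (auto simp: cycle_in_def)
  have "cycle_int A \<gamma> f + cycle_int A \<delta> f = 0"
  proof (rule cfun_eq_0)
    fix l :: "'a \<Rightarrow> real" assume l: "bounded_linear l"
    interpret cl: bounded_linear "cfun l"
      by (rule bounded_linear_cfun[OF l])
    have "cycle_integral A \<gamma> (\<lambda>z. cfun l (f z)) = cycle_integral A (\<lambda>i. reversepath (\<delta> i)) (\<lambda>z. cfun l (f z))"
    proof (rule cycle_integral_homologous[OF S(5,4) cyc' cfun_holomorphic[OF l S(5) f]])
      fix z assume z: "z \<notin> \<Omega> - K"
      then have z': "cnj z \<notin> \<Omega> - K"
        using \<Omega>[of "cnj z"] by auto
      have "winding_number (reversepath (\<delta> i)) z = cnj (winding_number (\<gamma> i) (cnj z))" if "i \<in> A" for i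
      proof -
        have "path (\<gamma> i)" "cnj z \<notin> path_image (\<gamma> i)" "path (\<delta> i)" "z \<notin> path_image (\<delta> i)"
          using cycle_in_image[OF S(4) that] cycle_in_image[OF cyc that] S(4) cyc that z z'
          by (auto simp: cycle_in_def intro: valid_path_imp_path simp del: cnj_quadratic_spectrum)
        then show ?thesis
          using winding_number_reversepath[of "\<delta> i" z] winding_number_cnj[of "\<gamma> i" "cnj z"]
          by (simp add: \<delta>_def)
      qed
      then have "cycle_winding A (\<lambda>i. reversepath (\<delta> i)) z = cnj (cycle_winding A \<gamma> (cnj z))"
        by (simp add: cycle_winding_def)
      also have "\<dots> = cycle_winding A \<gamma> z"
      proof (cases "z \<in> K")
        case True
        then show ?thesis
          using S(7)[of z] S(7)[of "cnj z"] by simp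
      next
        case False
        then have "z \<notin> \<Omega>" "cnj z \<notin> \<Omega>"
          using z z' by auto
        then show ?thesis
          using S(8) by simp
      qed
      finally show "cycle_winding A \<gamma> z = cycle_winding A (\<lambda>i. reversepath (\<delta> i)) z" ..
    qed
    also have "\<dots> = - cycle_integral A \<delta> (\<lambda>z. cfun l (f z))"
      unfolding cycle_integral_def sum_negf[symmetric] using cyc
      by (intro sum.cong contour_integral_reversepath) (auto simp: cycle_in_def)
    finally show "cfun l (cycle_int A \<gamma> f + cycle_int A \<delta> f) = 0"
      by (simp add: cl.add cfun_cycle_int[OF l S(5,4) f] cfun_cycle_int[OF l S(5) cyc f])
  qed
  moreover have "neg.power_int m A \<gamma> F = - cycle_int A \<delta> f"
  proof -
    have "neg.iota (1 / (2 * of_real pi * \<i>)) = - iota (1 / (2 * of_real pi * \<i>))"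
      using iota_diff[of 0 "1 / (2 * of_real pi * \<i>)"] by (simp add: neg_iota)
    then show ?thesis
      by (simp add: neg.power_int_def neg.cycle_int_def cycle_int_def conj_path \<delta>_def)
  qed
  ultimately show ?thesis
    by (simp add: power_int_def f_def[symmetric] add_eq_0_iff2)
qed

definition power_integrand :: "nat \<Rightarrow> (complex \<Rightarrow> complex) \<Rightarrow> (real \<Rightarrow> complex) \<Rightarrow> real \<Rightarrow> 'a" where
  "power_integrand m F \<gamma> t = iota (1 / (2 * of_real pi * \<i>)) *
     (iota (vector_derivative \<gamma> (at t within {0..1})) * (iota (F (\<gamma> t)) * res (\<gamma> t) ^ m))"

lemma has_integral_power_integrand:
  assumes "surrounds \<Omega> K A \<gamma>" "F holomorphic_on \<Omega>" "i \<in> A"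
  shows "(power_integrand m F (\<gamma> i) has_integral
    iota (1 / (2 * of_real pi * \<i>)) * path_int (\<gamma> i) (\<lambda>z. iota (F z) * res z ^ m)) {0..1}"
proof -
  note S = surroundsD[OF assms(1)]
  have paths: "valid_path (\<gamma> i)" "path_image (\<gamma> i) \<subseteq> \<Omega> - K"
    using S(4) assms(3) by (auto simp: cycle_in_def)
  have "jholo (\<Omega> - K) (\<lambda>z. iota (F z) * res z ^ m)"
    by (intro jholo_power_int S(5) holomorphic_on_subset[OF assms(2)]) auto
  from has_integral_linear[OF integrable_integral[OF path_integrable[OF S(5) paths this]]
      bounded_linear_mult_right[of "iota (1 / (2 * of_real pi * \<i>))"]]
  show ?thesis
    by (simp only: o_def path_int_def power_integrand_def[abs_def])
qed

lemma power_integrand_integrable: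
  assumes "surrounds \<Omega> K A \<gamma>" "F holomorphic_on \<Omega>" "i \<in> A"
  shows "power_integrand m F (\<gamma> i) integrable_on {0..1}"
  using has_integral_power_integrand[OF assms] by blast

lemma power_int_eq_sum:
  assumes "surrounds \<Omega> K A \<gamma>" "F holomorphic_on \<Omega>"
  shows "power_int m A \<gamma> F = (\<Sum>i\<in>A. integral {0..1} (power_integrand m F (\<gamma> i)))"
  unfolding power_int_def cycle_int_def sum_distrib_left
  by (intro sum.cong refl integral_unique[symmetric] has_integral_power_integrand[OF assms])

text \<open>In the mean over \<open>j\<close> and \<open>- j\<close> the terms with a single factor
  \<open>j\<close> cancel.\<close>

lemma real_integrand_eq:
  assumes "\<gamma> t \<notin> K"
  shows "(1 / 2) *\<^sub>R (power_integrand m F \<gamma> t + imaginary_unit_op.power_integrand (- j) B m F \<gamma> t) =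
    real_integrand B m F \<gamma> t"
proof -
  interpret neg: imaginary_unit_op "- j" B
    by (rule neg)
  define w where "w = 1 / (2 * of_real pi * \<i>) * (vector_derivative \<gamma> (at t within {0..1}) * F (\<gamma> t))"
  define X where "X = fst (res_parts B (\<gamma> t) m)"
  define Y where "Y = snd (res_parts B (\<gamma> t) m)"
  have jX: "j * X = X * j" and jY: "j * Y = Y * j"
    using res_parts_commute[of j B "\<gamma> t" m] assms jB by (auto simp: X_def Y_def)
  have jY': "j * (Y * j) = - Y"
    by (simp add: mult.assoc[symmetric] jY) (simp add: mult.assoc jj)
  have 1: "power_integrand m F \<gamma> t = iota w * (X + Y * j)"
    unfolding power_integrand_def w_def X_def Y_def res_power_parts[OF assms] by (simp only: iota_mult mult.assoc)
  have 2: "neg.power_integrand m F \<gamma> t = neg.iota w * (X - Y * j)"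
    unfolding neg.power_integrand_def w_def X_def Y_def neg.res_power_parts[OF assms]
    by (simp only: neg.iota_mult mult.assoc mult_minus_right diff_conv_add_uminus)
  have "iota w * (X + Y * j) + neg.iota w * (X - Y * j) =
      (Re w *\<^sub>R X - Im w *\<^sub>R Y) + (Re w *\<^sub>R X - Im w *\<^sub>R Y)"
    by (simp add: iota_def neg.iota_def distrib_left distrib_right right_diff_distrib left_diff_distrib
        jY' jX jY scaleR_add_right scaleR_diff_right)
  then show ?thesis
    unfolding 1 2 real_integrand_def Let_def w_def[symmetric] X_def[symmetric] Y_def[symmetric]
    by (simp only: scaleR_half_double)
qed

lemma has_integral_real_integrand:
  assumes sur: "surrounds \<Omega> K A \<gamma>" and F: "F holomorphic_on \<Omega>" and i: "i \<in> A"
  shows "(real_integrand B m F (\<gamma> i) has_integral (1 / 2) *\<^sub>R (integral {0..1} (power_integrand m F (\<gamma> i)) +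
    integral {0..1} (imaginary_unit_op.power_integrand (- j) B m F (\<gamma> i)))) {0..1}"
proof -
  interpret neg: imaginary_unit_op "- j" B
    by (rule neg)
  have notK: "\<gamma> i t \<notin> K" if "t \<in> {0..1}" for t
    using surroundsD(4)[OF sur] i that by (auto simp: cycle_in_def path_image_def image_subset_iff)
  have "((\<lambda>t. (1 / 2) *\<^sub>R (power_integrand m F (\<gamma> i) t + neg.power_integrand m F (\<gamma> i) t)) has_integral
      (1 / 2) *\<^sub>R (integral {0..1} (power_integrand m F (\<gamma> i)) + integral {0..1} (neg.power_integrand m F (\<gamma> i)))) {0..1}"
    by (intro has_integral_cmul has_integral_add integrable_integral power_integrand_integrable[OF sur F i]
        neg.power_integrand_integrable[OF sur F i])
  then show ?thesis
    by (rule has_integral_eq[rotated]) (rule real_integrand_eq[where \<gamma> = "\<gamma> i", OF notK])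
qed

text \<open>Both \<open>j\<close> and \<open>- j\<close> give the same integral, so it equals the
  mean of the two, in which no imaginary unit is left.\<close>

lemma power_int_real:
  assumes sur: "surrounds \<Omega> K A \<gamma>" and \<Omega>: "\<And>z. z \<in> \<Omega> \<Longrightarrow> cnj z \<in> \<Omega>"
    and F: "F holomorphic_on \<Omega>" "\<And>z. z \<in> \<Omega> \<Longrightarrow> F (cnj z) = cnj (F z)"
  shows "power_int m A \<gamma> F = real_cycle_int B m A \<gamma> F"
proof -
  interpret neg: imaginary_unit_op "- j" B
    by (rule neg)
  have "real_cycle_int B m A \<gamma> F = (1 / 2) *\<^sub>R (power_int m A \<gamma> F + neg.power_int m A \<gamma> F)"
    unfolding power_int_eq_sum[OF sur F(1)] neg.power_int_eq_sum[OF sur F(1)] real_cycle_int_def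
      sum.distrib[symmetric] scaleR_sum_right
    by (intro sum.cong refl integral_unique has_integral_real_integrand[OF sur F(1)])
  also have "\<dots> = power_int m A \<gamma> F"
    using power_int_neg[OF sur \<Omega> F, of m] by (simp only: scaleR_half_double)
  finally show ?thesis ..
qed

text \<open>Meant for \<open>c = T\<close>, which commutes with \<open>B\<close> but in general not
  with \<open>j\<close>: in the form without imaginary unit it passes under the integral
  sign.\<close>

lemma real_cycle_int_commute:
  assumes sur: "surrounds \<Omega> K A \<gamma>" and F: "F holomorphic_on \<Omega>" and c: "c * B = B * c"
  shows "c * real_cycle_int B m A \<gamma> F = real_cycle_int B m A \<gamma> F * c"
proof -
  have "c * integral {0..1} (real_integrand B m F (\<gamma> i)) = integral {0..1} (real_integrand B m F (\<gamma> i)) * c"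
    if i: "i \<in> A" for i
  proof -
    have notK: "\<gamma> i t \<notin> K" if "t \<in> {0..1}" for t
      using surroundsD(4)[OF sur] i that by (auto simp: cycle_in_def path_image_def image_subset_iff)
    have int: "real_integrand B m F (\<gamma> i) integrable_on {0..1}"
      using has_integral_real_integrand[OF sur F i] by blast
    have "c * integral {0..1} (real_integrand B m F (\<gamma> i)) = integral {0..1} (\<lambda>t. c * real_integrand B m F (\<gamma> i) t)"
      using integral_linear[OF int bounded_linear_mult_right[of c]] by (simp only: o_def)
    also have "\<dots> = integral {0..1} (\<lambda>t. real_integrand B m F (\<gamma> i) t * c)"
      using res_parts_commute[OF c notK, of _ m] unfolding real_integrand_def
      by (intro integral_cong) (simp only: Let_def right_diff_distrib left_diff_distrib mult_scaleR_right mult_scaleR_left)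
    also have "\<dots> = integral {0..1} (real_integrand B m F (\<gamma> i)) * c"
      using integral_linear[OF int bounded_linear_mult_left[of c]] by (simp only: o_def)
    finally show ?thesis .
  qed
  then show ?thesis
    by (simp add: real_cycle_int_def sum_distrib_left sum_distrib_right)
qed

end

section \<open>The Clifford ring of operators\<close>

lemma cl_prod_blinfun_add:
  "(x + x') \<otimes> y = x \<otimes> y + x' \<otimes> y" "x \<otimes> (y + y') = x \<otimes> y + x \<otimes> y'"
  by (simp_all add: cl_prod_add_left cl_prod_add_right bounded_bilinear_blinfun_compose)

lemma cl_prod_blinfun_scaleR:
  "(r *\<^sub>R x) \<otimes> y = r *\<^sub>R (x \<otimes> y)" "x \<otimes> (r *\<^sub>R y) = r *\<^sub>R (x \<otimes> y)"
  by (simp_all add: cl_prod_scaleR_left cl_prod_scaleR_right bounded_bilinear_blinfun_compose)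

text \<open>The sum norm is submultiplicative because the product of two basis elements is, up to
  sign, again a basis element. The Euclidean norm of the vector type is in general submultiplicative
  only up to a constant.\<close>

definition l1_norm :: "'a::real_normed_vector ^ 'k::finite \<Rightarrow> real" where
  "l1_norm x = (\<Sum>k\<in>UNIV. norm (x $ k))"

lemma l1_norm_sum: "l1_norm (\<Sum>i\<in>S. f i) \<le> (\<Sum>i\<in>S. l1_norm (f i))"
proof -
  have "l1_norm (\<Sum>i\<in>S. f i) \<le> (\<Sum>k\<in>UNIV. \<Sum>i\<in>S. norm (f i $ k))"
    unfolding l1_norm_def by (intro sum_mono) (simp add: norm_sum)
  then show ?thesis
    unfolding l1_norm_def by (subst sum.swap)
qed

lemma l1_norm_axis [simp]: "l1_norm (axis k a) = norm a"
proof -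
  have "norm ((axis k a :: 'a ^ 'b) $ i) = (if i = k then norm a else 0)" for i
    by (simp add: axis_def)
  then show ?thesis
    by (simp add: l1_norm_def)
qed

lemma l1_norm_op_times:
  fixes x y :: "('v::real_normed_vector, 'n::{finite,linorder}) cl_op"
  shows "l1_norm (x \<otimes> y) \<le> l1_norm x * l1_norm y"
proof -
  have "l1_norm (x \<otimes> y) \<le> (\<Sum>A\<in>UNIV. l1_norm (\<Sum>B\<in>UNIV. axis (sym_diff A B) (cl_sign A B *\<^sub>R (x $ A o\<^sub>L y $ B))))"
    unfolding cl_prod_def by (rule l1_norm_sum)
  also have "\<dots> \<le> (\<Sum>A\<in>UNIV. \<Sum>B\<in>UNIV. l1_norm (axis (sym_diff A B) (cl_sign A B *\<^sub>R (x $ A o\<^sub>L y $ B))))"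
    by (intro sum_mono l1_norm_sum)
  also have "\<dots> \<le> (\<Sum>A\<in>UNIV. \<Sum>B\<in>UNIV. norm (x $ A) * norm (y $ B))"
    by (intro sum_mono) (simp add: cl_sign_def norm_blinfun_compose)
  also have "\<dots> = l1_norm x * l1_norm y"
    unfolding l1_norm_def by (simp add: sum_product)
  finally show ?thesis .
qed

text \<open>The ring \<open>B(V_n)\<close> with the submultiplicative norm \<open>\<Sum>A. norm (x $ A)\<close>; \<open>zero_neq_one\<close> may fail, since
  \<open>V\<close> may be trivial.\<close>

typedef (overloaded) ('v, 'n) clifford_op = "UNIV :: ('v::real_normed_vector, 'n::{finite,linorder}) cl_op set"
  morphisms op_vec Op ..

declare op_vec_inverse [simp]

lemma op_vec_Op [simp]: "op_vec (Op x) = x"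
  by (simp add: Op_inverse)

lemma Op_eq_iff: "Op x = Op y \<longleftrightarrow> x = y"
  by (metis op_vec_Op)

instantiation clifford_op :: (real_normed_vector, "{finite,linorder}") real_normed_vector
begin

definition "0 = Op 0"
definition "x + y = Op (op_vec x + op_vec y)"
definition "x - y = Op (op_vec x - op_vec y)"
definition "- x = Op (- op_vec x)"
definition "r *\<^sub>R x = Op (r *\<^sub>R op_vec x)"
definition "norm x = l1_norm (op_vec x)"
definition "dist x y = norm (x - y :: ('a, 'b) clifford_op)"
definition "sgn x = inverse (norm x) *\<^sub>R (x :: ('a, 'b) clifford_op)"
definition "uniformity = (INF e\<in>{0<..}. principal {(x :: ('a, 'b) clifford_op, y). dist x y < e})"
definition "open (U :: ('a, 'b) clifford_op set) \<longleftrightarrow>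
  (\<forall>x\<in>U. eventually (\<lambda>(x', y). x' = x \<longrightarrow> y \<in> U) uniformity)"

instance
proof
  fix x y z :: "('a, 'b) clifford_op" and r s :: real
  note defs = plus_clifford_op_def minus_clifford_op_def uminus_clifford_op_def zero_clifford_op_def
    scaleR_clifford_op_def
  show "x + y + z = x + (y + z)" "x + y = y + x" "0 + x = x" "- x + x = 0" "x - y = x + - y"
    "r *\<^sub>R (x + y) = r *\<^sub>R x + r *\<^sub>R y" "(r + s) *\<^sub>R x = r *\<^sub>R x + s *\<^sub>R x"
    "r *\<^sub>R s *\<^sub>R x = (r * s) *\<^sub>R x" "1 *\<^sub>R x = x"
    by (simp_all add: defs ac_simps scaleR_add_right scaleR_add_left)
  show "dist x y = norm (x - y)"
    by (simp only: dist_clifford_op_def)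
  show "sgn x = inverse (norm x) *\<^sub>R x"
    by (simp only: sgn_clifford_op_def)
  show "uniformity = (INF e\<in>{0<..}. principal {(x :: ('a, 'b) clifford_op, y). dist x y < e})"
    by (simp only: uniformity_clifford_op_def)
  show "open U \<longleftrightarrow> (\<forall>x\<in>U. eventually (\<lambda>(x', y). x' = x \<longrightarrow> y \<in> U) uniformity)"
    for U :: "('a, 'b) clifford_op set"
    by (simp only: open_clifford_op_def)
  show "(norm x = 0) = (x = 0)"
    by (cases x) (simp add: norm_clifford_op_def l1_norm_def defs sum_nonneg_eq_0_iff vec_eq_iff Op_eq_iff)
  show "norm (x + y) \<le> norm x + norm y"
    by (simp add: norm_clifford_op_def l1_norm_def defs sum.distrib[symmetric] sum_mono norm_triangle_ineq)
  show "norm (r *\<^sub>R x) = \<bar>r\<bar> * norm x"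
    by (simp add: norm_clifford_op_def l1_norm_def defs sum_distrib_left)
qed

end

instantiation clifford_op :: (real_normed_vector, "{finite,linorder}") "{real_normed_algebra, monoid_mult}"
begin

definition "1 = Op op_one"
definition "x * y = Op (op_vec x \<otimes> op_vec y)"

instance
proof
  fix x y z :: "('a, 'b) clifford_op" and r :: real
  note defs = plus_clifford_op_def scaleR_clifford_op_def times_clifford_op_def one_clifford_op_def
  show "x * y * z = x * (y * z)" "(x + y) * z = x * z + y * z" "x * (y + z) = x * y + x * z"
    "r *\<^sub>R x * y = r *\<^sub>R (x * y)" "x * r *\<^sub>R y = r *\<^sub>R (x * y)" "1 * x = x" "x * 1 = x"
    by (simp_all add: defs op_times_assoc cl_prod_blinfun_add cl_prod_blinfun_scaleR op_times_one)
  show "norm (x * y) \<le> norm x * norm y"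
    by (simp add: norm_clifford_op_def times_clifford_op_def l1_norm_op_times)
qed

end

lemma Op_simps:
  "Op (x + y) = Op x + Op y" "Op (x - y) = Op x - Op y" "Op (- x) = - Op x" "Op (r *\<^sub>R x) = r *\<^sub>R Op x"
  "Op (x \<otimes> y) = Op x * Op y" "Op 0 = 0" "Op op_one = 1"
  by (simp_all add: plus_clifford_op_def minus_clifford_op_def uminus_clifford_op_def
      scaleR_clifford_op_def times_clifford_op_def zero_clifford_op_def one_clifford_op_def)

lemma Op_sum: "Op (\<Sum>i\<in>S. f i) = (\<Sum>i\<in>S. Op (f i))"
  by (induction S rule: infinite_finite_induct) (simp_all add: Op_simps)

text \<open>Continuity of this map carries integrals from the new type back to the vectors in terms
  of which \<open>slice_integral\<close> is defined.\<close>

lemma bounded_linear_op_vec: "bounded_linear op_vec"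
proof (rule bounded_linear_intro[where K = 1])
  show "norm (op_vec x) \<le> norm x * 1" for x :: "('a, 'b) clifford_op"
    unfolding norm_clifford_op_def l1_norm_def norm_vec_def by (simp add: L2_set_le_sum)
qed (simp_all add: plus_clifford_op_def scaleR_clifford_op_def)

instance clifford_op :: (banach, "{finite,linorder}") banach
proof
  fix X :: "nat \<Rightarrow> ('a, 'b) clifford_op"
  assume X: "Cauchy X"
  have "convergent (\<lambda>k. op_vec (X k) $ A)" for A
  proof (intro Cauchy_convergent bounded_linear.Cauchy[OF _ X])
    show "bounded_linear (\<lambda>x :: ('a, 'b) clifford_op. op_vec x $ A)"
      by (rule bounded_linear_compose[OF bounded_linear_vec_nth bounded_linear_op_vec])
  qed
  then have "\<forall>A. \<exists>l. (\<lambda>k. op_vec (X k) $ A) \<longlonglongrightarrow> l"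
    by (simp add: convergent_def)
  from choice[OF this] obtain L where L: "\<And>A. (\<lambda>k. op_vec (X k) $ A) \<longlonglongrightarrow> L A"
    by blast
  have "(\<lambda>k. norm (op_vec (X k) $ A - L A)) \<longlonglongrightarrow> 0" for A
    using L[of A] by (simp add: LIM_zero tendsto_norm_zero)
  then have "(\<lambda>k. \<Sum>A\<in>UNIV. norm (op_vec (X k) $ A - L A)) \<longlonglongrightarrow> 0"
    by (intro tendsto_null_sum)
  moreover have "norm (X k - Op (\<chi> A. L A)) = (\<Sum>A\<in>UNIV. norm (op_vec (X k) $ A - L A))" for k
    by (simp add: norm_clifford_op_def l1_norm_def minus_clifford_op_def)
  ultimately have "(\<lambda>k. X k - Op (\<chi> A. L A)) \<longlonglongrightarrow> 0"
    by (subst tendsto_norm_zero_iff[symmetric]) (simp only:)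
  then show "convergent X"
    using LIM_zero_cancel convergentI by blast
qed

lemma Op_power: "Op (op_power x k) = Op x ^ k"
  by (induction k) (simp_all add: op_power_def Op_simps)

lemma op_invertible_iff: "op_invertible x \<longleftrightarrow> Op x \<in> ring_units"
proof
  assume "op_invertible x"
  then obtain y where "x \<otimes> y = op_one" "y \<otimes> x = op_one"
    by (auto simp: op_invertible_def)
  then have "inverse_pair (Op x) (Op y)"
    by (simp add: inverse_pair_def Op_simps[symmetric])
  then show "Op x \<in> ring_units"
    by (auto simp: ring_units_def)
next
  assume "Op x \<in> ring_units"
  then obtain y where "inverse_pair (Op x) y"
    by (auto simp: ring_units_def)
  then have "inverse_pair (Op x) (Op (op_vec y))"
    by simp
  then show "op_invertible x"
    unfolding inverse_pair_def op_invertible_def by (metis Op_eq_iff Op_simps(5,7))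
qed

lemma Op_op_inv:
  assumes "inverse_pair (Op x) y"
  shows "Op (op_inv x) = y"
proof -
  have y: "x \<otimes> op_vec y = op_one \<and> op_vec y \<otimes> x = op_one"
    using assms unfolding inverse_pair_def by (metis Op_eq_iff Op_simps(5,7) op_vec_inverse)
  have "op_inv x = op_vec y"
    unfolding op_inv_def
  proof (rule the_equality[where P = "\<lambda>S. x \<otimes> S = op_one \<and> S \<otimes> x = op_one", OF y])
    fix S assume "x \<otimes> S = op_one \<and> S \<otimes> x = op_one"
    then have "inverse_pair (Op x) (Op S)"
      by (simp add: inverse_pair_def Op_simps[symmetric])
    then show "S = op_vec y"
      using inverse_pair_unique[OF assms] by (metis op_vec_Op)
  qed
  then show ?thesis
    by simp
qed

definition emb :: "real ^ ('n set) \<Rightarrow> ('v::real_normed_vector, 'n::{finite,linorder}) clifford_op" where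
  "emb a = Op (cl_emb a)"

lemma cl_emb_add: "cl_emb (a + b) = cl_emb a + cl_emb b"
  and cl_emb_scaleR: "cl_emb (r *\<^sub>R a) = r *\<^sub>R cl_emb a"
  and cl_emb_axis: "cl_emb (axis A r) = axis A (r *\<^sub>R id_blinfun)"
  by (simp_all add: cl_emb_def vec_eq_iff axis_def scaleR_add_left)

lemma emb_add: "emb (a + b) = emb a + emb b"
  and emb_scaleR: "emb (r *\<^sub>R a) = r *\<^sub>R emb a"
  by (simp_all add: emb_def cl_emb_add cl_emb_scaleR Op_simps)

lemma emb_sum: "emb (\<Sum>i\<in>S. f i) = (\<Sum>i\<in>S. emb (f i))"
proof (induction S rule: infinite_finite_induct)
  case empty
  show ?case
    using emb_scaleR[of 0 0] by simp
next
  case (infinite S)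
  then show ?case
    using emb_scaleR[of 0 0] by simp
qed (simp add: emb_add)

lemma id_blinfun_compose: "id_blinfun o\<^sub>L x = x" "x o\<^sub>L id_blinfun = x"
  by (auto intro: blinfun_eqI)

lemma op_times_axis:
  "axis A S \<otimes> axis C R = axis (sym_diff A C) (cl_sign A C *\<^sub>R (S o\<^sub>L R))"
  by (rule cl_prod_axis) (simp_all add: bounded_bilinear.zero_left bounded_bilinear.zero_right
      bounded_bilinear_blinfun_compose)

lemma cl_times_axis: "axis A a \<odot> axis C b = axis (sym_diff A C) (cl_sign A C * (a * b))"
  by (subst cl_prod_axis) simp_all

lemma emb_mult: "emb (a \<odot> b) = emb a * (emb b :: ('v::real_normed_vector, 'n::{finite,linorder}) clifford_op)"
proof -
  have ax: "emb (axis A r \<odot> axis C s) = emb (axis A r) * (emb (axis C s) :: ('v, 'n) clifford_op)" for A C r s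
    by (simp add: emb_def cl_emb_axis cl_times_axis op_times_axis Op_simps[symmetric] id_blinfun_compose
        bounded_bilinear.scaleR_left[OF bounded_bilinear_blinfun_compose]
        bounded_bilinear.scaleR_right[OF bounded_bilinear_blinfun_compose] Op_eq_iff mult.commute)
  note b = bounded_bilinear_mult
  have "a \<odot> b = (\<Sum>A\<in>UNIV. \<Sum>C\<in>UNIV. axis A (a $ A) \<odot> axis C (b $ C))"
    by (subst vec_eq_sum_axis[of a], subst vec_eq_sum_axis[of b])
      (simp only: cl_prod_sum_left[OF b] cl_prod_sum_right[OF b], rule sum.swap)
  then have "emb (a \<odot> b) = (\<Sum>A\<in>UNIV. \<Sum>C\<in>UNIV. emb (axis A (a $ A)) * (emb (axis C (b $ C)) :: ('v, 'n) clifford_op))"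
    by (simp only: emb_sum ax)
  also have "\<dots> = emb (\<Sum>A\<in>UNIV. axis A (a $ A)) * emb (\<Sum>C\<in>UNIV. axis C (b $ C))"
    by (simp only: emb_sum sum_product)
  finally show ?thesis
    by (simp only: vec_eq_sum_axis[symmetric])
qed

lemma emb_axis_empty: "emb (axis {} r) = r *\<^sub>R (1 :: ('v::real_normed_vector, 'n::{finite,linorder}) clifford_op)"
proof -
  have "axis {} (r *\<^sub>R id_blinfun) = r *\<^sub>R (op_one :: ('v, 'n) cl_op)"
    by (simp add: op_one_def axis_def vec_eq_iff)
  then show ?thesis
    by (simp add: emb_def cl_emb_axis Op_simps)
qed

text \<open>An operator on \<open>V\<close> acts on the coefficients and a real Clifford number on
  the basis elements, so the two do not interfere.\<close>

lemma emb_commute_scalar: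
  fixes a :: "real ^ ('n::{finite,linorder} set)"
  shows "emb a * Op (axis {} S) = Op (axis {} S) * emb a"
proof -
  have "emb (axis A r) * Op (axis {} S) = Op (axis {} S) * emb (axis A r)" for A :: "'n set" and r
    by (simp add: emb_def cl_emb_axis Op_simps[symmetric] op_times_axis id_blinfun_compose Op_eq_iff
        bounded_bilinear.scaleR_left[OF bounded_bilinear_blinfun_compose]
        bounded_bilinear.scaleR_right[OF bounded_bilinear_blinfun_compose])
  then have "emb (\<Sum>A\<in>UNIV. axis A (a $ A)) * Op (axis {} S) = Op (axis {} S) * emb (\<Sum>A\<in>UNIV. axis A (a $ A))"
    by (simp add: emb_sum sum_distrib_left sum_distrib_right)
  then show ?thesis
    by (simp only: vec_eq_sum_axis[symmetric])
qed

text \<open>The mixed terms cancel since \<open>e_i e_j = - e_j e_i\<close>.\<close>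

lemma vector_square:
  fixes d :: "'n::{finite,linorder} \<Rightarrow> 'b::real_normed_vector"
    and p :: "'b \<Rightarrow> 'b \<Rightarrow> 'c::real_normed_vector"
  assumes p: "bounded_bilinear p" and comm: "\<And>i j. p (d i) (d j) = p (d j) (d i)"
  shows "cl_prod p (\<Sum>i\<in>UNIV. axis {i} (d i)) (\<Sum>i\<in>UNIV. axis {i} (d i)) =
    (axis {} (- (\<Sum>i\<in>UNIV. p (d i) (d i))) :: 'c ^ ('n set))"
proof -
  have ax: "cl_prod p (axis {i} (d i)) (axis {j} (d j)) =
      (axis (sym_diff {i} {j}) (cl_sign {i} {j} *\<^sub>R p (d i) (d j)) :: 'c ^ ('n set))" for i j
    by (rule cl_prod_axis) (simp_all add: bounded_bilinear.zero_left[OF p] bounded_bilinear.zero_right[OF p])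
  have z: "axis k 0 = (0 :: 'c ^ ('n set))" for k :: "'n set"
    by (simp add: axis_def vec_eq_iff)
  define S where "S = (\<Sum>i\<in>UNIV. \<Sum>j\<in>UNIV. axis (sym_diff {i} {j}) (cl_sign {i} {j} *\<^sub>R p (d i) (d j)) :: 'c ^ ('n set))"
  have swap: "S = (\<Sum>i\<in>UNIV. \<Sum>j\<in>UNIV. axis (sym_diff {i} {j}) (cl_sign {j} {i} *\<^sub>R p (d i) (d j)))"
    unfolding S_def by (subst sum.swap) (simp only: comm Un_commute)
  have pair: "axis (sym_diff {i} {j}) (cl_sign {i} {j} *\<^sub>R p (d i) (d j)) +
      axis (sym_diff {i} {j}) (cl_sign {j} {i} *\<^sub>R p (d i) (d j)) =
      (if j = i then axis {} (- (p (d i) (d i))) + axis {} (- (p (d i) (d i))) else 0 :: 'c ^ ('n set))" for i j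
    using linear[of i j] unfolding axis_add_eq[symmetric] scaleR_add_left[symmetric]
    by (auto simp: cl_sign_prod z scaleR_2 axis_add_eq[symmetric])
  have "S + S = (\<Sum>i\<in>UNIV. \<Sum>j\<in>UNIV. (if j = i then axis {} (- (p (d i) (d i))) + axis {} (- (p (d i) (d i))) else 0 :: 'c ^ ('n set)))"
    by (subst (2) swap) (simp only: S_def sum.distrib[symmetric] pair)
  also have "\<dots> = (\<Sum>i\<in>UNIV. axis {} (- (p (d i) (d i)))) + (\<Sum>i\<in>UNIV. axis {} (- (p (d i) (d i))))"
    by (simp add: sum.distrib)
  finally have "S = (\<Sum>i\<in>UNIV. axis {} (- (p (d i) (d i))))"
    by (metis (no_types, lifting) scaleR_half_double scaleR_add_right)
  also have "\<dots> = axis {} (- (\<Sum>i\<in>UNIV. p (d i) (d i)))"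
    by (simp add: vec_eq_iff axis_def sum_negf)
  finally have "S = axis {} (- (\<Sum>i\<in>UNIV. p (d i) (d i)))" .
  moreover have "cl_prod p (\<Sum>i\<in>UNIV. axis {i} (d i)) (\<Sum>i\<in>UNIV. axis {i} (d i)) = S"
    unfolding S_def cl_prod_sum_left[OF p] cl_prod_sum_right[OF p] ax by (rule sum.swap)
  ultimately show ?thesis
    by simp
qed

section \<open>Imaginary units and operators with vanishing real component\<close>

definition imag :: "real ^ ('n::{finite,linorder}) \<Rightarrow> ('v::banach, 'n) clifford_op" where
  "imag I = emb (cl_of_point (0, I))"

lemma cl_of_vector: "cl_of_point (0, I) = (\<Sum>i\<in>UNIV. axis {i} (I $ i))"
  by (simp add: cl_of_point_def paravec_def vec_eq_iff axis_def)

lemma imag_square: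
  assumes "norm I = 1"
  shows "imag I * imag I = (- 1 :: ('v::banach, 'n::{finite,linorder}) clifford_op)"
proof -
  have "(\<Sum>i\<in>UNIV. I $ i * I $ i) = 1"
    using assms power2_norm_eq_inner[of I] by (simp add: inner_vec_def)
  then have "cl_of_point (0, I) \<odot> cl_of_point (0, I) = axis {} (- 1)"
    unfolding cl_of_vector by (subst vector_square[OF bounded_bilinear_mult]) (simp_all add: mult.commute)
  then show ?thesis
    by (simp add: imag_def emb_mult[symmetric] emb_axis_empty)
qed

lemma cl_of_slice_point: "cl_of_point (slice_point I (x, y)) = axis {} x + y *\<^sub>R cl_of_point (0, I)"
  unfolding cl_of_vector
  by (simp add: cl_of_point_def slice_point_def paravec_def vec_eq_iff axis_def sum_distrib_left if_distrib
      cong: if_cong)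

text \<open>The vanishing of \<open>T_0\<close> enters through the last claim: with
  \<open>op_conj T = - T\<close> the term of \<open>Q_op\<close> that is linear in \<open>T\<close>
  disappears, and \<open>s - op_conj T\<close> becomes \<open>s + T\<close>.\<close>

lemma BC1_components:
  fixes T :: "('v::banach, 'n::{finite,linorder}) cl_op"
  assumes "T \<in> BC1"
  shows "T = (\<Sum>i\<in>UNIV. axis {i} (component T i))"
    and "component T i o\<^sub>L component T k = component T k o\<^sub>L component T i"
    and "op_conj T = - T"
proof -
  obtain T0 t where T: "T = paravec T0 t" and comm: "\<And>i k. t i o\<^sub>L t k = t k o\<^sub>L t i" and "T $ {} = 0"
    using assms by (auto simp: BC1_def BC01_def)
  have "T $ {} = T0"
    unfolding T paravec_def by (simp add: axis_def)
  with \<open>T $ {} = 0\<close> have "T0 = 0"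
    by simp
  then have T': "T = (\<Sum>i\<in>UNIV. axis {i} (t i))"
    unfolding T paravec_def by (simp add: vec_eq_iff axis_def)
  have c: "component T i = t i" for i
    unfolding component_def T' by (simp add: axis_def)
  show "T = (\<Sum>i\<in>UNIV. axis {i} (component T i))"
    "component T i o\<^sub>L component T k = component T k o\<^sub>L component T i"
    unfolding c using T' comm by simp_all
  have "axis k (- x) = - axis k x" "axis k 0 = (0 :: ('v, 'n) cl_op)" for k :: "'n set" and x :: "'v \<Rightarrow>\<^sub>L 'v"
    by (simp_all add: vec_eq_iff axis_def)
  then have "axis {} 0 + (\<Sum>i\<in>UNIV. axis {i} (- t i)) = - (\<Sum>i\<in>UNIV. axis {i} (t i))"
    by (simp add: sum_negf)
  then show "op_conj T = - T"
    unfolding op_conj_def paravec_def c \<open>T $ {} = 0\<close> using T' by simp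
qed

definition neg_square :: "('v::banach, 'n::{finite,linorder}) cl_op \<Rightarrow> ('v, 'n) clifford_op" where
  "neg_square T = - (Op T * Op T)"

text \<open>As the components commute, the mixed products in \<open>T^2\<close> cancel and an
  operator on \<open>V\<close> remains; so \<open>neg_square T\<close> commutes with all imaginary
  units at once.\<close>

lemma neg_square_commute_emb:
  fixes T :: "('v::banach, 'n::{finite,linorder}) cl_op"
  assumes "T \<in> BC1"
  shows "emb a * neg_square T = neg_square T * emb a"
proof -
  have "T \<otimes> T = axis {} (- (\<Sum>i\<in>UNIV. component T i o\<^sub>L component T i))"
    by (subst (1 2) BC1_components(1)[OF assms])
      (rule vector_square[OF bounded_bilinear_blinfun_compose BC1_components(2)[OF assms]])
  moreover have "neg_square T = - Op (T \<otimes> T)"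
    by (simp add: neg_square_def Op_simps)
  ultimately show ?thesis
    by (simp add: emb_commute_scalar)
qed

lemma neg_square_commute: "Op T * neg_square T = neg_square T * Op T"
  by (simp add: neg_square_def mult.assoc)

lemma imaginary_unit_op_imag:
  assumes "T \<in> BC1" "norm I = 1"
  shows "imaginary_unit_op (imag I) (neg_square T)"
proof unfold_locales
  show "imag I * imag I = (- 1 :: ('a, 'b) clifford_op)"
    by (rule imag_square[OF assms(2)])
  show "neg_square T * imag I = imag I * neg_square T"
    unfolding imag_def by (rule neg_square_commute_emb[OF assms(1), symmetric])
qed

section \<open>The quadratic spectrum and the S-spectrum\<close>

text \<open>This automorphism maps \<open>T\<close> to \<open>- T\<close> and preserves
  invertibility. Hence, if \<open>T^2 - 2 s_0 T + |s|^2\<close> is invertible, so is the polynomial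
  with the opposite linear term.\<close>

definition grade_involution :: "('v::banach, 'n::{finite,linorder}) clifford_op \<Rightarrow> ('v, 'n) clifford_op" where
  "grade_involution x = Op (\<chi> A. (- 1) ^ card A *\<^sub>R (op_vec x $ A))"

lemma grade_involution_add: "grade_involution (x + y) = grade_involution x + grade_involution y"
  and grade_involution_diff: "grade_involution (x - y) = grade_involution x - grade_involution y"
  and grade_involution_scaleR: "grade_involution (r *\<^sub>R x) = r *\<^sub>R grade_involution x"
  by (simp_all add: grade_involution_def plus_clifford_op_def minus_clifford_op_def scaleR_clifford_op_def Op_eq_iff
      vec_eq_iff scaleR_add_right scaleR_diff_right)

lemma grade_involution_axis: "grade_involution (Op (axis A S)) = (- 1) ^ card A *\<^sub>R Op (axis A S)"
  by (simp add: grade_involution_def scaleR_clifford_op_def Op_eq_iff vec_eq_iff axis_def)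

lemma grade_involution_sum: "grade_involution (\<Sum>i\<in>S. f i) = (\<Sum>i\<in>S. grade_involution (f i))"
proof (induction S rule: infinite_finite_induct)
  case empty
  show ?case
    using grade_involution_scaleR[of 0 0] by simp
next
  case (infinite S)
  then show ?case
    using grade_involution_scaleR[of 0 0] by simp
qed (simp add: grade_involution_add)

lemma grade_involution_mult: "grade_involution (x * y) = grade_involution x * grade_involution y"
proof -
  have sgn: "(- 1 :: real) ^ card (sym_diff A C) = (- 1) ^ card A * (- 1) ^ card C" for A C :: "'b set"
    using prod_sym_diff[of "\<lambda>_. - 1" A C] by simp
  have ax: "grade_involution (Op (axis A S) * Op (axis C R)) =
      grade_involution (Op (axis A S)) * grade_involution (Op (axis C R))" for A C :: "'b set" and S R :: "'a \<Rightarrow>\<^sub>L 'a"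
    by (simp add: Op_simps(5)[symmetric] op_times_axis grade_involution_axis sgn)
  have expand: "x = (\<Sum>A\<in>UNIV. Op (axis A (op_vec x $ A)))" for x :: "('a, 'b) clifford_op"
    by (simp only: Op_sum[symmetric] vec_eq_sum_axis[symmetric] op_vec_inverse)
  have "grade_involution ((\<Sum>A\<in>UNIV. Op (axis A (op_vec x $ A))) * (\<Sum>A\<in>UNIV. Op (axis A (op_vec y $ A)))) =
      grade_involution (\<Sum>A\<in>UNIV. Op (axis A (op_vec x $ A))) * grade_involution (\<Sum>A\<in>UNIV. Op (axis A (op_vec y $ A)))"
    by (simp only: sum_product grade_involution_sum ax)
  then show ?thesis
    by (simp only: expand[symmetric])
qed

lemma grade_involution_one: "grade_involution 1 = 1"
  using grade_involution_axis[of "{}" id_blinfun] by (simp add: one_clifford_op_def op_one_def)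

lemma grade_involution_BC1: "T \<in> BC1 \<Longrightarrow> grade_involution (Op T) = - Op T"
  by (subst (1 2) BC1_components(1))
    (simp_all add: Op_sum grade_involution_sum grade_involution_axis sum_negf)

lemma grade_involution_units: "x \<in> ring_units \<Longrightarrow> grade_involution x \<in> ring_units"
  unfolding ring_units_def inverse_pair_def
  by (auto simp: grade_involution_mult[symmetric] grade_involution_one) (metis grade_involution_mult grade_involution_one)

lemma norm_slice_point: "norm I = 1 \<Longrightarrow> norm (slice_point I (Re z, Im z)) = norm z"
  by (simp add: slice_point_def norm_Pair cmod_def)

text \<open>The difference of squares \<open>(a - r t) (a + r t)\<close> with
  \<open>a = t^2 + m\<close>, arranged by powers of \<open>- t^2\<close> to match
  \<open>resolvent_norm\<close>.\<close>

lemma quadratic_product: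
  fixes t :: "'a::{real_normed_algebra, monoid_mult}"
  shows "(t * t - r *\<^sub>R t + m *\<^sub>R 1) * (t * t + r *\<^sub>R t + m *\<^sub>R 1) =
    m\<^sup>2 *\<^sub>R 1 + (r\<^sup>2 - 2 * m) *\<^sub>R (- (t * t)) + (- (t * t)) * (- (t * t))"
  by (simp add: algebra_simps power2_eq_square) (simp add: scaleR_add_left[symmetric] mult_2_right)

text \<open>With \<open>E = T^2 - 2 s_0 T + |s|^2\<close> and its image \<open>E'\<close> under the grade involution, which maps \<open>T\<close> to \<open>- T\<close>,
  \<open>E E' = Q_s Q_{s'}\<close> for the conjugate \<open>s'\<close> of \<open>s\<close>.\<close>

lemma quadratic_spectrum_subset:
  fixes T :: "('v::banach, 'n::{finite,linorder}) cl_op"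
  assumes T: "T \<in> BC1" and I: "norm I = 1" and z: "z \<in> quadratic_spectrum (neg_square T)"
  shows "slice_point I (Re z, Im z) \<in> S_spectrum T"
proof (rule ccontr)
  let ?t = "Op T"
  define E where "E = ?t * ?t - (2 * Re z) *\<^sub>R ?t + (norm z)\<^sup>2 *\<^sub>R 1"
  assume "slice_point I (Re z, Im z) \<notin> S_spectrum T"
  then have "E \<in> ring_units"
    by (simp add: S_spectrum_def op_invertible_iff norm_slice_point[OF I] Op_simps E_def)
      (simp add: slice_point_def)
  moreover have "grade_involution E = ?t * ?t + (2 * Re z) *\<^sub>R ?t + (norm z)\<^sup>2 *\<^sub>R 1"
    unfolding E_def
    by (simp add: grade_involution_add grade_involution_diff grade_involution_scaleR grade_involution_mult grade_involution_one
        grade_involution_BC1[OF T])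
  moreover have "E * (?t * ?t + (2 * Re z) *\<^sub>R ?t + (norm z)\<^sup>2 *\<^sub>R 1) = resolvent_norm (neg_square T) z"
  proof -
    have "2 * Re (z\<^sup>2) = (2 * Re z)\<^sup>2 - 2 * (norm z)\<^sup>2"
      unfolding cmod_power2 by (simp add: power2_eq_square algebra_simps)
    moreover have "norm z ^ 4 = ((norm z)\<^sup>2)\<^sup>2"
      by simp
    ultimately show ?thesis
      unfolding E_def resolvent_norm_def neg_square_def by (simp only: quadratic_product)
  qed
  ultimately have "resolvent_norm (neg_square T) z \<in> ring_units"
    using ring_units_mult grade_involution_units by metis
  then show False
    using z by (simp add: quadratic_spectrum_def)
qed

context
  fixes T :: "('v::banach, 'n::{finite,linorder}) cl_op" and I :: "real ^ ('n::{finite,linorder})" and z :: complex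
  assumes T: "T \<in> BC1" and I: "norm I = 1"
begin

interpretation imaginary_unit_op "imag I" "neg_square T"
  by (rule imaginary_unit_op_imag[OF T I])

lemma emb_slice_point: "emb (cl_of_point (slice_point I (Re z, Im z))) = imaginary_unit.iota (imag I :: ('v, 'n) clifford_op) z"
  by (simp add: cl_of_slice_point emb_add emb_scaleR emb_axis_empty iota_def flip: imag_def)

lemma Op_op_inv_Q_op:
  assumes "z \<notin> K"
  shows "Op (op_inv (Q_op T (slice_point I (Re z, Im z)))) = imaginary_unit_op.res (imag I) (neg_square T) z"
proof (rule Op_op_inv)
  have "Op (Q_op T (slice_point I (Re z, Im z))) = iota (z\<^sup>2) + neg_square T"
    by (simp add: Q_op_def Op_simps emb_mult emb_slice_point BC1_components(3)[OF T] neg_square_def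
        power2_eq_square iota_mult flip: emb_def)
  then show "inverse_pair (Op (Q_op T (slice_point I (Re z, Im z)))) (res z)"
    using res_inverse[OF assms] by simp
qed

end

section \<open>Stem functions\<close>

lemma unit_vector_exists: "\<exists>I :: real ^ 'n. norm I = 1"
  by (rule exI[of _ "axis undefined 1"]) simp

definition plane :: "'n::finite point set \<Rightarrow> complex set" where
  "plane U = {z. (Re z, Im z) \<in> uv_set U}"

lemma slice_eq_plane:
  assumes "axially_symmetric U" "norm I = 1"
  shows "slice I U = plane U"
proof (intro equalityI subsetI)
  fix z assume "z \<in> slice I U"
  then have *: "slice_point I (Re z, Im z) \<in> U"
    by (simp add: slice_def)
  have "slice_point J (Re z, Im z) \<in> U" if J: "norm J = 1" for J
  proof -
    \<comment> \<open>\<open>point_class\<close> provides only points with a nonnegative second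
      coordinate, so a negative sign of \<open>Im z\<close> is moved to the unit vector.\<close>
    define J' where "J' = (if Im z < 0 then - J else J)"
    have "norm J' = 1"
      using J by (simp add: J'_def)
    then have "slice_point J' (Re z, \<bar>Im z\<bar>) \<in> point_class (slice_point I (Re z, Im z))"
      using assms(2) unfolding point_class_def
      by (auto simp: slice_point_def intro!: exI[of _ J'])
    then have "slice_point J' (Re z, \<bar>Im z\<bar>) \<in> U"
      using assms(1) * by (auto simp: axially_symmetric_def)
    then show ?thesis
      by (auto simp: J'_def slice_point_def split: if_splits)
  qed
  then show "z \<in> plane U"
    by (simp add: plane_def uv_set_def)
next
  fix z assume "z \<in> plane U"
  then show "z \<in> slice I U"
    using assms(2) by (simp add: plane_def uv_set_def slice_def)
qed

lemma continuous_slice_point: "continuous_on S (\<lambda>z. slice_point I (Re z, Im z))"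
  unfolding slice_point_def by (intro continuous_intros)

lemma open_slice: "open U \<Longrightarrow> open (slice I U)"
  using continuous_slice_point[of UNIV I] open_vimage[of U "\<lambda>z. slice_point I (Re z, Im z)"]
  by (simp add: slice_def vimage_def)

lemma open_plane: "open U \<Longrightarrow> axially_symmetric U \<Longrightarrow> open (plane (U :: 'n::finite point set))"
  using unit_vector_exists open_slice slice_eq_plane by metis

lemma cnj_plane: "z \<in> plane U \<Longrightarrow> cnj z \<in> plane U"
  unfolding plane_def uv_set_def
  by (auto simp: slice_point_def) (metis norm_minus_cancel scaleR_minus_left scaleR_minus_right)

lemma plane_Int: "plane (U \<inter> U') = plane U \<inter> plane U'"
  by (auto simp: plane_def uv_set_def)

lemma closure_slice: "closure (slice I U) \<subseteq> slice I (closure U)"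
proof (rule closure_minimal)
  show "slice I U \<subseteq> slice I (closure U)"
    using closure_subset by (auto simp: slice_def)
  show "closed (slice I (closure U))"
    using continuous_slice_point[of UNIV I] closed_vimage[of "closure U" "\<lambda>z. slice_point I (Re z, Im z)"]
    by (simp add: slice_def vimage_def)
qed

text \<open>The quadratic spectrum lies in the slice because the S-spectrum lies in
  \<open>U\<close>; boundedness of \<open>U\<close> makes it compact. The frontier of the open slice
  avoids the slice, hence the spectrum, and stays in the domain of the function.\<close>

lemma admissible_surrounds:
  fixes T :: "('v::banach, 'n::{finite,linorder}) cl_op"
  assumes T: "T \<in> BC1" and U: "bounded U" "slice_Cauchy_domain U" "S_spectrum T \<subseteq> U" "closure U \<subseteq> \<Omega>"
    and \<Omega>: "open \<Omega>" "axially_symmetric \<Omega>" and I: "norm I = 1" and \<Gamma>: "oriented_boundary \<Gamma> (slice I U)"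
  shows "surrounds (plane \<Omega>) (quadratic_spectrum (neg_square T)) \<Gamma> (\<lambda>\<gamma>. \<gamma>)"
proof -
  let ?K = "quadratic_spectrum (neg_square T)"
  have sub: "?K \<subseteq> slice I U"
    using quadratic_spectrum_subset[OF T I] U(3) by (auto simp: slice_def)
  have op: "open (slice I U)"
    using U(2) by (simp add: slice_Cauchy_domain_def open_slice)
  have clo: "closure (slice I U) \<subseteq> plane \<Omega>"
    using closure_slice[of I U] U(4) slice_eq_plane[OF \<Omega>(2) I] by (auto simp: slice_def)
  obtain b where b: "\<And>x. x \<in> U \<Longrightarrow> norm x \<le> b"
    using U(1) by (auto simp: bounded_iff)
  then have "norm z \<le> b" if "z \<in> slice I U" for z
    using that norm_slice_point[OF I, of z] b[of "slice_point I (Re z, Im z)"] by (simp add: slice_def)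
  then have "bounded ?K"
    using sub by (auto simp: bounded_iff)
  then have "compact ?K"
    using closed_quadratic_spectrum compact_eq_bounded_closed by blast
  moreover have "cycle_in (plane \<Omega> - ?K) \<Gamma> (\<lambda>\<gamma>. \<gamma>)"
    using \<Gamma> clo sub op unfolding cycle_in_def oriented_boundary_def
    by (auto simp: frontier_def interior_open)
  moreover have "cycle_winding \<Gamma> (\<lambda>\<gamma>. \<gamma>) z = 1" if "z \<in> ?K" for z
    using \<Gamma> that sub by (auto simp: oriented_boundary_def cycle_winding_def)
  moreover have "cycle_winding \<Gamma> (\<lambda>\<gamma>. \<gamma>) z = 0" if "z \<notin> plane \<Omega>" for z
    using \<Gamma> that clo by (auto simp: oriented_boundary_def cycle_winding_def)
  moreover have "?K \<subseteq> plane \<Omega>"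
    using sub clo closure_subset by blast
  ultimately show ?thesis
    unfolding surrounds_def using open_plane[OF \<Omega>] by blast
qed

text \<open>\<open>\<phi> (u + I v)\<close> is the sum of the \<open>\<Phi>_A (u + I v) e_A\<close>, where the \<open>\<Phi>_A\<close> are holomorphic and real on the
  real axis.\<close>

definition stem :: "'v::banach itself \<Rightarrow> 'n::{finite,linorder} point set \<Rightarrow> ('n point \<Rightarrow> real ^ ('n set)) \<Rightarrow>
    ('n set \<Rightarrow> complex \<Rightarrow> complex) \<Rightarrow> bool" where
  "stem _ \<Omega> \<phi> \<Phi> \<longleftrightarrow>
     (\<forall>A. \<Phi> A holomorphic_on plane \<Omega> \<and> (\<forall>z\<in>plane \<Omega>. \<Phi> A (cnj z) = cnj (\<Phi> A z))) \<and>
     (\<forall>I z. norm I = 1 \<longrightarrow> z \<in> plane \<Omega> \<longrightarrow>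
        (emb (\<phi> (slice_point I (Re z, Im z))) :: ('v, 'n) clifford_op) =
          (\<Sum>A\<in>UNIV. imaginary_unit.iota (imag I) (\<Phi> A z) * emb (axis A 1)))"

lemma imaginary_unit_imag: "norm I = 1 \<Longrightarrow> imaginary_unit (imag I :: ('v::banach, 'n::{finite,linorder}) clifford_op)"
  by unfold_locales (rule imag_square)

text \<open>Coordinate by coordinate, the system in \<open>slice_components\<close> is the
  Cauchy-Riemann system for \<open>a + \<i> b\<close>; the complex derivative is read off in the
  direction \<open>(1, 0)\<close>.\<close>

lemma slice_components_holomorphic:
  fixes A :: "'n::{finite,linorder} set"
  assumes ab: "slice_components \<Omega> \<phi> a b" and \<Omega>: "open \<Omega>" "axially_symmetric \<Omega>"
  shows "(\<lambda>z. Complex (a (Re z, Im z) $ A) (b (Re z, Im z) $ A)) holomorphic_on plane \<Omega>"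
proof -
  have "\<exists>D. ((\<lambda>z. Complex (a (Re z, Im z) $ A) (b (Re z, Im z) $ A)) has_field_derivative D) (at z)"
    if z: "z \<in> plane \<Omega>" for z
  proof -
    let ?p = "(Re z, Im z)"
    have p: "?p \<in> uv_set \<Omega>"
      using z by (simp add: plane_def)
    define a' where "a' = frechet_derivative a (at ?p)"
    define b' where "b' = frechet_derivative b (at ?p)"
    have a': "(a has_derivative a') (at ?p)" and b': "(b has_derivative b') (at ?p)"
      and CR: "a' (1, 0) = b' (0, 1)" "a' (0, 1) = - b' (1, 0)"
      using ab p unfolding slice_components_def a'_def b'_def
      by (auto simp: frechet_derivative_works[symmetric])
    have lin: "c h = fst h *\<^sub>R c (1, 0) + snd h *\<^sub>R c (0, 1)" if "(f has_derivative c) (at ?p)"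
      for c f :: "real \<times> real \<Rightarrow> real ^ ('n set)" and h
    proof -
      have c: "linear c"
        using that by (rule has_derivative_linear)
      have "c h = c (fst h *\<^sub>R (1, 0) + snd h *\<^sub>R (0, 1))"
        by simp
      then show ?thesis
        by (simp only: linear_add[OF c] linear_scale[OF c])
    qed
    have "((\<lambda>z. (Re z, Im z)) has_derivative (\<lambda>h. (Re h, Im h))) (at z)"
      by (auto intro!: derivative_eq_intros)
    note chain = diff_chain_at[OF this]
    have "((\<lambda>z. a (Re z, Im z) $ A) has_derivative (\<lambda>h. a' (Re h, Im h) $ A)) (at z)"
      "((\<lambda>z. b (Re z, Im z) $ A) has_derivative (\<lambda>h. b' (Re h, Im h) $ A)) (at z)"
      using bounded_linear.has_derivative[OF bounded_linear_vec_nth chain[OF a']]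
        bounded_linear.has_derivative[OF bounded_linear_vec_nth chain[OF b']] by (simp_all add: o_def)
    then have "((\<lambda>z. of_real (a (Re z, Im z) $ A) + \<i> * of_real (b (Re z, Im z) $ A)) has_derivative
        (\<lambda>h. of_real (a' (Re h, Im h) $ A) + \<i> * of_real (b' (Re h, Im h) $ A))) (at z)"
      by (intro has_derivative_add has_derivative_mult_right has_derivative_of_real)
    moreover have "of_real (a' (Re h, Im h) $ A) + \<i> * of_real (b' (Re h, Im h) $ A) =
        Complex (a' (1, 0) $ A) (b' (1, 0) $ A) * h" for h
      unfolding lin[OF a', of "(Re h, Im h)"] lin[OF b', of "(Re h, Im h)"]
      using CR by (simp add: complex_eq_iff algebra_simps)
    ultimately have "((\<lambda>z. of_real (a (Re z, Im z) $ A) + \<i> * of_real (b (Re z, Im z) $ A)) has_field_derivative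
        Complex (a' (1, 0) $ A) (b' (1, 0) $ A)) (at z)"
      by (simp add: has_field_derivative_def)
    then show ?thesis
      by (auto simp: Complex_eq)
  qed
  then show ?thesis
    using open_plane[OF \<Omega>] by (simp add: holomorphic_on_open)
qed

text \<open>The coordinates of \<open>a\<close> and \<open>b\<close> are real and the imaginary unit
  multiplies \<open>b\<close> from the left, so in \<open>a + I b\<close> all basis elements can be
  collected on the right.\<close>

lemma slice_components_stem:
  fixes \<Omega> :: "'n::{finite,linorder} point set"
  assumes ab: "slice_components \<Omega> \<phi> a b" and \<Omega>: "open \<Omega>" "axially_symmetric \<Omega>"
  shows "stem TYPE('v::banach) \<Omega> \<phi> (\<lambda>A z. Complex (a (Re z, Im z) $ A) (b (Re z, Im z) $ A))"
  unfolding stem_def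
proof (intro conjI allI impI ballI)
  fix A :: "'n set" and I :: "(real, 'n) vec" and z :: complex
  show "(\<lambda>z. Complex (a (Re z, Im z) $ A) (b (Re z, Im z) $ A)) holomorphic_on plane \<Omega>"
    by (rule slice_components_holomorphic[OF assms])
  assume z: "z \<in> plane \<Omega>"
  then show "Complex (a (Re (cnj z), Im (cnj z)) $ A) (b (Re (cnj z), Im (cnj z)) $ A) =
      cnj (Complex (a (Re z, Im z) $ A) (b (Re z, Im z) $ A))"
    using ab by (simp add: slice_components_def plane_def complex_eq_iff)
  assume I: "norm I = 1"
  interpret imaginary_unit "imag I :: ('v, 'n) clifford_op"
    by (rule imaginary_unit_imag[OF I])
  have *: "x = (\<Sum>A\<in>UNIV. (x $ A) *\<^sub>R axis A 1)" for x :: "real ^ ('n set)"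
    by (simp add: vec_eq_iff axis_def if_distrib cong: if_cong)
  have "\<phi> (slice_point I (Re z, Im z)) = a (Re z, Im z) + cl_of_point (0, I) \<odot> b (Re z, Im z)"
    using ab I z by (simp add: slice_components_def plane_def)
  also have "(emb \<dots> :: ('v, 'n) clifford_op) =
      emb (\<Sum>A\<in>UNIV. (a (Re z, Im z) $ A) *\<^sub>R axis A 1) + imag I * emb (\<Sum>A\<in>UNIV. (b (Re z, Im z) $ A) *\<^sub>R axis A 1)"
    unfolding *[symmetric] by (simp add: emb_add emb_mult imag_def)
  also have "\<dots> = (\<Sum>A\<in>UNIV. iota (Complex (a (Re z, Im z) $ A) (b (Re z, Im z) $ A)) * emb (axis A 1))"
    by (simp add: emb_sum emb_scaleR iota_def distrib_right sum_distrib_left sum.distrib)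
  finally show "(emb (\<phi> (slice_point I (Re z, Im z))) :: ('v, 'n) clifford_op) =
      (\<Sum>A\<in>UNIV. iota (Complex (a (Re z, Im z) $ A) (b (Re z, Im z) $ A)) * emb (axis A 1))" .
qed

lemma left_slice_hyperholomorphic_stem:
  fixes \<Omega> :: "'n::{finite,linorder} point set"
  assumes "left_slice_hyperholomorphic \<Omega> \<phi>"
  obtains \<Phi> where "stem TYPE('v::banach) \<Omega> \<phi> \<Phi>"
  using assms slice_components_stem unfolding left_slice_hyperholomorphic_def by blast

text \<open>The components with nonempty \<open>A\<close> are known to vanish on the domain only.
  They are replaced by the zero function, so that sums of integrals over \<open>A\<close> collapse
  to one term.\<close>

lemma intrinsic_slice_hyperholomorphic_stem:
  fixes \<Omega> :: "'n::{finite,linorder} point set"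
  assumes "intrinsic_slice_hyperholomorphic \<Omega> \<phi>"
  obtains F where "stem TYPE('v::banach) \<Omega> \<phi> (\<lambda>A. if A = {} then F else (\<lambda>z. 0))"
proof -
  obtain a b where ab: "slice_components \<Omega> \<phi> a b"
    and real: "\<And>p. p \<in> uv_set \<Omega> \<Longrightarrow> a p \<in> range (axis {}) \<and> b p \<in> range (axis {})"
    and \<Omega>: "open \<Omega>" "axially_symmetric \<Omega>"
    using assms by (auto simp: intrinsic_slice_hyperholomorphic_def)
  define \<Phi> where "\<Phi> A z = Complex (a (Re z, Im z) $ A) (b (Re z, Im z) $ A)" for A z
  have stem: "stem TYPE('v) \<Omega> \<phi> \<Phi>"
    unfolding \<Phi>_def by (rule slice_components_stem[OF ab \<Omega>])
  have zero: "\<Phi> A z = 0" if "z \<in> plane \<Omega>" "A \<noteq> {}" for A z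
    using real[of "(Re z, Im z)"] that by (auto simp: plane_def \<Phi>_def axis_def complex_eq_iff)
  have "stem TYPE('v) \<Omega> \<phi> (\<lambda>A. if A = {} then \<Phi> {} else (\<lambda>z. 0))"
    unfolding stem_def
  proof (intro conjI allI impI ballI)
    fix A :: "'n set" and I :: "(real, 'n) vec" and z :: complex
    show "(if A = {} then \<Phi> {} else (\<lambda>z. 0)) holomorphic_on plane \<Omega>"
      using stem by (simp add: stem_def)
    assume z: "z \<in> plane \<Omega>"
    then show "(if A = {} then \<Phi> {} else (\<lambda>z. 0)) (cnj z) = cnj ((if A = {} then \<Phi> {} else (\<lambda>z. 0)) z)"
      using stem by (simp add: stem_def)
    assume I: "norm I = 1"
    have "(if A = {} then \<Phi> {} else (\<lambda>z. 0)) z = \<Phi> A z" for A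
      using zero[OF z] by simp
    then show "(emb (\<phi> (slice_point I (Re z, Im z))) :: ('v, 'n) clifford_op) =
        (\<Sum>A\<in>UNIV. imaginary_unit.iota (imag I) ((if A = {} then \<Phi> {} else (\<lambda>z. 0)) z) * emb (axis A 1))"
      using stem z I by (simp add: stem_def)
  qed
  then show ?thesis
    by (rule that)
qed

text \<open>For intrinsic \<open>f\<close> the embedded value is \<open>iota (F z)\<close>, with no
  basis element between it and the components of \<open>g\<close>, so the components of the product
  are products of complex numbers.\<close>

lemma stem_product:
  fixes \<Omega> \<Omega>' :: "'n::{finite,linorder} point set"
  assumes f: "stem TYPE('v::banach) \<Omega> f (\<lambda>A. if A = {} then F else (\<lambda>z. 0))" and g: "stem TYPE('v) \<Omega>' g G"
  shows "stem TYPE('v) (\<Omega> \<inter> \<Omega>') (\<lambda>x. f x \<odot> g x) (\<lambda>A z. F z * G A z)"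
  unfolding stem_def plane_Int
proof (intro conjI allI impI ballI)
  have F: "F holomorphic_on plane \<Omega>" "\<And>z. z \<in> plane \<Omega> \<Longrightarrow> F (cnj z) = cnj (F z)"
    using f[unfolded stem_def, THEN conjunct1, rule_format, of "{}"] by auto
  fix A :: "'n set" and I :: "(real, 'n) vec" and z :: complex
  show "(\<lambda>z. F z * G A z) holomorphic_on plane \<Omega> \<inter> plane \<Omega>'"
    using g F unfolding stem_def by (intro holomorphic_on_mult) (auto intro: holomorphic_on_subset)
  assume z: "z \<in> plane \<Omega> \<inter> plane \<Omega>'"
  then show "F (cnj z) * G A (cnj z) = cnj (F z * G A z)"
    using g F by (simp add: stem_def)
  assume I: "norm I = 1"
  interpret imaginary_unit "imag I :: ('v, 'n) clifford_op"
    by (rule imaginary_unit_imag[OF I])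
  have "emb (f (slice_point I (Re z, Im z))) = (\<Sum>A\<in>UNIV. iota ((if A = {} then F else (\<lambda>z. 0)) z) * emb (axis A 1))"
    using f z I by (simp add: stem_def)
  also have "\<dots> = (\<Sum>A\<in>(UNIV :: 'n set set). if A = {} then iota (F z) * emb (axis {} 1) else 0)"
    by (intro sum.cong) auto
  also have "\<dots> = iota (F z)"
    by (simp add: emb_axis_empty)
  finally show "(emb (f (slice_point I (Re z, Im z)) \<odot> g (slice_point I (Re z, Im z))) :: ('v, 'n) clifford_op) =
      (\<Sum>A\<in>UNIV. iota (F z * G A z) * emb (axis A 1))"
    using g z I by (simp add: stem_def emb_mult sum_distrib_left iota_mult mult.assoc)
qed

section \<open>The functional calculi in terms of stem functions\<close>

lemma emb_minus: "emb (- a) = - emb a"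
  using emb_scaleR[of "- 1" a] by simp

text \<open>The resolvents of all four calculi have the form \<open>(c s + b) Q_s^-m\<close> with a
  real \<open>c\<close> and a constant operator \<open>b\<close>. The operator stays on the left,
  outside the integral, and need not commute with the imaginary unit.\<close>

lemma slice_integral_eq:
  fixes T :: "('v::banach, 'n::{finite,linorder}) cl_op" and I :: "(real, 'n) vec"
    and c :: real and b :: "('v, 'n) clifford_op"
  defines "j \<equiv> imag I :: ('v, 'n) clifford_op" and "B \<equiv> neg_square T"
  assumes T: "T \<in> BC1" and I: "norm I = 1" and sur: "surrounds (plane \<Omega>) (quadratic_spectrum B) \<Gamma> (\<lambda>\<gamma>. \<gamma>)"
    and stem: "stem TYPE('v) \<Omega> \<phi> \<Phi>" and \<gamma>: "\<gamma> \<in> \<Gamma>"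
    and R: "\<And>z. z \<notin> quadratic_spectrum B \<Longrightarrow> Op (R (slice_point I (Re z, Im z))) =
      (c *\<^sub>R imaginary_unit.iota j z + b) * imaginary_unit_op.res j B z ^ m"
  defines "p \<equiv> \<lambda>F. imaginary_unit_op.power_integrand j B m F \<gamma>"
  shows "Op (slice_integral R \<phi> I \<gamma>) = (2 * pi) *\<^sub>R
    (\<Sum>A\<in>UNIV. (c *\<^sub>R integral {0..1} (p (\<lambda>z. z * \<Phi> A z)) + b * integral {0..1} (p (\<Phi> A))) * emb (axis A 1))"
proof -
  interpret imaginary_unit_op j B
    unfolding j_def B_def by (rule imaginary_unit_op_imag[OF T I])
  have hol: "\<Phi> A holomorphic_on plane \<Omega>" for A
    using stem by (simp add: stem_def)
  have im: "\<gamma> t \<in> plane \<Omega>" "\<gamma> t \<notin> K" if "t \<in> {0..1}" for t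
    using surroundsD(4)[OF sur] \<gamma> that by (auto simp: cycle_in_def path_image_def image_subset_iff)
  have int: "(p F has_integral integral {0..1} (p F)) {0..1}" if "F holomorphic_on plane \<Omega>" for F
    unfolding p_def by (intro integrable_integral power_integrand_integrable[OF sur that \<gamma>])
  let ?X = "\<lambda>t. (2 * pi) *\<^sub>R
      (\<Sum>A\<in>UNIV. (c *\<^sub>R p (\<lambda>z. z * \<Phi> A z) t + b * p (\<Phi> A) t) * emb (axis A 1))"
  let ?V = "(2 * pi) *\<^sub>R
    (\<Sum>A\<in>UNIV. (c *\<^sub>R integral {0..1} (p (\<lambda>z. z * \<Phi> A z)) + b * integral {0..1} (p (\<Phi> A))) * emb (axis A 1))"
  let ?f = "\<lambda>t. let s = slice_point I (Re (\<gamma> t), Im (\<gamma> t));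
         d = vector_derivative \<gamma> (at t within {0..1});
         ds_I = cl_of_point (slice_point I (Re d, Im d)) \<odot> (- cl_of_point (0, I))
     in R s \<otimes> cl_emb ds_I \<otimes> cl_emb (\<phi> s)"
  have "((\<lambda>t. b * p (\<Phi> A) t) has_integral b * integral {0..1} (p (\<Phi> A))) {0..1}" for A
    using has_integral_linear[OF int[OF hol] bounded_linear_mult_right] by (simp add: o_def)
  moreover have "((\<lambda>t. c *\<^sub>R p (\<lambda>z. z * \<Phi> A z) t) has_integral c *\<^sub>R integral {0..1} (p (\<lambda>z. z * \<Phi> A z))) {0..1}" for A
    by (intro has_integral_cmul int holomorphic_on_mult hol holomorphic_on_ident)
  ultimately have "((\<lambda>t. (c *\<^sub>R p (\<lambda>z. z * \<Phi> A z) t + b * p (\<Phi> A) t) * emb (axis A 1)) has_integral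
      (c *\<^sub>R integral {0..1} (p (\<lambda>z. z * \<Phi> A z)) + b * integral {0..1} (p (\<Phi> A))) * emb (axis A 1)) {0..1}" for A
    by (intro has_integral_mult_left has_integral_add)
  then have "(?X has_integral ?V) {0..1}"
    by (intro has_integral_cmul has_integral_sum) auto
  from has_integral_linear[OF this bounded_linear_op_vec]
  have "(op_vec \<circ> ?X has_integral op_vec ?V) {0..1}" .
  moreover have "(op_vec \<circ> ?X) t = ?f t" if t: "t \<in> {0..1}" for t
  proof -
    define d where "d = vector_derivative \<gamma> (at t within {0..1})"
    define z where "z = \<gamma> t"
    have z: "z \<in> plane \<Omega>" "z \<notin> K"
      using im[OF t] by (simp_all add: z_def)
    have summand: "(c *\<^sub>R iota z + b) * res z ^ m * (iota d * - j) * iota w = (2 * pi) *\<^sub>R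
        (c *\<^sub>R (iota (1 / (2 * of_real pi * \<i>)) * (iota d * (iota (z * w) * res z ^ m))) +
         b * (iota (1 / (2 * of_real pi * \<i>)) * (iota d * (iota w * res z ^ m))))" for w
    proof -
      \<comment> \<open>\<open>- \<i>\<close> is \<open>2 \<pi>\<close> times
        \<open>1 / (2 \<pi> \<i>)\<close>: the factor \<open>- I\<close> in \<open>ds_I\<close>
        supplies the normalization of the Cauchy integral.\<close>
      have "- j = iota (- \<i>)"
        by (simp add: iota_def)
      then have "res z ^ m * (iota d * - j) * iota w = iota (d * (- \<i>) * w) * res z ^ m"
        using iota_res_power[OF z(2), of "d * (- \<i>) * w" m] by (simp only: iota_mult mult.assoc)
      also have "d * (- \<i>) * w = of_real (2 * pi) * (1 / (2 * of_real pi * \<i>) * (d * w))"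
        by (simp add: field_simps)
      also have "iota \<dots> * res z ^ m = (2 * pi) *\<^sub>R (iota (1 / (2 * of_real pi * \<i>)) * (iota d * (iota w * res z ^ m)))"
        by (simp only: iota_mult iota_of_real mult.assoc mult_scaleR_left mult_1_left)
      finally have "(c *\<^sub>R iota z + b) * res z ^ m * (iota d * - j) * iota w =
          (2 * pi) *\<^sub>R ((c *\<^sub>R iota z + b) * (iota (1 / (2 * of_real pi * \<i>)) * (iota d * (iota w * res z ^ m))))"
        by (simp only: mult.assoc mult_scaleR_right)
      moreover have "iota z * (iota (1 / (2 * of_real pi * \<i>)) * (iota d * (iota w * res z ^ m))) =
          iota (1 / (2 * of_real pi * \<i>)) * (iota d * (iota (z * w) * res z ^ m))"
      proof -
        have "z * (1 / (2 * of_real pi * \<i>) * (d * w)) = 1 / (2 * of_real pi * \<i>) * (d * (z * w))"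
          by simp
        then show ?thesis
          by (simp only: mult.assoc[symmetric] iota_mult[symmetric])
      qed
      ultimately show ?thesis
        by (simp only: distrib_right mult_scaleR_left)
    qed
    have "Op (?f t) = (c *\<^sub>R iota z + b) * res z ^ m * (iota d * - j) * emb (\<phi> (slice_point I (Re z, Im z)))"
    proof -
      have "emb (cl_of_point (slice_point I (Re d, Im d)) \<odot> (- cl_of_point (0, I))) = iota d * - j"
        using emb_slice_point[OF T I, of d] by (simp add: emb_mult emb_minus j_def flip: imag_def)
      then show ?thesis
        using R[OF z(2)] by (simp add: Let_def Op_simps d_def z_def flip: emb_def)
    qed
    also have "emb (\<phi> (slice_point I (Re z, Im z))) = (\<Sum>A\<in>UNIV. iota (\<Phi> A z) * emb (axis A 1))"
      using stem z(1) I by (simp add: stem_def j_def)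
    also have "(c *\<^sub>R iota z + b) * res z ^ m * (iota d * - j) * \<dots> =
        (\<Sum>A\<in>UNIV. (c *\<^sub>R iota z + b) * res z ^ m * (iota d * - j) * iota (\<Phi> A z) * emb (axis A 1))"
      by (simp only: sum_distrib_left mult.assoc)
    also have "\<dots> = ?X t"
      unfolding summand p_def power_integrand_def d_def[symmetric] z_def[symmetric]
      by (simp only: mult_scaleR_left scaleR_sum_right)
    finally have "Op (?f t) = ?X t" .
    from arg_cong[OF this, of op_vec] show ?thesis
      by (simp only: o_def op_vec_Op)
  qed
  ultimately have "(?f has_integral op_vec ?V) {0..1}"
    by (rule has_integral_eq[rotated])
  then have "slice_integral R \<phi> I \<gamma> = op_vec ?V"
    unfolding slice_integral_def by (rule integral_unique)
  then show ?thesis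
    by simp
qed

text \<open>Any other admissible choice, with unit \<open>J\<close>, gives the same value for two
  reasons: for fixed \<open>J\<close> the two contours are homologous off the spectrum, and the
  integral has a form in which \<open>J\<close> does not occur. The given \<open>U\<close>,
  \<open>I\<close>, \<open>\<Gamma>\<close> show that the condition in the definite description is
  not vacuous, so the value is determined.\<close>

lemma calculus_eq:
  fixes T :: "('v::banach, 'n::{finite,linorder}) cl_op" and c :: real and b :: "('v, 'n) clifford_op"
  assumes T: "T \<in> BC1" and U: "bounded U" "slice_Cauchy_domain U" "S_spectrum T \<subseteq> U" "closure U \<subseteq> \<Omega>"
    and \<Omega>: "open \<Omega>" "axially_symmetric \<Omega>" and stem: "stem TYPE('v) \<Omega> \<phi> \<Phi>"
    and I: "norm I = 1" and \<Gamma>: "oriented_boundary \<Gamma> (slice I U)"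
    and R: "\<And>I z. norm I = 1 \<Longrightarrow> z \<notin> quadratic_spectrum (neg_square T) \<Longrightarrow>
      Op (R (slice_point I (Re z, Im z))) =
        (c *\<^sub>R imaginary_unit.iota (imag I) z + b) * imaginary_unit_op.res (imag I) (neg_square T) z ^ m"
  shows "Op (calculus T R \<Omega> \<phi>) = (\<Sum>A\<in>UNIV.
    (c *\<^sub>R real_cycle_int (neg_square T) m \<Gamma> (\<lambda>\<gamma>. \<gamma>) (\<lambda>z. z * \<Phi> A z) +
     b * real_cycle_int (neg_square T) m \<Gamma> (\<lambda>\<gamma>. \<gamma>) (\<Phi> A)) * emb (axis A 1))" (is "_ = ?V")
proof -
  let ?B = "neg_square T"
  have hol: "\<Phi> A holomorphic_on plane \<Omega>" and real: "\<And>z. z \<in> plane \<Omega> \<Longrightarrow> \<Phi> A (cnj z) = cnj (\<Phi> A z)" for A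
    using stem by (simp_all add: stem_def)
  have hol': "(\<lambda>z. z * \<Phi> A z) holomorphic_on plane \<Omega>" for A
    by (intro holomorphic_on_mult hol holomorphic_on_ident)
  have val: "op_vec ?V = (1 / (2 * pi)) *\<^sub>R (\<Sum>\<gamma>\<in>\<Delta>. slice_integral R \<phi> J \<gamma>)"
    if U': "bounded U'" "slice_Cauchy_domain U'" "S_spectrum T \<subseteq> U'" "closure U' \<subseteq> \<Omega>"
      and J: "norm J = 1" and \<Delta>: "oriented_boundary \<Delta> (slice J U')" for U' J \<Delta>
  proof -
    interpret imaginary_unit_op "imag J" ?B
      by (rule imaginary_unit_op_imag[OF T J])
    note sur = admissible_surrounds[OF T U \<Omega> I \<Gamma>] and sur' = admissible_surrounds[OF T U' \<Omega> J \<Delta>]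
    let ?p = "\<lambda>F. power_integrand m F"
    have sum: "(\<Sum>\<gamma>\<in>\<Delta>. integral {0..1} (?p F \<gamma>)) = real_cycle_int ?B m \<Gamma> (\<lambda>\<gamma>. \<gamma>) F"
      if "F holomorphic_on plane \<Omega>" "\<And>z. z \<in> plane \<Omega> \<Longrightarrow> F (cnj z) = cnj (F z)" for F
      using power_int_eq_sum[OF sur' that(1), of m] power_int_homologous[OF sur' sur that(1), of m]
        power_int_real[OF sur cnj_plane that, of m] by simp
    have "Op ((1 / (2 * pi)) *\<^sub>R (\<Sum>\<gamma>\<in>\<Delta>. slice_integral R \<phi> J \<gamma>)) =
        (1 / (2 * pi)) *\<^sub>R (\<Sum>\<gamma>\<in>\<Delta>. (2 * pi) *\<^sub>R (\<Sum>A\<in>UNIV. (c *\<^sub>R integral {0..1} (?p (\<lambda>z. z * \<Phi> A z) \<gamma>) +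
          b * integral {0..1} (?p (\<Phi> A) \<gamma>)) * emb (axis A 1)))"
      unfolding Op_simps Op_sum
      by (intro arg_cong2[where f = scaleR] refl sum.cong slice_integral_eq[OF T J sur' stem _ R[OF J]])
    also have "\<dots> = (\<Sum>\<gamma>\<in>\<Delta>. \<Sum>A\<in>UNIV. (c *\<^sub>R integral {0..1} (?p (\<lambda>z. z * \<Phi> A z) \<gamma>) +
          b * integral {0..1} (?p (\<Phi> A) \<gamma>)) * emb (axis A 1))"
    proof -
      have "1 / (2 * pi) * (2 * pi) = 1"
        by simp
      then show ?thesis
        by (simp only: scaleR_sum_right[symmetric, of "2 * pi"] scaleR_scaleR scaleR_one)
    qed
    also have "\<dots> = (\<Sum>A\<in>UNIV. (c *\<^sub>R (\<Sum>\<gamma>\<in>\<Delta>. integral {0..1} (?p (\<lambda>z. z * \<Phi> A z) \<gamma>)) +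
          b * (\<Sum>\<gamma>\<in>\<Delta>. integral {0..1} (?p (\<Phi> A) \<gamma>))) * emb (axis A 1))"
      by (subst sum.swap) (simp only: scaleR_sum_right sum_distrib_left sum_distrib_right sum.distrib distrib_right)
    also have "\<dots> = ?V"
      by (simp only: sum[OF hol real] sum[OF hol'] real complex_cnj_mult)
    finally have "Op ((1 / (2 * pi)) *\<^sub>R (\<Sum>\<gamma>\<in>\<Delta>. slice_integral R \<phi> J \<gamma>)) = ?V" .
    from arg_cong[OF this, of op_vec] show ?thesis
      by (simp only: op_vec_Op)
  qed
  have "calculus T R \<Omega> \<phi> = op_vec ?V"
    unfolding calculus_def
  proof (rule the_equality)
    show "\<forall>U I \<Gamma>. bounded U \<and> slice_Cauchy_domain U \<and> S_spectrum T \<subseteq> U \<and> closure U \<subseteq> \<Omega> \<and>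
       norm I = 1 \<and> oriented_boundary \<Gamma> (slice I U) \<longrightarrow>
         op_vec ?V = (1 / (2 * pi)) *\<^sub>R (\<Sum>\<gamma>\<in>\<Gamma>. slice_integral R \<phi> I \<gamma>)"
      using val by blast
    show "A = op_vec ?V" if "\<forall>U I \<Gamma>. bounded U \<and> slice_Cauchy_domain U \<and> S_spectrum T \<subseteq> U \<and> closure U \<subseteq> \<Omega> \<and>
       norm I = 1 \<and> oriented_boundary \<Gamma> (slice I U) \<longrightarrow>
         A = (1 / (2 * pi)) *\<^sub>R (\<Sum>\<gamma>\<in>\<Gamma>. slice_integral R \<phi> I \<gamma>)" for A
    proof -
      have "A = (1 / (2 * pi)) *\<^sub>R (\<Sum>\<gamma>\<in>\<Gamma>. slice_integral R \<phi> I \<gamma>)"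
        using that U I \<Gamma> by blast
      then show ?thesis
        using val[OF U I \<Gamma>] by simp
    qed
  qed
  then show ?thesis
    by simp
qed

section \<open>The product rule\<close>

definition stem_int :: "('v::banach, 'n::{finite,linorder}) cl_op \<Rightarrow> (real \<Rightarrow> complex) set \<Rightarrow> nat \<Rightarrow>
    (complex \<Rightarrow> complex) \<Rightarrow> ('v, 'n) clifford_op" where
  "stem_int T \<Gamma> m F = real_cycle_int (neg_square T) m \<Gamma> (\<lambda>\<gamma>. \<gamma>) F"

text \<open>The Cauchy integral of \<open>F\<close> against \<open>(s + T) Q_s^-m\<close>, with
  \<open>T\<close> taken out to the left. Up to constants, \<open>m = 1\<close> is the S-functional
  calculus, \<open>m = \<alpha> + 1\<close> the Cliffordian one and \<open>m = h_n + 1\<close> the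
  F-functional calculus.\<close>

definition Cauchy_int :: "('v::banach, 'n::{finite,linorder}) cl_op \<Rightarrow> (real \<Rightarrow> complex) set \<Rightarrow> nat \<Rightarrow>
    (complex \<Rightarrow> complex) \<Rightarrow> ('v, 'n) clifford_op" where
  "Cauchy_int T \<Gamma> m F = stem_int T \<Gamma> m (\<lambda>z. z * F z) + Op T * stem_int T \<Gamma> m F"

lemma stem_int_zero [simp]: "stem_int T \<Gamma> m (\<lambda>z. 0) = 0"
  by (simp add: stem_int_def real_cycle_int_def real_integrand_def[abs_def])

lemma Cauchy_int_zero [simp]: "Cauchy_int T \<Gamma> m (\<lambda>z. 0) = 0"
  by (simp add: Cauchy_int_def)

text \<open>The kernel \<open>(c s + b) Q_s^-m\<close> is used with \<open>b = c T\<close>, because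
  \<open>- op_conj T = T\<close>, and then without the term in \<open>s\<close> and with the real
  multiple \<open>c\<close> of the unit as \<open>b\<close>.\<close>

lemma
  fixes T :: "('v::banach, 'n::{finite,linorder}) cl_op"
  assumes T: "T \<in> BC1" and U: "bounded U" "slice_Cauchy_domain U" "S_spectrum T \<subseteq> U" "closure U \<subseteq> \<Omega>"
    and \<Omega>: "open \<Omega>" "axially_symmetric \<Omega>" and stem: "stem TYPE('v) \<Omega> \<phi> \<Phi>"
    and I: "norm I = 1" and \<Gamma>: "oriented_boundary \<Gamma> (slice I U)"
  shows Op_Cauchy_calculus: "Op (calculus T (\<lambda>s. c *\<^sub>R ((cl_emb (cl_of_point s) - op_conj T) \<otimes>
        op_power (op_inv (Q_op T s)) m)) \<Omega> \<phi>) =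
      c *\<^sub>R (\<Sum>A\<in>UNIV. Cauchy_int T \<Gamma> m (\<Phi> A) * emb (axis A 1))"
    and Op_power_calculus: "Op (calculus T (\<lambda>s. c *\<^sub>R op_power (op_inv (Q_op T s)) m) \<Omega> \<phi>) =
      c *\<^sub>R (\<Sum>A\<in>UNIV. stem_int T \<Gamma> m (\<Phi> A) * emb (axis A 1))"
proof -
  have "Op (calculus T (\<lambda>s. c *\<^sub>R ((cl_emb (cl_of_point s) - op_conj T) \<otimes>
        op_power (op_inv (Q_op T s)) m)) \<Omega> \<phi>) = (\<Sum>A\<in>UNIV.
      (c *\<^sub>R real_cycle_int (neg_square T) m \<Gamma> (\<lambda>\<gamma>. \<gamma>) (\<lambda>z. z * \<Phi> A z) +
       (c *\<^sub>R Op T) * real_cycle_int (neg_square T) m \<Gamma> (\<lambda>\<gamma>. \<gamma>) (\<Phi> A)) * emb (axis A 1))"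
    by (rule calculus_eq[OF T U \<Omega> stem I \<Gamma>])
      (simp add: Op_simps Op_power Op_op_inv_Q_op[OF T] BC1_components(3)[OF T] emb_slice_point[OF T]
        scaleR_add_right distrib_right flip: emb_def)
  then show "Op (calculus T (\<lambda>s. c *\<^sub>R ((cl_emb (cl_of_point s) - op_conj T) \<otimes>
        op_power (op_inv (Q_op T s)) m)) \<Omega> \<phi>) =
      c *\<^sub>R (\<Sum>A\<in>UNIV. Cauchy_int T \<Gamma> m (\<Phi> A) * emb (axis A 1))"
    by (simp add: Cauchy_int_def stem_int_def scaleR_sum_right distrib_right scaleR_add_right)
  have "Op (calculus T (\<lambda>s. c *\<^sub>R op_power (op_inv (Q_op T s)) m) \<Omega> \<phi>) = (\<Sum>A\<in>UNIV.
      (0 *\<^sub>R real_cycle_int (neg_square T) m \<Gamma> (\<lambda>\<gamma>. \<gamma>) (\<lambda>z. z * \<Phi> A z) +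
       (c *\<^sub>R 1) * real_cycle_int (neg_square T) m \<Gamma> (\<lambda>\<gamma>. \<gamma>) (\<Phi> A)) * emb (axis A 1))"
    by (rule calculus_eq[OF T U \<Omega> stem I \<Gamma>]) (simp add: Op_simps Op_power Op_op_inv_Q_op[OF T])
  then show "Op (calculus T (\<lambda>s. c *\<^sub>R op_power (op_inv (Q_op T s)) m) \<Omega> \<phi>) =
      c *\<^sub>R (\<Sum>A\<in>UNIV. stem_int T \<Gamma> m (\<Phi> A) * emb (axis A 1))"
    by (simp add: stem_int_def scaleR_sum_right)
qed

text \<open>Since \<open>T\<close> commutes with the integrals and
  \<open>T^2 = - neg_square T\<close>, a product of two Cauchy integrals splits into a part without
  \<open>T\<close> and a multiple of \<open>T\<close>. The sums of these parts are given by the two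
  product formulas for resolvent powers, and recombine to the Cauchy integral of
  \<open>F G\<close>.\<close>

lemma Cauchy_int_product:
  fixes T :: "('v::banach, 'n::{finite,linorder}) cl_op"
  assumes T: "T \<in> BC1" and sur: "surrounds D (quadratic_spectrum (neg_square T)) \<Gamma> (\<lambda>\<gamma>. \<gamma>)"
    and D: "\<And>z. z \<in> D \<Longrightarrow> cnj z \<in> D"
    and F: "F holomorphic_on D" "\<And>z. z \<in> D \<Longrightarrow> F (cnj z) = cnj (F z)"
    and G: "G holomorphic_on D" "\<And>z. z \<in> D \<Longrightarrow> G (cnj z) = cnj (G z)"
  shows "Cauchy_int T \<Gamma> (Suc n) (\<lambda>z. F z * G z) =
    (\<Sum>k<Suc n. Cauchy_int T \<Gamma> (Suc k) F * Cauchy_int T \<Gamma> (Suc n - k) G) +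
    (\<Sum>k<n. stem_int T \<Gamma> (Suc k) F * stem_int T \<Gamma> (n - k) G)"
proof -
  obtain I :: "(real, 'n) vec" where I: "norm I = 1"
    using unit_vector_exists by blast
  interpret imaginary_unit_op "imag I" "neg_square T"
    by (rule imaginary_unit_op_imag[OF T I])
  let ?P = "stem_int T \<Gamma>" and ?t = "Op T"
  have zF: "(\<lambda>z. z * F z) holomorphic_on D" and zG: "(\<lambda>z. z * G z) holomorphic_on D"
    by (intro holomorphic_on_mult holomorphic_on_ident F G)+
  have P: "power_int m \<Gamma> (\<lambda>\<gamma>. \<gamma>) H = ?P m H"
    if "H holomorphic_on D" "\<And>z. z \<in> D \<Longrightarrow> H (cnj z) = cnj (H z)" for m H
    unfolding stem_int_def by (rule power_int_real[OF sur D that])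
  have PF: "power_int m \<Gamma> (\<lambda>\<gamma>. \<gamma>) F = ?P m F" "power_int m \<Gamma> (\<lambda>\<gamma>. \<gamma>) (\<lambda>z. z * F z) = ?P m (\<lambda>z. z * F z)"
    "power_int m \<Gamma> (\<lambda>\<gamma>. \<gamma>) G = ?P m G" "power_int m \<Gamma> (\<lambda>\<gamma>. \<gamma>) (\<lambda>z. z * G z) = ?P m (\<lambda>z. z * G z)"
    "power_int m \<Gamma> (\<lambda>\<gamma>. \<gamma>) (\<lambda>z. F z * G z) = ?P m (\<lambda>z. F z * G z)"
    "power_int m \<Gamma> (\<lambda>\<gamma>. \<gamma>) (\<lambda>z. z * (F z * G z)) = ?P m (\<lambda>z. z * (F z * G z))" for m
    by (rule P; use F G zF zG in \<open>auto intro: holomorphic_on_mult\<close>)+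
  note scalar = power_int_product_scalar[OF sur F(1) G(1), of n, unfolded PF]
  note mixed = power_int_product_mixed[OF sur F(1) G(1), of "Suc n", OF zero_less_Suc, unfolded PF]
  have comm: "?t * ?P m H = ?P m H * ?t" if "H holomorphic_on D" for m H
    unfolding stem_int_def by (rule real_cycle_int_commute[OF sur that neg_square_commute])
  have prod: "Cauchy_int T \<Gamma> i F * Cauchy_int T \<Gamma> k G =
      (?P i (\<lambda>z. z * F z) * ?P k (\<lambda>z. z * G z) - neg_square T * ?P i F * ?P k G) +
      ?t * (?P i (\<lambda>z. z * F z) * ?P k G + ?P i F * ?P k (\<lambda>z. z * G z))" for i k
  proof -
    have 1: "?P i (\<lambda>z. z * F z) * (?t * x) = ?t * (?P i (\<lambda>z. z * F z) * x)" for x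
      using comm[OF zF] by (simp only: mult.assoc[symmetric])
    have 2: "?t * ?P i F * (?t * x) = - neg_square T * ?P i F * x" for x
      using comm[OF F(1), of i] unfolding neg_square_def minus_minus
      by (metis mult.assoc)
    show ?thesis
      unfolding Cauchy_int_def distrib_left distrib_right 1 2
      by (simp add: mult.assoc algebra_simps)
  qed
  have "(\<Sum>k<Suc n. Cauchy_int T \<Gamma> (Suc k) F * Cauchy_int T \<Gamma> (Suc n - k) G) =
      (\<Sum>k<Suc n. ?P (Suc k) (\<lambda>z. z * F z) * ?P (Suc n - k) (\<lambda>z. z * G z)
        - neg_square T * ?P (Suc k) F * ?P (Suc n - k) G) + ?t * ?P (Suc n) (\<lambda>z. F z * G z)"
    unfolding mixed[symmetric] by (simp only: prod sum.distrib sum_distrib_left distrib_left)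
  then show ?thesis
    unfolding Cauchy_int_def[of _ _ "Suc n" "\<lambda>z. F z * G z"] scalar[symmetric] by (simp only: ac_simps)
qed

section \<open>The constants of the calculi\<close>

lemma pochhammer_minus_of_nat:
  assumes "k \<le> h"
  shows "pochhammer (- real h) k = (- 1) ^ k * fact h / fact (h - k)"
  using assms
proof (induction k)
  case (Suc k)
  define r where "r = real (h - k)"
  have "h - k = Suc (h - Suc k)"
    using Suc.prems by simp
  then have f: "fact (h - k) = r * fact (h - Suc k)" and "r \<noteq> 0"
    by (simp_all add: r_def)
  have "pochhammer (- real h) (Suc k) = (- 1) ^ k * fact h / fact (h - k) * (- r)"
    using Suc by (simp add: pochhammer_Suc of_nat_diff r_def)
  also have "\<dots> = (- 1) ^ Suc k * fact h / fact (h - Suc k)"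
    unfolding f using \<open>r \<noteq> 0\<close> by simp
  finally show ?case .
qed simp

text \<open>With \<open>h = i + k + 1\<close> the orders are \<open>k\<close> and
  \<open>i + 1\<close> in the first product, \<open>k + 1\<close> and \<open>i + 1\<close> in the
  second, of sum \<open>h\<close> and \<open>h + 1\<close>. The signs of the Pochhammer symbols
  multiply to \<open>(-1)^h\<close> and \<open>(-1)^(h + 1)\<close>; the latter accounts for the
  minus sign of the last sum of the theorem.\<close>

lemma calculus_constants:
  assumes "i < h"
  shows "(4 ^ (h - i - 1) * fact (h - i - 1) * pochhammer (- real h) (h - i - 1)) *
      (4 ^ (i + 1) * fact (i + 1) * pochhammer (- real h) (i + 1)) = (fact h)\<^sup>2 * 4 ^ h * (- 1) ^ h" (is ?C)
    and "(2 ^ (2 * (h - i) - 1) * fact (h - i - 1) * pochhammer (- real h) (h - i)) *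
      (2 ^ (2 * (i + 1) - 1) * fact (i + 1 - 1) * pochhammer (- real h) (i + 1)) = - ((fact h)\<^sup>2 * 4 ^ h * (- 1) ^ h)" (is ?D)
proof -
  obtain k where h: "h = Suc (i + k)"
    using assms less_iff_Suc_add by blast
  have diffs: "h - k = i + 1" "h - (i + 1) = k" "h - (k + 1) = i" "h - i = k + 1" "h - i - 1 = k"
    using h by auto
  have le: "k \<le> h" "i + 1 \<le> h" "k + 1 \<le> h"
    using h by auto
  have p: "pochhammer (- real h) k = (- 1) ^ k * fact h / fact (i + 1)"
    "pochhammer (- real h) (i + 1) = (- 1) ^ (i + 1) * fact h / fact k"
    "pochhammer (- real h) (k + 1) = (- 1) ^ (k + 1) * fact h / fact i"
    using le by (simp_all only: pochhammer_minus_of_nat diffs)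
  have sgn: "(- 1 :: real) ^ h = (- 1) ^ k * (- 1) ^ (i + 1)" "(4 :: real) ^ h = 4 ^ k * 4 ^ (i + 1)"
    by (simp_all add: h power_add)
  show ?C
    unfolding diffs(5) p sgn by (simp add: power2_eq_square del: fact_Suc power_Suc)
  have "2 * (k + 1) - 1 + (2 * (i + 1) - 1) = 2 * h"
    by (simp add: h)
  then have two: "(2::real) ^ (2 * (k + 1) - 1) * 2 ^ (2 * (i + 1) - 1) = 4 ^ h"
    by (simp only: power_add[symmetric]) (simp add: power_mult)
  have "(2 ^ (2 * (h - i) - 1) * fact (h - i - 1) * pochhammer (- real h) (h - i)) *
      (2 ^ (2 * (i + 1) - 1) * fact (i + 1 - 1) * pochhammer (- real h) (i + 1)) =
      (2 ^ (2 * (k + 1) - 1) * 2 ^ (2 * (i + 1) - 1)) * (fact k * fact i *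
        (pochhammer (- real h) (k + 1) * pochhammer (- real h) (i + 1)))"
    unfolding diffs by simp
  also have "\<dots> = - ((fact h)\<^sup>2 * 4 ^ h * (- 1) ^ h)"
    unfolding two p sgn(1) by (simp add: power2_eq_square)
  finally show ?D .
qed

theorem theorem7p13:
  fixes T :: "('v::banach, 'n::{finite,linorder}) cl_op"
    and U \<Omega>f \<Omega>g :: "'n point set"
    and f g :: "'n point \<Rightarrow> real ^ ('n set)"
    and n h :: nat
  assumes "n = CARD('n)" and "n \<ge> 3" and "odd n" and "h = (n - 1) div 2"
    and "T \<in> BC1"
    and "\<And>i. spectrum (component T i) \<subseteq> \<real>"
    and "bounded U" and "slice_Cauchy_domain U" and "S_spectrum T \<subseteq> U"
    and "intrinsic_slice_hyperholomorphic \<Omega>f f"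
    and "left_slice_hyperholomorphic \<Omega>g g"
    and "closure U \<subseteq> \<Omega>f \<inter> \<Omega>g"
  shows "F_calculus T (\<Omega>f \<inter> \<Omega>g) (\<lambda>x. f x \<odot> g x) =
      F_calculus T \<Omega>f f \<otimes> S_calculus T \<Omega>g g
    + S_calculus T \<Omega>f f \<otimes> F_calculus T \<Omega>g g
    + (\<Sum>i<h - 1. Cliffordian_calculus (h - i - 1) T \<Omega>f f \<otimes> Cliffordian_calculus (i + 1) T \<Omega>g g)
    - (\<Sum>i<h. polyharmonic_calculus (h - i) T \<Omega>f f \<otimes> polyharmonic_calculus (i + 1) T \<Omega>g g)"
proof -
  note T = assms(5) and U = assms(7-9)
  have clo: "closure U \<subseteq> \<Omega>f" "closure U \<subseteq> \<Omega>g" "closure U \<subseteq> \<Omega>f \<inter> \<Omega>g"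
    using assms(12) by auto
  have \<Omega>f: "open \<Omega>f" "axially_symmetric \<Omega>f" and \<Omega>g: "open \<Omega>g" "axially_symmetric \<Omega>g"
    using assms(10,11) by (auto simp: intrinsic_slice_hyperholomorphic_def left_slice_hyperholomorphic_def)
  then have \<Omega>: "open (\<Omega>f \<inter> \<Omega>g)" "axially_symmetric (\<Omega>f \<inter> \<Omega>g)"
    by (auto simp: axially_symmetric_def)
  obtain F where F: "stem TYPE('v) \<Omega>f f (\<lambda>A. if A = {} then F else (\<lambda>z. 0))"
    using intrinsic_slice_hyperholomorphic_stem[OF assms(10)] by blast
  obtain G where G: "stem TYPE('v) \<Omega>g g G"
    using left_slice_hyperholomorphic_stem[OF assms(11)] by blast
  note FG = stem_product[OF F G]
  obtain I :: "(real, 'n) vec" where I: "norm I = 1"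
    using unit_vector_exists by blast
  then obtain \<Gamma> where \<Gamma>: "oriented_boundary \<Gamma> (slice I U)"
    using assms(8) unfolding slice_Cauchy_domain_def by blast
  let ?C = "Cauchy_int T \<Gamma>" and ?P = "stem_int T \<Gamma>"
  let ?e = "\<lambda>A. emb (axis A 1) :: ('v, 'n) clifford_op"
  define D where "D = plane (\<Omega>f \<inter> \<Omega>g)"
  have F_D: "F holomorphic_on D" "\<And>z. z \<in> D \<Longrightarrow> F (cnj z) = cnj (F z)"
    using F[unfolded stem_def, THEN conjunct1, rule_format, of "{}"]
    by (auto simp: D_def plane_Int intro: holomorphic_on_subset)
  have G_D: "G A holomorphic_on D" "\<And>z. z \<in> D \<Longrightarrow> G A (cnj z) = cnj (G A z)" for A
    using G[unfolded stem_def, THEN conjunct1, rule_format, of A]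
    by (auto simp: D_def plane_Int intro: holomorphic_on_subset)
  have product: "?C (h + 1) (\<lambda>z. F z * G A z) =
      (\<Sum>k<h + 1. ?C (k + 1) F * ?C (h + 1 - k) (G A)) + (\<Sum>k<h. ?P (k + 1) F * ?P (h - k) (G A))" for A
    using Cauchy_int_product[OF T admissible_surrounds[OF T U clo(3) \<Omega> I \<Gamma>, folded D_def] _ F_D G_D, of h A]
    by (simp add: D_def cnj_plane)

  \<comment> \<open>For \<open>f\<close> only the component \<open>A = {}\<close> is present, so
    each of its calculi is a single integral without basis elements.\<close>
  have left: "(\<Sum>A\<in>UNIV. X (if A = {} then F else (\<lambda>z. 0)) * ?e A) = X F" if "X (\<lambda>z. 0) = 0"
    for X :: "(complex \<Rightarrow> complex) \<Rightarrow> ('v, 'n) clifford_op"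
  proof -
    have "(\<Sum>A\<in>UNIV. X (if A = {} then F else (\<lambda>z. 0)) * ?e A) =
        (\<Sum>A\<in>(UNIV :: 'n set set). if A = {} then X F * ?e {} else 0)"
      using that by (intro sum.cong) auto
    then show ?thesis
      by (simp add: emb_axis_empty)
  qed
  note Cf = Op_Cauchy_calculus[OF T U clo(1) \<Omega>f F I \<Gamma>, unfolded left[of "?C m" for m, OF Cauchy_int_zero]]
  note Pf = Op_power_calculus[OF T U clo(1) \<Omega>f F I \<Gamma>, unfolded left[of "?P m" for m, OF stem_int_zero]]
  note Cg = Op_Cauchy_calculus[OF T U clo(2) \<Omega>g G I \<Gamma>]
  note Pg = Op_power_calculus[OF T U clo(2) \<Omega>g G I \<Gamma>]
  note Cfg = Op_Cauchy_calculus[OF T U clo(3) \<Omega> FG I \<Gamma>]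

  have h: "h_of TYPE('n) = h" "CARD('n) = 2 * h + 1" "h > 0"
    using assms(1-4) by (auto simp: h_of_def elim!: oddE)
  define c where "c = (fact h)\<^sup>2 * 4 ^ h * (- 1 :: real) ^ h"
  \<comment> \<open>As \<open>(n + 1) / 2 = h + 1\<close>, the Gamma factor is \<open>h!\<close>,
    which gives the common value of the products of constants.\<close>
  have gamma: "gamma_of TYPE('n) = c"
  proof -
    have "(real CARD('n) + 1) / 2 = 1 + real h"
      by (simp add: h(2))
    then have "Gamma ((real CARD('n) + 1) / 2) = fact h"
      by (simp only: Gamma_fact)
    then show ?thesis
      by (simp add: gamma_of_def h(2) c_def power_mult)
  qed
  \<comment> \<open>The S-functional calculus is brought into the general form, with constant
    \<open>1\<close> and exponent \<open>1\<close>.\<close>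
  have S: "S_calculus T = calculus T (\<lambda>s. 1 *\<^sub>R ((cl_emb (cl_of_point s) - op_conj T) \<otimes> op_power (op_inv (Q_op T s)) 1))"
    by (simp add: S_calculus_def op_power_def op_times_one)
  let ?a = "\<lambda>\<alpha>. 4 ^ \<alpha> * fact \<alpha> * pochhammer (- real h) \<alpha>"
  let ?b = "\<lambda>l. 2 ^ (2 * l - 1) * fact (l - 1) * pochhammer (- real h) l"
  \<comment> \<open>The terms \<open>k = 0\<close> and \<open>k = h\<close> are the products of an
    S-calculus and an F-calculus. The remaining \<open>h - 1\<close> terms, in reversed order, are
    the Cliffordian ones; for \<open>h = 1\<close> there are none.\<close>
  have reindex: "(\<Sum>k<h + 1. ?C (k + 1) F * ?C (h + 1 - k) (G A)) =
      ?C (h + 1) F * ?C 1 (G A) + ?C 1 F * ?C (h + 1) (G A) +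
      (\<Sum>i<h - 1. ?C (h - i - 1 + 1) F * ?C (i + 1 + 1) (G A))" for A
  proof -
    obtain m where m: "h = Suc m"
      using h(3) gr0_implies_Suc by blast
    have "(\<Sum>k<h + 1. ?C (k + 1) F * ?C (h + 1 - k) (G A)) =
        ?C 1 F * ?C (h + 1) (G A) + (\<Sum>k<m. ?C (k + 2) F * ?C (h - k) (G A)) + ?C (h + 1) F * ?C 1 (G A)"
    proof -
      have split: "(\<Sum>k<h + 1. g k) = g 0 + (\<Sum>k<m. g (Suc k)) + g (Suc m)" for g :: "nat \<Rightarrow> ('v, 'n) clifford_op"
        by (simp only: m Suc_eq_plus1[symmetric] sum.lessThan_Suc_shift[of _ "Suc m"] sum.lessThan_Suc[of _ m] add.assoc)
      show ?thesis
        unfolding split by (simp add: m)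
    qed
    also have "(\<Sum>k<m. ?C (k + 2) F * ?C (h - k) (G A)) =
        (\<Sum>i<m. ?C (m - Suc i + 2) F * ?C (h - (m - Suc i)) (G A))"
      by (rule sum.nat_diff_reindex[symmetric])
    also have "\<dots> = (\<Sum>i<h - 1. ?C (h - i - 1 + 1) F * ?C (i + 1 + 1) (G A))"
    proof (rule sum.cong)
      fix i assume "i \<in> {..<h - 1}"
      then have "m - Suc i + 2 = h - i - 1 + 1" "h - (m - Suc i) = i + 1 + 1"
        using m by auto
      then show "?C (m - Suc i + 2) F * ?C (h - (m - Suc i)) (G A) = ?C (h - i - 1 + 1) F * ?C (i + 1 + 1) (G A)"
        by simp
    qed (simp add: m)
    finally show ?thesis
      by (simp only: ac_simps)
  qed
  \<comment> \<open>The substitution \<open>k = h - 1 - i\<close> makes the exponents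
    \<open>h - i\<close> and \<open>i + 1\<close>, the orders of the polyharmonic calculi.\<close>
  have reindex': "(\<Sum>k<h. ?P (k + 1) F * ?P (h - k) (G A)) = (\<Sum>i<h. ?P (h - i) F * ?P (i + 1) (G A))" for A
  proof -
    have "(\<Sum>k<h. ?P (k + 1) F * ?P (h - k) (G A)) = (\<Sum>i<h. ?P (h - Suc i + 1) F * ?P (h - (h - Suc i)) (G A))"
      by (rule sum.nat_diff_reindex[symmetric])
    also have "\<dots> = (\<Sum>i<h. ?P (h - i) F * ?P (i + 1) (G A))"
      by (intro sum.cong refl) (simp add: Suc_diff_Suc)
    finally show ?thesis .
  qed

  have 1: "Op (F_calculus T \<Omega>f f \<otimes> S_calculus T \<Omega>g g) = c *\<^sub>R (\<Sum>A\<in>UNIV. ?C (h + 1) F * ?C 1 (G A) * ?e A)"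
    unfolding Op_simps F_calculus_def S Cf Cg h(1) gamma by (simp add: sum_distrib_left mult.assoc scaleR_sum_right)
  have 2: "Op (S_calculus T \<Omega>f f \<otimes> F_calculus T \<Omega>g g) = c *\<^sub>R (\<Sum>A\<in>UNIV. ?C 1 F * ?C (h + 1) (G A) * ?e A)"
    unfolding Op_simps F_calculus_def S Cf Cg h(1) gamma by (simp add: sum_distrib_left mult.assoc scaleR_sum_right)
  have 3: "Op (Cliffordian_calculus (h - i - 1) T \<Omega>f f \<otimes> Cliffordian_calculus (i + 1) T \<Omega>g g) =
      c *\<^sub>R (\<Sum>A\<in>UNIV. ?C (h - i - 1 + 1) F * ?C (i + 1 + 1) (G A) * ?e A)" if "i < h - 1" for i
  proof -
    have const: "?a (i + 1) * ?a (h - i - 1) = c"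
      unfolding c_def by (subst mult.commute, rule calculus_constants(1)) (use that in simp)
    show ?thesis
      unfolding Op_simps Cliffordian_calculus_def Cf Cg h(1) mult_scaleR_left mult_scaleR_right scaleR_scaleR const
      by (simp only: sum_distrib_left mult.assoc)
  qed
  have 4: "Op (polyharmonic_calculus (h - i) T \<Omega>f f \<otimes> polyharmonic_calculus (i + 1) T \<Omega>g g) =
      - (c *\<^sub>R (\<Sum>A\<in>UNIV. ?P (h - i) F * ?P (i + 1) (G A) * ?e A))" if "i < h" for i
  proof -
    have const: "?b (i + 1) * ?b (h - i) = - c"
      unfolding c_def by (subst mult.commute, rule calculus_constants(2)[OF that])
    show ?thesis
      unfolding Op_simps polyharmonic_calculus_def Pf Pg h(1) mult_scaleR_left mult_scaleR_right scaleR_scaleR const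
      by (simp only: sum_distrib_left mult.assoc scaleR_minus_left)
  qed
  have "Op (F_calculus T (\<Omega>f \<inter> \<Omega>g) (\<lambda>x. f x \<odot> g x)) =
      c *\<^sub>R (\<Sum>A\<in>UNIV. ?C (h + 1) (\<lambda>z. F z * G A z) * ?e A)"
    unfolding F_calculus_def Cfg h(1) gamma ..
  \<comment> \<open>The factors \<open>e_A\<close> stay on the right, so the product formula is
    applied to each component and summed. The double negation in the last sum prepares the negative
    constant of the polyharmonic products.\<close>
  also have "\<dots> = c *\<^sub>R (\<Sum>A\<in>UNIV. ?C (h + 1) F * ?C 1 (G A) * ?e A) + c *\<^sub>R (\<Sum>A\<in>UNIV. ?C 1 F * ?C (h + 1) (G A) * ?e A)
      + (\<Sum>i<h - 1. c *\<^sub>R (\<Sum>A\<in>UNIV. ?C (h - i - 1 + 1) F * ?C (i + 1 + 1) (G A) * ?e A))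
      - (\<Sum>i<h. - (c *\<^sub>R (\<Sum>A\<in>UNIV. ?P (h - i) F * ?P (i + 1) (G A) * ?e A)))"
    unfolding product reindex reindex' distrib_right sum.distrib sum_distrib_right scaleR_add_right
      scaleR_sum_right[symmetric] sum_negf
      sum.swap[of _ "{..<h - 1}" "UNIV :: 'n set set"] sum.swap[of _ "{..<h}" "UNIV :: 'n set set"]
    by (simp only: diff_minus_eq_add)
  also have "\<dots> = Op (F_calculus T \<Omega>f f \<otimes> S_calculus T \<Omega>g g
    + S_calculus T \<Omega>f f \<otimes> F_calculus T \<Omega>g g
    + (\<Sum>i<h - 1. Cliffordian_calculus (h - i - 1) T \<Omega>f f \<otimes> Cliffordian_calculus (i + 1) T \<Omega>g g)
    - (\<Sum>i<h. polyharmonic_calculus (h - i) T \<Omega>f f \<otimes> polyharmonic_calculus (i + 1) T \<Omega>g g))"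
    unfolding Op_simps(1,2) Op_sum 1 2
    by (intro arg_cong2[where f = minus] arg_cong2[where f = plus] refl sum.cong 3[symmetric] 4[symmetric]) auto
  finally show ?thesis
    by (simp only: Op_eq_iff)
qed

end
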